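(* Let $(X_i)_{i\in\mathbb{Z}^d}$ be the stationary centered random field $X_i=g(\varepsilon_{i-s};\,s\in\mathbb{Z}^d)$, with $X_0\in\mathbb{L}^2$, and assume that $\Delta_2:=\sum_{i\in\mathbb{Z}^d}\delta_{i,2}<\infty$. Let $(\Gamma_n)_{n\ge 1}$ be a sequence of finite subsets of $\mathbb{Z}^d$ such that $|\Gamma_n|\to\infty$, put $S_{\Gamma_n}=\sum_{i\in\Gamma_n}X_i$, and assume that $\sigma_n^2:=\mathbb{E}(S_{\Gamma_n}^2)\to\infty$. Then $$L\left[\frac{S_{\Gamma_n}}{\sqrt{|\Gamma_n|}},\;N\left(0,\frac{\sigma_n^2}{|\Gamma_n|}\right)\right]\to 0\quad\text{as } n\to\infty,$$ where $L[\cdot,\cdot]$ denotes the Lévy distance between probability distributions on $\mathbb{R}$.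
   Context: $d\ge1$ is an integer, $(\varepsilon_j)_{j\in\mathbb{Z}^d}$ are i.i.d. random variables, $g$ is a measurable function, and $X_i=g(\varepsilon_{i-s};\,s\in\mathbb{Z}^d)$ for $i\in\mathbb{Z}^d$. "Centered" means $\mathbb{E}X_0=0$. Let $(\varepsilon'_j)_{j\in\mathbb{Z}^d}$ be an i.i.d. copy of $(\varepsilon_j)_{j\in\mathbb{Z}^d}$ (independent of it), let $\varepsilon^*_j=\varepsilon_j$ if $j\ne0$ and $\varepsilon^*_0=\varepsilon'_0$, and set $X_i^*=g(\varepsilon^*_{i-s};\,s\in\mathbb{Z}^d)$. The physical dependence measure is $\delta_{i,p}=\|X_i-X_i^*\|_p$. $|\Gamma|$ denotes the cardinality of $\Gamma$. In $L[Z,N(0,v)]$ the random variable $Z$ stands for its law, and $N(0,v)$ is the centered Gaussian law with variance $v$. *)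

theory Defs
  imports "HOL-Probability.Probability"
begin

definition iid_family :: "'w measure \<Rightarrow> 'e measure \<Rightarrow> ('i \<Rightarrow> 'w \<Rightarrow> 'e) \<Rightarrow> bool" where
  "iid_family M E \<epsilon> \<longleftrightarrow>
     prob_space.indep_vars M (\<lambda>_. E) \<epsilon> UNIV \<and>
     (\<forall>j k. distr M E (\<epsilon> j) = distr M E (\<epsilon> k))"

definition indep_iid_copy ::
    "'w measure \<Rightarrow> 'e measure \<Rightarrow> ('i \<Rightarrow> 'w \<Rightarrow> 'e) \<Rightarrow> ('i \<Rightarrow> 'w \<Rightarrow> 'e) \<Rightarrow> bool" where
  "indep_iid_copy M E \<epsilon> \<epsilon>' \<longleftrightarrow>
     iid_family M E \<epsilon>' \<and>
     (\<forall>j. distr M E (\<epsilon>' j) = distr M E (\<epsilon> j)) \<and>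
     prob_space.indep_var M
       (PiM UNIV (\<lambda>_. E)) (\<lambda>\<omega> j. \<epsilon> j \<omega>)
       (PiM UNIV (\<lambda>_. E)) (\<lambda>\<omega> j. \<epsilon>' j \<omega>)"

text \<open>Points of the \<open>d\<close>-dimensional integer lattice are elements of \<open>int ^ 'd\<close>, where
  \<open>d = CARD('d)\<close>.\<close>

definition random_field ::
    "((int ^ 'd \<Rightarrow> 'e) \<Rightarrow> real) \<Rightarrow> (int ^ 'd \<Rightarrow> 'w \<Rightarrow> 'e) \<Rightarrow> int ^ 'd \<Rightarrow> 'w \<Rightarrow> real" where
  "random_field g \<epsilon> i \<omega> = g (\<lambda>s. \<epsilon> (i - s) \<omega>)"

definition coupled_innovations ::
    "(int ^ 'd \<Rightarrow> 'w \<Rightarrow> 'e) \<Rightarrow> (int ^ 'd \<Rightarrow> 'w \<Rightarrow> 'e) \<Rightarrow> int ^ 'd \<Rightarrow> 'w \<Rightarrow> 'e" where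
  "coupled_innovations \<epsilon> \<epsilon>' j = (if j = 0 then \<epsilon>' 0 else \<epsilon> j)"

text \<open>The Bochner integral of a non-integrable function is \<open>0\<close>, so \<open>Lp_norm M p Z\<close> is the
  \<open>p\<close>-norm only for \<open>Z\<close> in \<open>L\<^sup>p\<close>.\<close>

definition Lp_norm :: "'w measure \<Rightarrow> real \<Rightarrow> ('w \<Rightarrow> real) \<Rightarrow> real" where
  "Lp_norm M p Z = (\<integral>\<omega>. \<bar>Z \<omega>\<bar> powr p \<partial>M) powr (1 / p)"

definition phys_dep ::
    "'w measure \<Rightarrow> ((int ^ 'd \<Rightarrow> 'e) \<Rightarrow> real) \<Rightarrow> (int ^ 'd \<Rightarrow> 'w \<Rightarrow> 'e) \<Rightarrow>
      (int ^ 'd \<Rightarrow> 'w \<Rightarrow> 'e) \<Rightarrow> int ^ 'd \<Rightarrow> real \<Rightarrow> real" where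
  "phys_dep M g \<epsilon> \<epsilon>' i p =
     Lp_norm M p (\<lambda>\<omega>. random_field g \<epsilon> i \<omega> - random_field g (coupled_innovations \<epsilon> \<epsilon>') i \<omega>)"

definition Levy_distance :: "real measure \<Rightarrow> real measure \<Rightarrow> real" where
  "Levy_distance \<mu> \<nu> =
     Inf {e. e > 0 \<and> (\<forall>x. cdf \<mu> (x - e) - e \<le> cdf \<nu> x \<and> cdf \<nu> x \<le> cdf \<mu> (x + e) + e)}"

text \<open>\<open>normal_density\<close> takes the standard deviation and has no meaning for standard deviation
  \<open>0\<close>; the Gaussian law with variance \<open>0\<close> is the point mass at the mean.\<close>

definition centered_normal :: "real \<Rightarrow> real measure" where
  "centered_normal v =
     (if v = 0 then return borel 0
      else density lborel (\<lambda>x. ennreal (normal_density 0 (sqrt v) x)))"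

end

(* Efron-Stein: the variance of F is at most half the sum over a of the squared L2 change of F
   when the innovation at site a is replaced by an independent copy.  For F the sum of X_i over a
   finite set Gamma this gives |S|_2 <= sqrt |Gamma| * Delta_2.  Applied to X - Z, where Z is the
   centred conditional expectation of a truncation of X given finitely many innovations, it shows
   that S / sqrt |Gamma| is close in L2, uniformly in Gamma, to the same sum for the bounded,
   finitely dependent field Z.  For that field, Stein's method for characteristic functions
   compares psi(s) = E exp(i s S) with the solution of psi' = - s v psi, where v = E S^2, and the
   error vanishes like 1 / sqrt |Gamma|.  So the characteristic functions of the two laws are
   asymptotically equal; as the variances stay below Delta_2^2, Levy's continuity theorem along
   subsequences yields convergence of the Levy distance. *)

theory Submission
  imports Defs
begin

section \<open>Square integrable functions\<close>

text \<open>The sets \<open>\<Gamma> n\<close> have no prescribed shape: no boundary condition is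
  assumed and the normalised variances need not converge, so there need be no limit law. Hence every
  estimate sees the set only through its cardinality, and the comparison Gaussian keeps the variance
  of the sum being studied. One device handles independence: on the product of two copies of the
  configuration space, exchanging the coordinates in a set \<open>B\<close> preserves the measure.
  This gives the law of a resampled configuration, the product rule for functions of disjoint
  coordinates, and the factor 1/2 in Efron-Stein. Conditional expectations are integrals over
  resampled coordinates, so neither a filtration nor an ordering of the lattice enters. Efron-Stein
  is first proved for finite resampled sets. A configuration has infinitely many coordinates, so the
  step to the variance needs that a square integrable function hardly changes when everything
  outside a large finite set is resampled. The differential equation is compared through an
  integrating factor; the resulting error carries no factor growing with \<open>v\<close> and allows
  \<open>v = 0\<close>.\<close>

definition square_integrable :: "'a measure \<Rightarrow> ('a \<Rightarrow> real) \<Rightarrow> bool" where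
  "square_integrable M f \<longleftrightarrow> f \<in> borel_measurable M \<and> integrable M (\<lambda>x. (f x)\<^sup>2)"

definition l2norm :: "'a measure \<Rightarrow> ('a \<Rightarrow> real) \<Rightarrow> real" where
  "l2norm M f = sqrt (\<integral>x. (f x)\<^sup>2 \<partial>M)"

lemma square_integrable_measurable [measurable_dest]:
  "square_integrable M f \<Longrightarrow> f \<in> borel_measurable M"
  by (simp add: square_integrable_def)

lemma l2norm_nonneg [simp]: "0 \<le> l2norm M f"
  by (simp add: l2norm_def)

lemma l2norm_power2: "(l2norm M f)\<^sup>2 = (\<integral>x. (f x)\<^sup>2 \<partial>M)"
  by (simp add: l2norm_def)

lemma square_integrable_mult:
  assumes "square_integrable M f" "square_integrable M g"
  shows "integrable M (\<lambda>x. f x * g x)"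
proof (rule Bochner_Integration.integrable_bound)
  show "integrable M (\<lambda>x. (f x)\<^sup>2 + (g x)\<^sup>2)"
    using assms by (auto simp: square_integrable_def)
  show "(\<lambda>x. f x * g x) \<in> borel_measurable M"
    using assms by (auto simp: square_integrable_def)
  have "\<bar>f x * g x\<bar> \<le> (f x)\<^sup>2 + (g x)\<^sup>2" for x
    using sum_squares_bound[of "\<bar>f x\<bar>" "\<bar>g x\<bar>"] abs_ge_zero[of "f x * g x"]
    unfolding abs_mult power2_abs by linarith
  then show "AE x in M. norm (f x * g x) \<le> norm ((f x)\<^sup>2 + (g x)\<^sup>2)"
    by (auto intro!: AE_I2)
qed

lemma square_integrable_cmult:
  assumes "square_integrable M f" shows "square_integrable M (\<lambda>x. c * f x)"
  using assms by (auto simp: square_integrable_def power_mult_distrib)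

lemma square_integrable_add:
  assumes "square_integrable M f" "square_integrable M g"
  shows "square_integrable M (\<lambda>x. f x + g x)"
  using assms square_integrable_mult[OF assms]
  by (auto simp: square_integrable_def power2_sum mult.assoc)

lemma square_integrable_diff:
  assumes "square_integrable M f" "square_integrable M g"
  shows "square_integrable M (\<lambda>x. f x - g x)"
  using square_integrable_add[OF assms(1) square_integrable_cmult[OF assms(2), of "-1"]] by simp

lemma square_integrable_sum:
  assumes "\<And>i. i \<in> I \<Longrightarrow> square_integrable M (f i)"
  shows "square_integrable M (\<lambda>x. \<Sum>i\<in>I. f i x)"
  using assms
proof (induction I rule: infinite_finite_induct)
  case (insert i I)
  then show ?case by (auto intro: square_integrable_add)
qed (auto simp: square_integrable_def)

text \<open>Cauchy-Schwarz, by expanding the square of \<open>?b * f - ?a * g\<close> with the two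
  norms as coefficients. The last step cancels \<open>?a * ?b\<close>, so a vanishing norm is
  treated apart: then the product is zero almost everywhere.\<close>

lemma integral_mult_le_l2norm:
  assumes "square_integrable M f" "square_integrable M g"
  shows "(\<integral>x. f x * g x \<partial>M) \<le> l2norm M f * l2norm M g"
proof -
  have null: "(\<integral>x. f x * g x \<partial>M) = 0"
    if "l2norm M f = 0" "square_integrable M f" "square_integrable M g" for f g
  proof -
    have "(\<integral>x. (f x)\<^sup>2 \<partial>M) = 0"
      using that(1) by (simp add: l2norm_def)
    then have "AE x in M. (f x)\<^sup>2 = 0"
      using that(2) by (subst (asm) integral_nonneg_eq_0_iff_AE) (auto simp: square_integrable_def)
    then have "AE x in M. f x * g x = 0" by eventually_elim auto
    then show ?thesis by (rule integral_eq_zero_AE)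
  qed
  show ?thesis
  proof (cases "l2norm M f = 0 \<or> l2norm M g = 0")
    case True
    then show ?thesis
      using null[of f g] null[of g f] assms by (auto simp: mult.commute)
  next
    case False
    let ?a = "l2norm M f" and ?b = "l2norm M g"
    have pos: "?a > 0" "?b > 0" using False l2norm_nonneg[of M f] l2norm_nonneg[of M g] by linarith+
    have int: "integrable M (\<lambda>x. (f x)\<^sup>2)" "integrable M (\<lambda>x. (g x)\<^sup>2)" "integrable M (\<lambda>x. f x * g x)"
      using assms square_integrable_mult[OF assms] by (auto simp: square_integrable_def)
    have "0 \<le> (\<integral>x. (?b * f x - ?a * g x)\<^sup>2 \<partial>M)" by simp
    also have "\<dots> = (\<integral>x. ?b\<^sup>2 * (f x)\<^sup>2 + ?a\<^sup>2 * (g x)\<^sup>2 - 2 * ?a * ?b * (f x * g x) \<partial>M)"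
      by (intro Bochner_Integration.integral_cong) (auto simp: power2_eq_square algebra_simps)
    also have "\<dots> = ?b\<^sup>2 * ?a\<^sup>2 + ?a\<^sup>2 * ?b\<^sup>2 - 2 * ?a * ?b * (\<integral>x. f x * g x \<partial>M)"
      using int by (simp add: l2norm_power2)
    finally have "?a * ?b * (\<integral>x. f x * g x \<partial>M) \<le> ?a * ?b * (?a * ?b)"
      by (simp add: power2_eq_square algebra_simps)
    then show ?thesis using pos by simp
  qed
qed

lemma l2norm_add_le:
  assumes "square_integrable M f" "square_integrable M g"
  shows "l2norm M (\<lambda>x. f x + g x) \<le> l2norm M f + l2norm M g"
proof (rule power2_le_imp_le)
  have "(l2norm M (\<lambda>x. f x + g x))\<^sup>2 = (\<integral>x. (f x)\<^sup>2 + (g x)\<^sup>2 + 2 * (f x * g x) \<partial>M)"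
    unfolding l2norm_power2
    by (intro Bochner_Integration.integral_cong) (auto simp: power2_eq_square algebra_simps)
  also have "\<dots> = (l2norm M f)\<^sup>2 + (l2norm M g)\<^sup>2 + 2 * (\<integral>x. f x * g x \<partial>M)"
    using assms square_integrable_mult[OF assms] by (simp add: square_integrable_def l2norm_power2)
  also have "\<dots> \<le> (l2norm M f)\<^sup>2 + (l2norm M g)\<^sup>2 + 2 * (l2norm M f * l2norm M g)"
    using integral_mult_le_l2norm[OF assms] by simp
  finally show "(l2norm M (\<lambda>x. f x + g x))\<^sup>2 \<le> (l2norm M f + l2norm M g)\<^sup>2"
    by (simp add: power2_sum)
qed simp

lemma l2norm_diff_le:
  assumes "square_integrable M f" "square_integrable M g"
  shows "l2norm M (\<lambda>x. f x - g x) \<le> l2norm M f + l2norm M g"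
  using l2norm_add_le[OF assms(1) square_integrable_cmult[OF assms(2), of "-1"]]
  by (simp add: l2norm_def)

lemma l2norm_le_add_diff:
  assumes "square_integrable M f" "square_integrable M g"
  shows "l2norm M f \<le> l2norm M g + l2norm M (\<lambda>x. f x - g x)"
  using l2norm_add_le[OF assms(2) square_integrable_diff[OF assms]] by simp

lemma l2norm_mono:
  assumes "square_integrable M g" "f \<in> borel_measurable M" "\<And>x. x \<in> space M \<Longrightarrow> \<bar>f x\<bar> \<le> \<bar>g x\<bar>"
  shows "square_integrable M f" "l2norm M f \<le> l2norm M g"
proof -
  have g: "integrable M (\<lambda>x. (g x)\<^sup>2)" using assms(1) by (simp add: square_integrable_def)
  have le: "(f x)\<^sup>2 \<le> (g x)\<^sup>2" if "x \<in> space M" for x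
    using assms(3)[OF that] by (simp add: abs_le_square_iff)
  have f: "integrable M (\<lambda>x. (f x)\<^sup>2)"
    by (rule Bochner_Integration.integrable_bound[OF g]) (use assms(2) le in auto)
  then show "square_integrable M f" using assms(2) by (simp add: square_integrable_def)
  show "l2norm M f \<le> l2norm M g"
    unfolding l2norm_def by (intro real_sqrt_le_mono integral_mono f g le)
qed

text \<open>Change of variables for a measure-preserving map. Resampling, exchange, translation and
  the joint law of the innovations with their copy all enter the L2 estimates in this form.\<close>

lemma l2norm_distr:
  assumes "T \<in> measurable M M'" "distr M M' T = M'" "square_integrable M' f"
  shows "square_integrable M (\<lambda>x. f (T x))" "l2norm M (\<lambda>x. f (T x)) = l2norm M' f"
proof -
  have f: "f \<in> borel_measurable M'" "integrable M' (\<lambda>x. (f x)\<^sup>2)"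
    using assms(3) by (auto simp: square_integrable_def)
  have "integrable (distr M M' T) (\<lambda>x. (f x)\<^sup>2)" using f assms(2) by simp
  then have "integrable M (\<lambda>x. (f (T x))\<^sup>2)"
    by (rule integrable_distr[OF assms(1)])
  then show "square_integrable M (\<lambda>x. f (T x))"
    using measurable_compose[OF assms(1) f(1)] by (simp add: square_integrable_def)
  have "(\<integral>x. (f x)\<^sup>2 \<partial>M') = (\<integral>x. (f x)\<^sup>2 \<partial>distr M M' T)" using assms(2) by simp
  also have "\<dots> = (\<integral>x. (f (T x))\<^sup>2 \<partial>M)"
    by (rule integral_distr[OF assms(1)]) (use f in simp)
  finally show "l2norm M (\<lambda>x. f (T x)) = l2norm M' f" by (simp add: l2norm_def)
qed

context prob_space
begin

lemma square_integrable_bounded: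
  assumes [measurable]: "f \<in> borel_measurable M" and "\<And>x. x \<in> space M \<Longrightarrow> \<bar>f x\<bar> \<le> K"
  shows "square_integrable M f"
  unfolding square_integrable_def
proof
  show "integrable M (\<lambda>x. (f x)\<^sup>2)"
  proof (rule integrable_const_bound[where B = "K\<^sup>2"])
    have "norm ((f x)\<^sup>2) \<le> K\<^sup>2" if "x \<in> space M" for x
      using power_mono[OF assms(2)[OF that] abs_ge_zero, of 2] by simp
    then show "AE x in M. norm ((f x)\<^sup>2) \<le> K\<^sup>2" by (auto intro!: AE_I2)
  qed simp
qed (rule assms)

lemma square_integrable_const: "square_integrable M (\<lambda>x. c)"
  by (simp add: square_integrable_def)

lemma l2norm_const [simp]: "l2norm M (\<lambda>x. c) = \<bar>c\<bar>"
  by (simp add: l2norm_def prob_space)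

lemma square_integrable_integrable:
  assumes "square_integrable M f" shows "integrable M f"
  using square_integrable_mult[OF assms square_integrable_const[of 1]] by simp

lemma integral_abs_le_l2norm:
  assumes "square_integrable M f" shows "(\<integral>x. \<bar>f x\<bar> \<partial>M) \<le> l2norm M f"
  using integral_mult_le_l2norm[OF _ square_integrable_const[of 1], of "\<lambda>x. \<bar>f x\<bar>"] assms
  by (simp add: square_integrable_def l2norm_def prob_space)

lemma abs_integral_le_l2norm:
  assumes "square_integrable M f" shows "\<bar>\<integral>x. f x \<partial>M\<bar> \<le> l2norm M f"
  using integral_abs_le_l2norm[OF assms] integral_abs_bound[of M f] by linarith

end

section \<open>Product measures and resampling\<close>

text \<open>With \<open>B = {a}\<close> this is the single-site coupling behind the physical
  dependence measure. With the fresh configuration as first argument it plays the opposite role: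
  only the coordinates in \<open>B\<close> are kept.\<close>

definition resample :: "'i set \<Rightarrow> ('i \<Rightarrow> 'e) \<Rightarrow> ('i \<Rightarrow> 'e) \<Rightarrow> 'i \<Rightarrow> 'e" where
  "resample B x y = (\<lambda>j. if j \<in> B then y j else x j)"

lemma resample_empty [simp]: "resample {} x y = x"
  by (simp add: resample_def)

lemma measurable_resample [measurable]:
  assumes [measurable]: "f \<in> measurable K (PiM UNIV (\<lambda>_. N))" "g \<in> measurable K (PiM UNIV (\<lambda>_. N))"
  shows "(\<lambda>z. resample B (f z) (g z)) \<in> measurable K (PiM UNIV (\<lambda>_. N))"
  unfolding resample_def
proof (rule measurable_abs_UNIV)
  fix j
  have "(\<lambda>z. f z j) \<in> measurable K N" "(\<lambda>z. g z j) \<in> measurable K N"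
    by measurable
  then show "(\<lambda>z. if j \<in> B then g z j else f z j) \<in> measurable K N"
    by (cases "j \<in> B") auto
qed

text \<open>Two independent configurations are one configuration indexed by
  \<open>'i \<times> bool\<close>. Seen this way, swapping some coordinates between the copies is a
  permutation of the index set, under which a product of equal factors is invariant. The identity is
  checked on finite cylinders.\<close>

lemma distr_pair_PiM_join:
  fixes N :: "'e measure"
  assumes "prob_space N"
  defines "P \<equiv> PiM (UNIV :: 'i set) (\<lambda>_. N)" and "Q \<equiv> PiM (UNIV :: ('i \<times> bool) set) (\<lambda>_. N)"
  shows "distr (P \<Otimes>\<^sub>M P) Q (\<lambda>z p. if snd p then snd z (fst p) else fst z (fst p)) = Q" (is "distr _ _ ?\<Psi> = _")
proof -
  interpret N: prob_space N by fact
  interpret Q: product_prob_space "\<lambda>_::'i \<times> bool. N" UNIV by unfold_locales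
  interpret P: product_prob_space "\<lambda>_::'i. N" UNIV by unfold_locales
  interpret pair: pair_prob_space P P unfolding P_def by unfold_locales
  have [measurable]: "?\<Psi> \<in> measurable (P \<Otimes>\<^sub>M P) Q"
    unfolding P_def Q_def
  proof (rule measurable_abs_UNIV)
    fix p :: "'i \<times> bool"
    show "(\<lambda>z. if snd p then snd z (fst p) else fst z (fst p)) \<in>
      measurable ((PiM UNIV (\<lambda>_. N)) \<Otimes>\<^sub>M (PiM UNIV (\<lambda>_. N))) N"
      by (cases "snd p") simp_all
  qed
  show ?thesis
    unfolding Q_def
  proof (rule Q.PiM_eq)
    show "sets (distr (P \<Otimes>\<^sub>M P) (PiM UNIV (\<lambda>_. N)) ?\<Psi>) = sets (PiM UNIV (\<lambda>_. N))"
      by simp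
    fix J :: "('i \<times> bool) set" and F
    assume J: "finite J" and F: "\<And>j. j \<in> J \<Longrightarrow> F j \<in> sets N"
    \<comment> \<open>The cylinder over \<open>J\<close> splits into a rectangle: the constraints on
      the first copy sit over \<open>J0\<close>, those on the second over \<open>J1\<close>.\<close>
    define J0 where "J0 = {i. (i, False) \<in> J}"
    define J1 where "J1 = {i. (i, True) \<in> J}"
    have Jeq: "J = (\<lambda>i. (i, False)) ` J0 \<union> (\<lambda>i. (i, True)) ` J1"
    proof (rule set_eqI)
      fix p show "p \<in> J \<longleftrightarrow> p \<in> (\<lambda>i. (i, False)) ` J0 \<union> (\<lambda>i. (i, True)) ` J1"
        by (cases p; cases "snd p") (auto simp: J0_def J1_def)
    qed
    have Jball: "(\<forall>j\<in>J. p j) \<longleftrightarrow> (\<forall>i\<in>J0. p (i, False)) \<and> (\<forall>i\<in>J1. p (i, True))" for p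
      by (subst Jeq) (simp add: ball_Un)
    have fin: "finite J0" "finite J1"
      using J finite_vimageI[OF J, of "\<lambda>i. (i, False)"] finite_vimageI[OF J, of "\<lambda>i. (i, True)"]
      by (auto simp: J0_def J1_def inj_on_def vimage_def)
    let ?A0 = "{x \<in> space P. \<forall>i\<in>J0. x i \<in> F (i, False)}"
    let ?A1 = "{x \<in> space P. \<forall>i\<in>J1. x i \<in> F (i, True)}"
    have A: "?A0 \<in> sets P" "?A1 \<in> sets P"
      using fin F unfolding P_def J0_def J1_def by measurable
    have emb: "prod_emb UNIV (\<lambda>_. N) J (PiE J F) \<in> sets Q"
      unfolding Q_def using J F by (intro sets_PiM_I) auto
    have pre: "?\<Psi> -` prod_emb UNIV (\<lambda>_. N) J (PiE J F) \<inter> space (P \<Otimes>\<^sub>M P) = ?A0 \<times> ?A1"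
      by (rule set_eqI) (auto simp: prod_emb_def space_pair_measure PiE_iff P_def space_PiM Jball)
    have "emeasure (distr (P \<Otimes>\<^sub>M P) (PiM UNIV (\<lambda>_. N)) ?\<Psi>) (prod_emb UNIV (\<lambda>_. N) J (PiE J F)) =
        emeasure (P \<Otimes>\<^sub>M P) (?A0 \<times> ?A1)"
      using emb by (subst emeasure_distr) (simp_all add: pre Q_def[symmetric])
    also have "\<dots> = emeasure P ?A0 * emeasure P ?A1"
      using A unfolding P_def by (rule P.P.emeasure_pair_measure_Times)
    also have "emeasure P ?A0 = (\<Prod>i\<in>J0. emeasure N (F (i, False)))"
      unfolding P_def using fin F by (intro P.emeasure_PiM_Collect) (auto simp: J0_def)
    also have "emeasure P ?A1 = (\<Prod>i\<in>J1. emeasure N (F (i, True)))"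
      unfolding P_def using fin F by (intro P.emeasure_PiM_Collect) (auto simp: J1_def)
    also have "(\<Prod>i\<in>J0. emeasure N (F (i, False))) * (\<Prod>i\<in>J1. emeasure N (F (i, True))) =
        (\<Prod>j\<in>J. emeasure N (F j))"
      unfolding Jeq using fin
      by (subst prod.union_disjoint) (auto simp: prod.reindex inj_on_def)
    finally show "emeasure (distr (P \<Otimes>\<^sub>M P) (PiM UNIV (\<lambda>_. N)) ?\<Psi>) (prod_emb UNIV (\<lambda>_. N) J (PiE J F)) =
        (\<Prod>j\<in>J. emeasure N (F j))" .
  qed
qed

section \<open>Resampling and exchange on a product of identical factors\<close>

locale iid_product = product_prob_space "\<lambda>_ :: 'i. N" "UNIV :: 'i set"
  for N :: "'e measure" and idx :: "'i itself"
begin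

abbreviation P :: "('i \<Rightarrow> 'e) measure" where
  "P \<equiv> PiM UNIV (\<lambda>_. N)"

abbreviation PP :: "(('i \<Rightarrow> 'e) \<times> ('i \<Rightarrow> 'e)) measure" where
  "PP \<equiv> P \<Otimes>\<^sub>M P"

sublocale pair: pair_prob_space P P
  by unfold_locales

definition exchange :: "'i set \<Rightarrow> ('i \<Rightarrow> 'e) \<times> ('i \<Rightarrow> 'e) \<Rightarrow> ('i \<Rightarrow> 'e) \<times> ('i \<Rightarrow> 'e)" where
  "exchange B z = (resample B (fst z) (snd z), resample B (snd z) (fst z))"

lemma measurable_exchange [measurable]: "exchange B \<in> measurable PP PP"
  unfolding exchange_def by measurable

lemma distr_exchange: "distr PP PP (exchange B) = PP"
proof -
  let ?Q = "PiM (UNIV :: ('i \<times> bool) set) (\<lambda>_. N)"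
  define \<Psi> where "\<Psi> = (\<lambda>(z :: ('i \<Rightarrow> 'e) \<times> ('i \<Rightarrow> 'e)) p. if snd p then snd z (fst p) else fst z (fst p))"
  define \<Phi> where "\<Phi> = (\<lambda>(q :: 'i \<times> bool \<Rightarrow> 'e). (\<lambda>i. q (i, False), \<lambda>i. q (i, True)))"
  \<comment> \<open>\<open>r\<close> flips the Boolean exactly over \<open>B\<close>, so reindexing
    by \<open>r\<close> is \<open>exchange B\<close> read on the joined index set;
    \<open>\<Phi>\<close> conjugates the two.\<close>
  define r where "r = (\<lambda>p. (fst p :: 'i, if fst p \<in> B then \<not> snd p else snd p))"
  have N: "prob_space N" by (rule M.prob_space_axioms)
  have [measurable]: "\<Psi> \<in> measurable PP ?Q"
    unfolding \<Psi>_def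
  proof (rule measurable_abs_UNIV)
    fix p :: "'i \<times> bool"
    show "(\<lambda>z. if snd p then snd z (fst p) else fst z (fst p)) \<in> measurable PP N"
      by (cases "snd p") simp_all
  qed
  have [measurable]: "\<Phi> \<in> measurable ?Q PP"
    unfolding \<Phi>_def by (intro measurable_Pair measurable_abs_UNIV) simp_all
  have rm [measurable]: "(\<lambda>q p. q (r p)) \<in> measurable ?Q ?Q"
    by (intro measurable_abs_UNIV) simp_all
  have Q: "distr PP ?Q \<Psi> = ?Q"
    using distr_pair_PiM_join[OF N] unfolding \<Psi>_def .
  have "inj r" by (auto simp: inj_on_def r_def prod_eq_iff split: if_splits)
  then have r: "distr ?Q ?Q (\<lambda>q p. q (r p)) = ?Q"
    using distr_PiM_reindex[of UNIV "\<lambda>_. N" r UNIV] N by (simp add: restrict_def)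
  have \<Phi>: "distr ?Q PP \<Phi> = PP"
  proof -
    have "distr ?Q PP \<Phi> = distr (distr PP ?Q \<Psi>) PP \<Phi>" by (simp add: Q)
    also have "\<dots> = distr PP PP (\<Phi> \<circ> \<Psi>)" by (rule distr_distr) measurable
    also have "\<Phi> \<circ> \<Psi> = (\<lambda>z. z)" by (auto simp: \<Phi>_def \<Psi>_def)
    finally show ?thesis by (simp add: distr_id)
  qed
  have "distr PP PP (exchange B) = distr (distr ?Q PP \<Phi>) PP (exchange B)" by (simp add: \<Phi>)
  also have "\<dots> = distr ?Q PP (exchange B \<circ> \<Phi>)" by (rule distr_distr) measurable
  also have "exchange B \<circ> \<Phi> = \<Phi> \<circ> (\<lambda>q p. q (r p))"
    by (rule ext, rule prod_eqI; rule ext; simp add: \<Phi>_def r_def exchange_def resample_def)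
  also have "distr ?Q PP \<dots> = distr (distr ?Q ?Q (\<lambda>q p. q (r p))) PP \<Phi>"
    by (rule distr_distr[symmetric]) measurable
  also have "\<dots> = PP" by (simp add: r \<Phi>)
  finally show ?thesis .
qed

lemma integral_exchange:
  fixes f :: "_ \<Rightarrow> 'b :: {banach, second_countable_topology}"
  assumes "f \<in> borel_measurable PP"
  shows "(\<integral>z. f (exchange B z) \<partial>PP) = (\<integral>z. f z \<partial>PP)"
  using integral_distr[OF measurable_exchange assms, of B] by (simp add: distr_exchange)

lemma distr_fst: "distr PP P fst = P"
  by (rule P.distr_pair_fst)

lemma distr_resample:
  "distr PP P (\<lambda>z. resample B (fst z) (snd z)) = P"
proof -
  have "distr PP P (\<lambda>z. resample B (fst z) (snd z)) = distr PP P (fst \<circ> exchange B)"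
    by (simp add: exchange_def comp_def)
  also have "\<dots> = distr (distr PP PP (exchange B)) P fst"
    by (rule distr_distr[symmetric]) measurable
  finally show ?thesis by (simp add: distr_exchange distr_fst)
qed

lemma integral_fst_PP:
  fixes f :: "_ \<Rightarrow> 'b :: {banach, second_countable_topology}"
  assumes "f \<in> borel_measurable P"
  shows "(\<integral>z. f (fst z) \<partial>PP) = (\<integral>x. f x \<partial>P)"
  using integral_distr[OF measurable_fst assms, of P] by (simp add: distr_fst)

lemma integral_resample:
  fixes f :: "_ \<Rightarrow> 'b :: {banach, second_countable_topology}"
  assumes "f \<in> borel_measurable P"
  shows "(\<integral>z. f (resample B (fst z) (snd z)) \<partial>PP) = (\<integral>x. f x \<partial>P)"
  using integral_distr[of "\<lambda>z. resample B (fst z) (snd z)" PP P f] assms by (simp add: distr_resample)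

lemma integrable_resample:
  fixes f :: "_ \<Rightarrow> 'b :: {banach, second_countable_topology}"
  assumes "integrable P f"
  shows "integrable PP (\<lambda>z. f (resample B (fst z) (snd z)))"
  using integrable_distr[of "\<lambda>z. resample B (fst z) (snd z)" PP P f] assms by (simp add: distr_resample)

lemma integrable_snd_PP:
  fixes f :: "_ \<Rightarrow> 'b :: {banach, second_countable_topology}"
  assumes "integrable P f" shows "integrable PP (\<lambda>z. f (snd z))"
  using integrable_resample[OF assms, of UNIV] by (simp add: resample_def)

lemma integral_snd_PP:
  fixes f :: "_ \<Rightarrow> 'b :: {banach, second_countable_topology}"
  assumes "f \<in> borel_measurable P"
  shows "(\<integral>z. f (snd z) \<partial>PP) = (\<integral>x. f x \<partial>P)"
  using integral_resample[OF assms, of UNIV] by (simp add: resample_def)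

lemma l2_resample:
  assumes "square_integrable P f"
  shows "square_integrable PP (\<lambda>z. f (resample B (fst z) (snd z)))"
    "l2norm PP (\<lambda>z. f (resample B (fst z) (snd z))) = l2norm P f"
  using l2norm_distr[OF _ distr_resample[of B] assms] by simp_all

lemma l2_fst:
  assumes "square_integrable P f"
  shows "square_integrable PP (\<lambda>z. f (fst z))" "l2norm PP (\<lambda>z. f (fst z)) = l2norm P f"
  using l2_resample[OF assms, of "{}"] by simp_all

lemma l2_snd:
  assumes "square_integrable P f"
  shows "square_integrable PP (\<lambda>z. f (snd z))" "l2norm PP (\<lambda>z. f (snd z)) = l2norm P f"
  using l2_resample[OF assms, of UNIV] by (simp_all add: resample_def)

lemma integral_mult_fst_snd:
  fixes f h :: "_ \<Rightarrow> 'b :: {real_normed_field, banach, second_countable_topology}"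
  assumes [measurable]: "f \<in> borel_measurable P" "h \<in> borel_measurable P"
    and int: "integrable PP (\<lambda>z. f (fst z) * h (snd z))" "integrable P h"
  shows "(\<integral>z. f (fst z) * h (snd z) \<partial>PP) = (\<integral>x. f x \<partial>P) * (\<integral>x. h x \<partial>P)"
proof -
  have "(\<integral>z. f (fst z) * h (snd z) \<partial>PP) = (\<integral>x. (\<integral>y. f x * h y \<partial>P) \<partial>P)"
    using pair.integral_fst'[OF int(1)] by simp
  also have "\<dots> = (\<integral>x. f x * (\<integral>y. h y \<partial>P) \<partial>P)"
    using int(2) by simp
  also have "\<dots> = (\<integral>x. f x \<partial>P) * (\<integral>x. h x \<partial>P)"
    by simp
  finally show ?thesis .
qed

text \<open>Stated pointwise rather than through a sub-sigma-algebra, so that a function can be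
  compared directly at a configuration and at its exchanged version.\<close>

definition depends_on :: "'i set \<Rightarrow> (('i \<Rightarrow> 'e) \<Rightarrow> 'b) \<Rightarrow> bool" where
  "depends_on C f \<longleftrightarrow> (\<forall>x y. (\<forall>j\<in>C. x j = y j) \<longrightarrow> f x = f y)"

text \<open>Independence of functions of disjoint coordinates. The product of the integrals is the
  integral of \<open>f\<close> at the first and \<open>h\<close> at the second configuration;
  exchanging the coordinates in \<open>D\<close> leaves the value of \<open>f\<close> alone and
  makes \<open>h\<close> see the first configuration on all of \<open>D\<close>.\<close>

lemma integral_mult_disjoint:
  fixes f h :: "_ \<Rightarrow> 'b :: {real_normed_field, banach, second_countable_topology}"
  assumes [measurable]: "f \<in> borel_measurable P" "h \<in> borel_measurable P"
    and bdd: "\<And>x. x \<in> space P \<Longrightarrow> norm (f x) \<le> K" "\<And>x. x \<in> space P \<Longrightarrow> norm (h x) \<le> L"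
    and dep: "depends_on C f" "depends_on D h" "C \<inter> D = {}"
  shows "(\<integral>x. f x * h x \<partial>P) = (\<integral>x. f x \<partial>P) * (\<integral>x. h x \<partial>P)"
proof -
  obtain x where "x \<in> space P" using P.not_empty by (meson ex_in_conv)
  then have L: "L \<ge> 0" using order_trans[OF norm_ge_zero bdd(2)] by blast
  have "integrable PP (\<lambda>z. f (fst z) * h (snd z))"
  proof (rule pair.integrable_const_bound[where B = "K * L"])
    show "AE z in PP. norm (f (fst z) * h (snd z)) \<le> K * L"
      using bdd L by (auto intro!: AE_I2 mult_mono' simp: norm_mult space_pair_measure)
  qed measurable
  moreover have "integrable P h"
    by (rule P.integrable_const_bound[where B = L]) (use bdd in \<open>auto intro!: AE_I2\<close>)
  ultimately have "(\<integral>x. f x \<partial>P) * (\<integral>x. h x \<partial>P) = (\<integral>z. f (fst z) * h (snd z) \<partial>PP)"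
    by (intro integral_mult_fst_snd[symmetric]) auto
  also have "\<dots> = (\<integral>z. f (fst (exchange D z)) * h (snd (exchange D z)) \<partial>PP)"
    by (rule integral_exchange[symmetric]) measurable
  also have "\<dots> = (\<integral>z. f (fst z) * h (fst z) \<partial>PP)"
  proof (rule Bochner_Integration.integral_cong)
    fix z
    have "f (fst (exchange D z)) = f (fst z)"
      by (rule dep(1)[unfolded depends_on_def, rule_format])
        (use dep(3) in \<open>auto simp: exchange_def resample_def\<close>)
    moreover have "h (snd (exchange D z)) = h (fst z)"
      by (rule dep(2)[unfolded depends_on_def, rule_format])
        (auto simp: exchange_def resample_def)
    ultimately show "f (fst (exchange D z)) * h (snd (exchange D z)) = f (fst z) * h (fst z)" by simp
  qed simp
  also have "\<dots> = (\<integral>x. f x * h x \<partial>P)"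
    by (rule integral_fst_PP) measurable
  finally show ?thesis by simp
qed

end

section \<open>Local approximation and the Efron-Stein inequality\<close>

text \<open>For \<open>T >= 0\<close> this is the projection onto the interval from
  \<open>- T\<close> to \<open>T\<close>. Unlike cutting large values to \<open>0\<close> it is
  1-Lipschitz, so truncation does not increase the effect of changing an innovation.\<close>

definition clamp :: "real \<Rightarrow> real \<Rightarrow> real" where
  "clamp T u = max (- T) (min T u)"

lemma measurable_clamp [measurable]: "clamp T \<in> borel_measurable borel"
  unfolding clamp_def by measurable

lemma abs_clamp_le: "0 \<le> T \<Longrightarrow> \<bar>clamp T u\<bar> \<le> T"
  by (auto simp: clamp_def)

lemma clamp_lipschitz: "\<bar>clamp T u - clamp T v\<bar> \<le> \<bar>u - v\<bar>"
  by (auto simp: clamp_def max_def min_def)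

section \<open>Approximation by functions of finitely many coordinates\<close>

context iid_product
begin

text \<open>The resampled configuration agrees with \<open>snd z\<close> on \<open>B'\<close> and is
  fresh elsewhere. Asking for all \<open>B'\<close> above \<open>B\<close> lets two approximations
  be combined on the union of their sets. The L1 distance fits the induction over integrable
  functions.\<close>

definition locally_approximable :: "(('i \<Rightarrow> 'e) \<Rightarrow> real) \<Rightarrow> bool" where
  "locally_approximable F \<longleftrightarrow> (\<forall>e>0. \<exists>B. finite B \<and>
     (\<forall>B'. B \<subseteq> B' \<longrightarrow> (\<integral>z. \<bar>F (snd z) - F (resample B' (fst z) (snd z))\<bar> \<partial>PP) < e))"

text \<open>L1 limits are admissible because \<open>snd z\<close> and its resampled version both
  have law \<open>P\<close>: replacing \<open>F\<close> by \<open>G\<close> costs the same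
  \<open>P\<close>-integral at each of the two places.\<close>

lemma locally_approximable_closure:
  assumes F: "integrable P F"
    and approx: "\<And>e. e > 0 \<Longrightarrow>
      \<exists>G. integrable P G \<and> locally_approximable G \<and> (\<integral>x. \<bar>F x - G x\<bar> \<partial>P) < e"
  shows "locally_approximable F"
  unfolding locally_approximable_def
proof (intro allI impI)
  fix e :: real assume "e > 0"
  then obtain G where G: "integrable P G" "locally_approximable G" "(\<integral>x. \<bar>F x - G x\<bar> \<partial>P) < e / 4"
    using approx[of "e / 4"] by auto
  obtain B where B: "finite B"
    "\<And>B'. B \<subseteq> B' \<Longrightarrow> (\<integral>z. \<bar>G (snd z) - G (resample B' (fst z) (snd z))\<bar> \<partial>PP) < e / 2"
    using G(2) \<open>e > 0\<close> unfolding locally_approximable_def by (meson half_gt_zero)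
  show "\<exists>B. finite B \<and>
     (\<forall>B'. B \<subseteq> B' \<longrightarrow> (\<integral>z. \<bar>F (snd z) - F (resample B' (fst z) (snd z))\<bar> \<partial>PP) < e)"
  proof (intro exI[of _ B] conjI allI impI B(1))
    fix B' assume "B \<subseteq> B'"
    let ?r = "\<lambda>z. resample B' (fst z) (snd z)"
    have int: "integrable P (\<lambda>x. \<bar>F x - G x\<bar>)" using F G(1) by auto
    note i = integrable_snd_PP[OF F] integrable_snd_PP[OF G(1)] integrable_resample[OF F, of B']
      integrable_resample[OF G(1), of B']
    have "(\<integral>z. \<bar>F (snd z) - F (?r z)\<bar> \<partial>PP) \<le>
      (\<integral>z. \<bar>F (snd z) - G (snd z)\<bar> + \<bar>G (snd z) - G (?r z)\<bar> + \<bar>F (?r z) - G (?r z)\<bar> \<partial>PP)"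
      using i by (intro integral_mono) auto
    also have "\<dots> = (\<integral>z. \<bar>F (snd z) - G (snd z)\<bar> \<partial>PP) + (\<integral>z. \<bar>G (snd z) - G (?r z)\<bar> \<partial>PP)
        + (\<integral>z. \<bar>F (?r z) - G (?r z)\<bar> \<partial>PP)"
      using i by simp
    also have "\<dots> < e / 4 + e / 2 + e / 4"
      using integral_snd_PP[of "\<lambda>x. \<bar>F x - G x\<bar>"] integral_resample[of "\<lambda>x. \<bar>F x - G x\<bar>" B']
        B(2)[OF \<open>B \<subseteq> B'\<close>] G(3) int by (simp add: borel_measurable_integrable)
    finally show "(\<integral>z. \<bar>F (snd z) - F (?r z)\<bar> \<partial>PP) < e" by simp
  qed
qed

lemma locally_approximable_add:
  assumes F: "integrable P F" "locally_approximable F" and G: "integrable P G" "locally_approximable G"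
  shows "locally_approximable (\<lambda>x. F x + G x)"
  unfolding locally_approximable_def
proof (intro allI impI)
  fix e :: real assume e: "e > 0"
  obtain B where B: "finite B"
    "\<And>B'. B \<subseteq> B' \<Longrightarrow> (\<integral>z. \<bar>F (snd z) - F (resample B' (fst z) (snd z))\<bar> \<partial>PP) < e / 2"
    using F(2) e unfolding locally_approximable_def by (meson half_gt_zero)
  obtain C where C: "finite C"
    "\<And>B'. C \<subseteq> B' \<Longrightarrow> (\<integral>z. \<bar>G (snd z) - G (resample B' (fst z) (snd z))\<bar> \<partial>PP) < e / 2"
    using G(2) e unfolding locally_approximable_def by (meson half_gt_zero)
  show "\<exists>B. finite B \<and> (\<forall>B'. B \<subseteq> B' \<longrightarrow>
    (\<integral>z. \<bar>F (snd z) + G (snd z) - (F (resample B' (fst z) (snd z)) + G (resample B' (fst z) (snd z)))\<bar> \<partial>PP) < e)"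
  proof (intro exI[of _ "B \<union> C"] conjI allI impI)
    fix B' assume B': "B \<union> C \<subseteq> B'"
    let ?r = "\<lambda>z. resample B' (fst z) (snd z)"
    note i = integrable_snd_PP[OF F(1)] integrable_snd_PP[OF G(1)] integrable_resample[OF F(1), of B']
      integrable_resample[OF G(1), of B']
    have "(\<integral>z. \<bar>F (snd z) + G (snd z) - (F (?r z) + G (?r z))\<bar> \<partial>PP)
      \<le> (\<integral>z. \<bar>F (snd z) - F (?r z)\<bar> + \<bar>G (snd z) - G (?r z)\<bar> \<partial>PP)"
      using i by (intro integral_mono) auto
    also have "\<dots> = (\<integral>z. \<bar>F (snd z) - F (?r z)\<bar> \<partial>PP) + (\<integral>z. \<bar>G (snd z) - G (?r z)\<bar> \<partial>PP)"
      using i by simp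
    finally show "(\<integral>z. \<bar>F (snd z) + G (snd z) - (F (?r z) + G (?r z))\<bar> \<partial>PP) < e"
      using B(2)[of B'] C(2)[of B'] B' by simp
  qed (use B C in auto)
qed

lemma locally_approximable_scale:
  assumes "locally_approximable F"
  shows "locally_approximable (\<lambda>x. F x * c)"
  unfolding locally_approximable_def
proof (intro allI impI)
  fix e :: real assume e: "e > 0"
  then have "e / (\<bar>c\<bar> + 1) > 0" by (simp add: add_nonneg_pos)
  then obtain B where B: "finite B"
    "\<And>B'. B \<subseteq> B' \<Longrightarrow> (\<integral>z. \<bar>F (snd z) - F (resample B' (fst z) (snd z))\<bar> \<partial>PP) < e / (\<bar>c\<bar> + 1)"
    using assms unfolding locally_approximable_def by meson
  show "\<exists>B. finite B \<and> (\<forall>B'. B \<subseteq> B' \<longrightarrow>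
    (\<integral>z. \<bar>F (snd z) * c - F (resample B' (fst z) (snd z)) * c\<bar> \<partial>PP) < e)"
  proof (intro exI[of _ B] conjI allI impI B(1))
    fix B' assume B': "B \<subseteq> B'"
    let ?I = "\<integral>z. \<bar>F (snd z) - F (resample B' (fst z) (snd z))\<bar> \<partial>PP"
    have "(\<integral>z. \<bar>F (snd z) * c - F (resample B' (fst z) (snd z)) * c\<bar> \<partial>PP) = ?I * \<bar>c\<bar>"
      by (simp add: abs_mult flip: left_diff_distrib)
    also have "\<dots> \<le> ?I * (\<bar>c\<bar> + 1)" by (intro mult_left_mono) auto
    also have "\<dots> < e" using B(2)[OF B'] by (simp add: pos_less_divide_eq add_nonneg_pos)
    finally show "(\<integral>z. \<bar>F (snd z) * c - F (resample B' (fst z) (snd z)) * c\<bar> \<partial>PP) < e" .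
  qed
qed

text \<open>Dynkin induction from the generating cylinders. A cylinder over \<open>J\<close> is
  decided by the coordinates in \<open>J\<close>, so its error is exactly \<open>0\<close> once
  \<open>B'\<close> contains \<open>J\<close>; passing to the complement does not change the
  error.\<close>

lemma locally_approximable_indicator:
  assumes "A \<in> sets P"
  shows "locally_approximable (indicator A)"
proof -
  have A: "A \<in> sigma_sets (\<Pi>\<^sub>E i\<in>UNIV. space N) (prod_algebra UNIV (\<lambda>_. N))"
    using assms by (simp add: sets_PiM)
  have intI: "integrable P (indicator A :: _ \<Rightarrow> real)" if "A \<in> sets P" for A
    using that by (simp add: P.emeasure_eq_measure)
  from Int_stable_prod_algebra prod_algebra_sets_into_space A
  show ?thesis
  proof (induction rule: sigma_sets_induct_disjoint)
    case (basic A)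
    then obtain J F where J: "A = prod_emb UNIV (\<lambda>_. N) J (\<Pi>\<^sub>E j\<in>J. F j)" "finite J"
      by (elim prod_algebraE)
    have "(\<integral>z. \<bar>indicator A (snd z) - indicator A (resample B' (fst z) (snd z))\<bar> \<partial>PP) = (0::real)"
      if "J \<subseteq> B'" for B'
    proof -
      have "snd z \<in> A \<longleftrightarrow> resample B' (fst z) (snd z) \<in> A" if "z \<in> space PP" for z
      proof -
        have "restrict (resample B' (fst z) (snd z)) J = restrict (snd z) J"
          using \<open>J \<subseteq> B'\<close> by (auto simp: resample_def restrict_def fun_eq_iff)
        then show ?thesis
          using that unfolding J(1) prod_emb_def
          by (auto simp: space_pair_measure space_PiM PiE_iff resample_def)
      qed
      then have "(\<integral>z. \<bar>indicator A (snd z) - indicator A (resample B' (fst z) (snd z))\<bar> \<partial>PP) =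
        (\<integral>z. (0::real) \<partial>PP)"
        by (intro Bochner_Integration.integral_cong) (auto simp: indicator_def)
      then show ?thesis by simp
    qed
    then show ?case
      unfolding locally_approximable_def by (intro allI impI exI[of _ J] conjI J(2)) simp
  next
    case empty
    show ?case unfolding locally_approximable_def by auto
  next
    case (compl A)
    have "(\<integral>z. \<bar>indicator ((\<Pi>\<^sub>E i\<in>UNIV. space N) - A) (snd z) -
        indicator ((\<Pi>\<^sub>E i\<in>UNIV. space N) - A) (resample B' (fst z) (snd z))\<bar> \<partial>PP) =
      (\<integral>z. \<bar>indicator A (snd z) - indicator A (resample B' (fst z) (snd z))\<bar> \<partial>PP :: real)" for B'
      by (intro Bochner_Integration.integral_cong)
        (auto simp: indicator_def space_pair_measure space_PiM PiE_iff resample_def)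
    then show ?case using compl(2) unfolding locally_approximable_def by simp
  next
    case (union A)
    \<comment> \<open>Finite disjoint unions are sums of indicators; the partial unions increase to
      the whole union and converge to it in L1 by continuity of the measure.\<close>
    define C where "C n = (\<Union>i<n. A i)" for n
    have As: "A i \<in> sets P" for i using union(2) by (auto simp: sets_PiM)
    have Cs: "C n \<in> sets P" for n unfolding C_def using As by auto
    have Us: "\<Union>(range A) \<in> sets P" using As by auto
    have la: "locally_approximable (indicator (C n))" for n
    proof (induction n)
      case 0
      show ?case unfolding locally_approximable_def C_def by auto
    next
      case (Suc n)
      have "A i \<inter> A n = {}" if "i < n" for i
        by (rule disjoint_family_onD[OF union(1)]) (use that in auto)
      then have "C n \<inter> A n = {}" unfolding C_def by blast
      moreover have "C (Suc n) = C n \<union> A n" by (auto simp: C_def less_Suc_eq)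
      ultimately have "(indicator (C (Suc n)) :: _ \<Rightarrow> real) = (\<lambda>x. indicator (C n) x + indicator (A n) x)"
        by (auto simp: indicator_def fun_eq_iff)
      then show ?case
        using locally_approximable_add[OF intI[OF Cs] Suc intI[OF As] union(3)] by simp
    qed
    have "(\<lambda>n. measure P (C n)) \<longlonglongrightarrow> measure P (\<Union>n. C n)"
    proof (rule P.finite_Lim_measure_incseq)
      show "range C \<subseteq> sets P" using Cs by auto
      show "incseq C" unfolding incseq_def C_def by (intro allI impI UN_mono) auto
    qed
    also have "(\<Union>n. C n) = \<Union>(range A)" by (auto simp: C_def)
    finally have lim: "(\<lambda>n. measure P (C n)) \<longlonglongrightarrow> measure P (\<Union>(range A))" .
    show ?case
    proof (rule locally_approximable_closure[OF intI[OF Us]])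
      fix e :: real assume "e > 0"
      from LIMSEQ_D[OF lim this] obtain n where n: "\<bar>measure P (C n) - measure P (\<Union>(range A))\<bar> < e"
        by auto
      have sub: "C n \<subseteq> \<Union>(range A)" by (auto simp: C_def)
      have "(\<integral>x. \<bar>indicator (\<Union>(range A)) x - indicator (C n) x\<bar> \<partial>P) =
          (\<integral>x. indicator (\<Union>(range A) - C n) x \<partial>P :: real)"
        using sub by (intro Bochner_Integration.integral_cong) (auto simp: indicator_def)
      also have "\<dots> = measure P (\<Union>(range A) - C n)"
        using Us Cs by simp
      also have "\<dots> = measure P (\<Union>(range A)) - measure P (C n)"
        using Us Cs sub by (intro P.finite_measure_Diff) auto
      finally show "\<exists>G. integrable P G \<and> locally_approximable G \<and>
          (\<integral>x. \<bar>indicator (\<Union>(range A)) x - G x\<bar> \<partial>P) < e"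
        using intI[OF Cs[of n]] la[of n] n by (intro exI[of _ "indicator (C n)"]) auto
    qed
  qed
qed

lemma locally_approximable_integrable:
  assumes "integrable P F" shows "locally_approximable F"
  using assms
proof (induction rule: integrable_induct)
  case (base A c)
  then show ?case
    using locally_approximable_scale[OF locally_approximable_indicator] by simp
next
  case (add f g)
  then show ?case by (intro locally_approximable_add)
next
  case (lim f s)
  show ?case
  proof (rule locally_approximable_closure[OF lim.hyps(4)])
    fix e :: real assume "e > 0"
    \<comment> \<open>The approximants of the induction satisfy
      \<open>\<bar>s i x\<bar> \<le> 2 * \<bar>f x\<bar>\<close>, whence the dominating function
      with factor 3.\<close>
    have "(\<lambda>i. \<integral>x. \<bar>f x - s i x\<bar> \<partial>P) \<longlonglongrightarrow> (\<integral>x. 0 \<partial>P)"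
    proof (rule integral_dominated_convergence[where w = "\<lambda>x. 3 * \<bar>f x\<bar>"])
      have "(\<lambda>i. \<bar>f x - s i x\<bar>) \<longlonglongrightarrow> 0" if "x \<in> space P" for x
        using tendsto_rabs_zero[OF LIM_zero[OF lim.hyps(2)[OF that]]] by (simp add: abs_minus_commute)
      then show "AE x in P. (\<lambda>i. \<bar>f x - s i x\<bar>) \<longlonglongrightarrow> 0" by (auto intro!: AE_I2)
      have "\<bar>f x - s i x\<bar> \<le> 3 * \<bar>f x\<bar>" if "x \<in> space P" for x i
        using lim.hyps(3)[OF that, of i] by simp
      then show "AE x in P. norm \<bar>f x - s i x\<bar> \<le> 3 * \<bar>f x\<bar>" for i by (auto intro!: AE_I2)
    qed (use lim.hyps in auto)
    then have "(\<lambda>i. \<integral>x. \<bar>f x - s i x\<bar> \<partial>P) \<longlonglongrightarrow> 0" by simp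
    from LIMSEQ_D[OF this \<open>e > 0\<close>] obtain i where "(\<integral>x. \<bar>f x - s i x\<bar> \<partial>P) < e" by auto
    then show "\<exists>G. integrable P G \<and> locally_approximable G \<and> (\<integral>x. \<bar>f x - G x\<bar> \<partial>P) < e"
      using lim.hyps(1) lim.IH by blast
  qed
qed

lemma l2_clamp_approx:
  assumes F: "square_integrable P F" and "e > 0"
  shows "\<exists>T\<ge>0. l2norm P (\<lambda>x. F x - clamp T (F x)) < e"
proof -
  have [measurable]: "F \<in> borel_measurable P" using F by (simp add: square_integrable_def)
  have "(\<lambda>n. \<integral>x. (F x - clamp (real n) (F x))\<^sup>2 \<partial>P) \<longlonglongrightarrow> (\<integral>x. 0 \<partial>P)"
  proof (rule integral_dominated_convergence[where w = "\<lambda>x. (F x)\<^sup>2"])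
    have "(\<lambda>n. (F x - clamp (real n) (F x))\<^sup>2) \<longlonglongrightarrow> 0" for x
    proof (rule tendsto_eventually)
      show "eventually (\<lambda>n. (F x - clamp (real n) (F x))\<^sup>2 = 0) sequentially"
        using eventually_ge_at_top[of "nat \<lceil>\<bar>F x\<bar>\<rceil>"]
      proof eventually_elim
        case (elim n)
        then have "\<bar>F x\<bar> \<le> real n" by linarith
        then show ?case by (auto simp: clamp_def)
      qed
    qed
    then show "AE x in P. (\<lambda>n. (F x - clamp (real n) (F x))\<^sup>2) \<longlonglongrightarrow> 0" by (auto intro!: AE_I2)
    have "\<bar>F x - clamp (real n) (F x)\<bar> \<le> \<bar>F x\<bar>" for x n
      by (auto simp: clamp_def max_def min_def)
    then have "(F x - clamp (real n) (F x))\<^sup>2 \<le> (F x)\<^sup>2" for x n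
      by (simp add: abs_le_square_iff)
    then show "AE x in P. norm ((F x - clamp (real n) (F x))\<^sup>2) \<le> (F x)\<^sup>2" for n
      by (auto intro!: AE_I2)
  qed (use F in \<open>auto simp: square_integrable_def\<close>)
  then have "(\<lambda>n. l2norm P (\<lambda>x. F x - clamp (real n) (F x))) \<longlonglongrightarrow> 0"
    unfolding l2norm_def using tendsto_real_sqrt by fastforce
  from LIMSEQ_D[OF this \<open>e > 0\<close>] obtain n where "l2norm P (\<lambda>x. F x - clamp (real n) (F x)) < e"
    by auto
  then show ?thesis by (intro exI[of _ "real n"]) auto
qed

lemma square_integrable_clamp:
  assumes "square_integrable P F" "0 \<le> T"
  shows "square_integrable P (\<lambda>x. clamp T (F x))"
  using assms by (intro P.square_integrable_bounded[where K = T] abs_clamp_le)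
    (auto simp: square_integrable_def)

text \<open>For a function bounded by \<open>T\<close>, smallness in L1 gives smallness in L2, since
  the square of a difference is at most \<open>2 * T + 1\<close> times its absolute value. The part
  removed by truncation is small in L2 from the start and enters twice with the same norm.\<close>

lemma resample_l2_approx:
  assumes F: "square_integrable P F" and "e > 0"
  shows "\<exists>B. finite B \<and> (\<forall>B'. B \<subseteq> B' \<longrightarrow>
    l2norm PP (\<lambda>z. F (snd z) - F (resample B' (fst z) (snd z))) < e)"
proof -
  obtain T where T: "T \<ge> 0" "l2norm P (\<lambda>x. F x - clamp T (F x)) < e / 4"
    using l2_clamp_approx[OF F, of "e / 4"] \<open>e > 0\<close> by auto
  define U where "U x = clamp T (F x)" for x
  define G where "G x = F x - U x" for x
  have U: "square_integrable P U" "\<And>x. \<bar>U x\<bar> \<le> T"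
    using square_integrable_clamp[OF F T(1)] abs_clamp_le[OF T(1)] unfolding U_def by auto
  have G: "square_integrable P G" "l2norm P G < e / 4"
    using square_integrable_diff[OF F U(1)] T(2) unfolding G_def U_def by auto
  \<comment> \<open>Chosen so that the factor \<open>2 * T + 1\<close> turns it into the square of
    \<open>e / 2\<close>; the \<open>+ 1\<close> keeps the denominator positive when
    \<open>T = 0\<close>.\<close>
  define e' where "e' = (e / 2)\<^sup>2 / (2 * T + 1)"
  have "e' > 0" using \<open>e > 0\<close> T(1) by (simp add: e'_def)
  then obtain B where B: "finite B"
    "\<And>B'. B \<subseteq> B' \<Longrightarrow> (\<integral>z. \<bar>U (snd z) - U (resample B' (fst z) (snd z))\<bar> \<partial>PP) < e'"
    using locally_approximable_integrable[OF P.square_integrable_integrable[OF U(1)]]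
    unfolding locally_approximable_def by meson
  show ?thesis
  proof (intro exI[of _ B] conjI allI impI B(1))
    fix B' assume B': "B \<subseteq> B'"
    let ?r = "\<lambda>z. resample B' (fst z) (snd z)"
    let ?D = "\<lambda>z. U (snd z) - U (?r z)"
    have D: "square_integrable PP ?D"
      by (intro square_integrable_diff l2_snd l2_resample U)
    have "(l2norm PP ?D)\<^sup>2 \<le> (\<integral>z. (2 * T + 1) * \<bar>?D z\<bar> \<partial>PP)"
      unfolding l2norm_power2
    proof (rule integral_mono)
      show "integrable PP (\<lambda>z. (?D z)\<^sup>2)" "integrable PP (\<lambda>z. (2 * T + 1) * \<bar>?D z\<bar>)"
        using D pair.square_integrable_integrable[OF D] by (auto simp: square_integrable_def)
      fix z
      have "\<bar>?D z\<bar> \<le> 2 * T + 1" using U(2)[of "snd z"] U(2)[of "?r z"] by linarith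
      then have "\<bar>?D z\<bar> * \<bar>?D z\<bar> \<le> (2 * T + 1) * \<bar>?D z\<bar>" by (rule mult_right_mono) simp
      then show "(?D z)\<^sup>2 \<le> (2 * T + 1) * \<bar>?D z\<bar>" by (simp add: power2_eq_square)
    qed
    also have "\<dots> = (2 * T + 1) * (\<integral>z. \<bar>?D z\<bar> \<partial>PP)" by simp
    also have "\<dots> < (e / 2)\<^sup>2"
      using B(2)[OF B'] T(1) by (simp add: e'_def pos_less_divide_eq mult.commute)
    finally have l2D: "l2norm PP ?D < e / 2"
      by (rule power_less_imp_less_base) (use \<open>e > 0\<close> in simp)
    have GG: "square_integrable PP (\<lambda>z. G (snd z) - G (?r z))"
      by (intro square_integrable_diff l2_snd l2_resample G)
    have "l2norm PP (\<lambda>z. G (snd z) - G (?r z)) \<le> l2norm P G + l2norm P G"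
      using l2norm_diff_le[OF l2_snd(1)[OF G(1)] l2_resample(1)[OF G(1), of B']]
      by (simp add: l2_snd(2)[OF G(1)] l2_resample(2)[OF G(1)])
    moreover have "l2norm PP (\<lambda>z. ?D z + (G (snd z) - G (?r z))) \<le>
        l2norm PP ?D + l2norm PP (\<lambda>z. G (snd z) - G (?r z))"
      by (rule l2norm_add_le[OF D GG])
    moreover have "(\<lambda>z. ?D z + (G (snd z) - G (?r z))) = (\<lambda>z. F (snd z) - F (?r z))"
      by (simp add: G_def fun_eq_iff)
    ultimately show "l2norm PP (\<lambda>z. F (snd z) - F (?r z)) < e"
      using l2D G(2) by simp
  qed
qed

section \<open>Single-site coefficients and the Efron-Stein inequality\<close>

definition delta :: "'i \<Rightarrow> (('i \<Rightarrow> 'e) \<Rightarrow> real) \<Rightarrow> real" where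
  "delta a F = l2norm PP (\<lambda>z. F (fst z) - F (resample {a} (fst z) (snd z)))"

lemma delta_nonneg [simp]: "0 \<le> delta a F"
  by (simp add: delta_def)

lemma square_integrable_resample_diff:
  assumes "square_integrable P F"
  shows "square_integrable PP (\<lambda>z. F (fst z) - F (resample B (fst z) (snd z)))"
  by (intro square_integrable_diff l2_fst l2_resample assms)

lemma delta_add_le:
  assumes "square_integrable P F" "square_integrable P G"
  shows "delta a (\<lambda>x. F x + G x) \<le> delta a F + delta a G"
proof -
  have "delta a (\<lambda>x. F x + G x) = l2norm PP (\<lambda>z. (F (fst z) - F (resample {a} (fst z) (snd z))) +
      (G (fst z) - G (resample {a} (fst z) (snd z))))"
    unfolding delta_def by (simp add: algebra_simps)
  also have "\<dots> \<le> delta a F + delta a G"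
    unfolding delta_def by (intro l2norm_add_le square_integrable_resample_diff assms)
  finally show ?thesis .
qed

lemma delta_uminus: "delta a (\<lambda>x. - F x) = delta a F"
  by (simp add: delta_def l2norm_def power2_commute)

lemma delta_diff_le:
  assumes "square_integrable P F" "square_integrable P G"
  shows "delta a (\<lambda>x. F x - G x) \<le> delta a F + delta a G"
  using delta_add_le[OF assms(1) square_integrable_cmult[OF assms(2), of "-1"], of a]
  by (simp add: delta_uminus)

lemma delta_sum_le:
  assumes "\<And>i. i \<in> I \<Longrightarrow> square_integrable P (F i)"
  shows "delta a (\<lambda>x. \<Sum>i\<in>I. F i x) \<le> (\<Sum>i\<in>I. delta a (F i))"
  using assms
proof (induction I rule: infinite_finite_induct)
  case (insert i I)
  have "delta a (\<lambda>x. F i x + (\<Sum>i\<in>I. F i x)) \<le> delta a (F i) + delta a (\<lambda>x. \<Sum>i\<in>I. F i x)"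
    by (intro delta_add_le square_integrable_sum insert.prems) auto
  then show ?case using insert by (simp add: order_trans)
qed (auto simp: delta_def l2norm_def)

lemma delta_le_l2norm:
  assumes "square_integrable P F"
  shows "delta a F \<le> 2 * l2norm P F"
  using l2norm_diff_le[OF l2_fst(1)[OF assms] l2_resample(1)[OF assms, of "{a}"]]
  by (simp add: delta_def l2_fst(2)[OF assms] l2_resample(2)[OF assms])

text \<open>The sites of \<open>B\<close> are resampled one at a time, and the increment
  \<open>?D\<close> of site \<open>l\<close> contributes at most half of the squared coefficient.
  Exchanging the two copies at \<open>l\<close> reverses the sign of \<open>?D\<close> and replaces
  \<open>?a\<close> by \<open>?f {l}\<close>; averaging both forms gives half the integral of
  \<open>(?a - ?f {l}) * ?D\<close>, to which Cauchy-Schwarz applies.\<close>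

lemma efron_stein_finite:
  assumes F: "square_integrable P F" and "finite B"
  shows "(\<integral>z. F (fst z) * (F (fst z) - F (resample B (fst z) (snd z))) \<partial>PP) \<le> (\<Sum>l\<in>B. (delta l F)\<^sup>2) / 2"
  using \<open>finite B\<close>
proof induction
  case empty
  show ?case by simp
next
  case (insert l B)
  let ?a = "\<lambda>z. F (fst z)" and ?f = "\<lambda>B z. F (resample B (fst z) (snd z))"
  let ?D = "\<lambda>z. ?f B z - ?f (insert l B) z"
  note sq = l2_fst(1)[OF F] l2_resample(1)[OF F]
  have D: "square_integrable PP ?D" by (intro square_integrable_diff sq)
  have [measurable]: "F \<in> borel_measurable P" using F by (simp add: square_integrable_def)
  have "(\<integral>z. ?a z * ?D z \<partial>PP) = (\<integral>z. ?a (exchange {l} z) * ?D (exchange {l} z) \<partial>PP)"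
    by (rule integral_exchange[symmetric]) measurable
  also have "\<dots> = (\<integral>z. - (?f {l} z * ?D z) \<partial>PP)"
  proof (rule Bochner_Integration.integral_cong)
    fix z
    have "resample B (fst (exchange {l} z)) (snd (exchange {l} z)) = resample (insert l B) (fst z) (snd z)"
      "resample (insert l B) (fst (exchange {l} z)) (snd (exchange {l} z)) = resample B (fst z) (snd z)"
      using insert.hyps by (auto simp: resample_def exchange_def fun_eq_iff)
    then show "?a (exchange {l} z) * ?D (exchange {l} z) = - (?f {l} z * ?D z)"
      by (simp add: exchange_def algebra_simps)
  qed simp
  finally have "2 * (\<integral>z. ?a z * ?D z \<partial>PP) = (\<integral>z. ?a z * ?D z \<partial>PP) + (\<integral>z. - (?f {l} z * ?D z) \<partial>PP)"
    by simp
  also have "\<dots> = (\<integral>z. ?a z * ?D z + - (?f {l} z * ?D z) \<partial>PP)"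
    by (intro Bochner_Integration.integral_add[symmetric] Bochner_Integration.integrable_minus
        square_integrable_mult sq D)
  also have "\<dots> = (\<integral>z. (?a z - ?f {l} z) * ?D z \<partial>PP)"
    by (intro Bochner_Integration.integral_cong) (auto simp: algebra_simps)
  also have "\<dots> \<le> delta l F * l2norm PP ?D"
    unfolding delta_def by (intro integral_mult_le_l2norm square_integrable_resample_diff F D)
  also have "l2norm PP ?D = delta l F"
  proof -
    \<comment> \<open>After exchanging the sites of \<open>B\<close>, the increment is the
      single-site difference that defines \<open>delta l F\<close>, hence has the same norm.\<close>
    have "?D = (\<lambda>z. (\<lambda>z. ?a z - ?f {l} z) (exchange B z))"
    proof
      fix z :: "('i \<Rightarrow> 'e) \<times> ('i \<Rightarrow> 'e)"
      have "resample {l} (resample B (fst z) (snd z)) (resample B (snd z) (fst z)) =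
          resample (insert l B) (fst z) (snd z)"
        using insert.hyps by (auto simp: resample_def)
      then show "?D z = (\<lambda>z. ?a z - ?f {l} z) (exchange B z)" by (simp add: exchange_def)
    qed
    then show ?thesis
      unfolding delta_def
      using l2norm_distr(2)[OF measurable_exchange distr_exchange square_integrable_resample_diff[OF F], of B "{l}"]
      by simp
  qed
  finally have *: "(\<integral>z. ?a z * ?D z \<partial>PP) \<le> (delta l F)\<^sup>2 / 2"
    by (simp add: power2_eq_square)
  have "(\<integral>z. ?a z * (?a z - ?f (insert l B) z) \<partial>PP) =
    (\<integral>z. ?a z * (?a z - ?f B z) + ?a z * ?D z \<partial>PP)"
    by (intro Bochner_Integration.integral_cong) (auto simp: algebra_simps)
  also have "\<dots> = (\<integral>z. ?a z * (?a z - ?f B z) \<partial>PP) + (\<integral>z. ?a z * ?D z \<partial>PP)"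
    by (intro Bochner_Integration.integral_add square_integrable_mult sq D square_integrable_diff)
  finally show ?case using * insert by simp
qed

text \<open>The variance is the integral of \<open>F (fst z) * (F (fst z) - F (snd z))\<close>. For
  a large finite \<open>B\<close> the independent copy \<open>snd z\<close> may be replaced by
  \<open>fst z\<close> resampled on \<open>B\<close>, with arbitrarily small L2 error, and the
  finite inequality takes over.\<close>

lemma variance_le_delta:
  assumes F: "square_integrable P F"
    and K: "\<And>B. finite B \<Longrightarrow> (\<Sum>l\<in>B. (delta l F)\<^sup>2) \<le> K"
  shows "(\<integral>x. (F x)\<^sup>2 \<partial>P) - (\<integral>x. F x \<partial>P)\<^sup>2 \<le> K / 2"
proof (rule field_le_epsilon)
  fix e :: real assume "e > 0"
  have [measurable]: "F \<in> borel_measurable P" using F by (simp add: square_integrable_def)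
  \<comment> \<open>The error is multiplied by \<open>l2norm P F\<close> below; the
    \<open>+ 1\<close> covers the case of norm \<open>0\<close>.\<close>
  have pos: "e / (l2norm P F + 1) > 0" using \<open>e > 0\<close> by (simp add: add_nonneg_pos)
  obtain B where B: "finite B" "l2norm PP (\<lambda>z. F (snd z) - F (resample B (fst z) (snd z))) < e / (l2norm P F + 1)"
    using resample_l2_approx[OF F pos] by blast
  let ?a = "\<lambda>z. F (fst z)" and ?b = "\<lambda>z. F (snd z)" and ?f = "\<lambda>z. F (resample B (fst z) (snd z))"
  note sq = l2_fst(1)[OF F] l2_snd(1)[OF F] l2_resample(1)[OF F, of B]
  have "(\<integral>x. (F x)\<^sup>2 \<partial>P) = (\<integral>z. ?a z * ?a z \<partial>PP)"
    using integral_fst_PP[of "\<lambda>x. F x * F x"] by (simp add: power2_eq_square)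
  moreover have "(\<integral>x. F x \<partial>P)\<^sup>2 = (\<integral>z. ?a z * ?b z \<partial>PP)"
    using integral_mult_fst_snd[of F F] square_integrable_mult[OF sq(1,2)]
      P.square_integrable_integrable[OF F] by (simp add: power2_eq_square)
  ultimately have "(\<integral>x. (F x)\<^sup>2 \<partial>P) - (\<integral>x. F x \<partial>P)\<^sup>2 =
      (\<integral>z. ?a z * ?a z \<partial>PP) - (\<integral>z. ?a z * ?b z \<partial>PP)" by simp
  also have "\<dots> = (\<integral>z. ?a z * ?a z - ?a z * ?b z \<partial>PP)"
    by (intro Bochner_Integration.integral_diff[symmetric] square_integrable_mult sq)
  also have "\<dots> = (\<integral>z. ?a z * (?a z - ?f z) + (- 1 * ?a z) * (?b z - ?f z) \<partial>PP)"
    by (intro Bochner_Integration.integral_cong) (auto simp: algebra_simps)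
  also have "\<dots> = (\<integral>z. ?a z * (?a z - ?f z) \<partial>PP) + (\<integral>z. (- 1 * ?a z) * (?b z - ?f z) \<partial>PP)"
    by (intro Bochner_Integration.integral_add square_integrable_mult square_integrable_cmult
        square_integrable_diff sq)
  also have "(\<integral>z. (- 1 * ?a z) * (?b z - ?f z) \<partial>PP) \<le>
      l2norm PP (\<lambda>z. - 1 * ?a z) * l2norm PP (\<lambda>z. ?b z - ?f z)"
    by (intro integral_mult_le_l2norm square_integrable_cmult square_integrable_diff sq)
  also have "l2norm PP (\<lambda>z. - 1 * ?a z) = l2norm P F"
    using l2_fst(2)[OF F] by (simp add: l2norm_def)
  also have "l2norm P F * l2norm PP (\<lambda>z. ?b z - ?f z) \<le> (l2norm P F + 1) * (e / (l2norm P F + 1))"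
    using B(2) by (intro mult_mono) auto
  also have "\<dots> = e" using l2norm_nonneg[of P F] by (simp add: add_nonneg_eq_0_iff)
  also have "(\<integral>z. ?a z * (?a z - ?f z) \<partial>PP) \<le> K / 2"
    using efron_stein_finite[OF F B(1)] K[OF B(1)] by simp
  finally show "(\<integral>x. (F x)\<^sup>2 \<partial>P) - (\<integral>x. F x \<partial>P)\<^sup>2 \<le> K / 2 + e" by simp
qed

section \<open>Conditional expectation given the coordinates in a set\<close>

definition local_part :: "'i set \<Rightarrow> (('i \<Rightarrow> 'e) \<Rightarrow> real) \<Rightarrow> ('i \<Rightarrow> 'e) \<Rightarrow> real" where
  "local_part A U x = (\<integral>y. U (resample A y x) \<partial>P)"

lemma measurable_local_part [measurable]:
  assumes [measurable]: "U \<in> borel_measurable P"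
  shows "local_part A U \<in> borel_measurable P"
  unfolding local_part_def by measurable

text \<open>\<open>local_part A U\<close> is a version of the conditional expectation of
  \<open>U\<close> given the coordinates in \<open>A\<close>, written as an integral over all
  others. Because it is defined pointwise, it ignores the coordinates outside \<open>A\<close>
  exactly and not just almost surely.\<close>

lemma depends_on_local_part: "depends_on A (local_part A U)"
  unfolding depends_on_def local_part_def
proof (intro allI impI)
  fix x y :: "'i \<Rightarrow> 'e" assume "\<forall>j\<in>A. x j = y j"
  then have "resample A w x = resample A w y" for w by (auto simp: resample_def)
  then show "(\<integral>w. U (resample A w x) \<partial>P) = (\<integral>w. U (resample A w y) \<partial>P)" by simp
qed

lemma jensen_square:
  fixes h :: "('i \<Rightarrow> 'e) \<Rightarrow> real"
  assumes "h \<in> borel_measurable P" "\<And>y. \<bar>h y\<bar> \<le> L"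
  shows "(\<integral>y. h y \<partial>P)\<^sup>2 \<le> (\<integral>y. (h y)\<^sup>2 \<partial>P)"
proof -
  have "square_integrable P h"
    by (rule P.square_integrable_bounded[OF assms(1), where K = L]) (rule assms(2))
  from power_mono[OF P.abs_integral_le_l2norm[OF this] abs_ge_zero, of 2] show ?thesis
    by (simp add: l2norm_power2)
qed

context
  fixes U :: "('i \<Rightarrow> 'e) \<Rightarrow> real" and T :: real
  assumes U [measurable]: "U \<in> borel_measurable P" and bdd: "\<And>x. \<bar>U x\<bar> \<le> T"
begin

lemma square_integrable_U: "square_integrable P U"
  by (rule P.square_integrable_bounded[OF U bdd])

text \<open>Boundedness gives this at every \<open>x\<close> of the space, where Fubini alone would
  leave an exceptional null set.\<close>

lemma integrable_local_part:
  assumes "x \<in> space P" shows "integrable P (\<lambda>y. U (resample A y x))"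
  by (rule P.integrable_const_bound[where B = T]) (use assms bdd in auto)

lemma abs_local_part_le:
  assumes "x \<in> space P" shows "\<bar>local_part A U x\<bar> \<le> T"
proof -
  have "\<bar>local_part A U x\<bar> \<le> (\<integral>y. \<bar>U (resample A y x)\<bar> \<partial>P)"
    unfolding local_part_def by (rule integral_abs_bound)
  also have "\<dots> \<le> T"
    using integrable_local_part[OF assms] bdd by (intro P.integral_le_const) auto
  finally show ?thesis .
qed

lemma square_integrable_local_part: "square_integrable P (local_part A U)"
  by (rule P.square_integrable_bounded[OF _ abs_local_part_le]) measurable

text \<open>At fixed \<open>x\<close> the difference is an average over \<open>y\<close> of
  \<open>U x - U (resample A y x)\<close>; Jensen moves the square inside, and integrating over
  \<open>x\<close> gives the right-hand side.\<close>

lemma l2norm_local_part_le: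
  "l2norm P (\<lambda>x. U x - local_part A U x) \<le> l2norm PP (\<lambda>z. U (snd z) - U (resample A (fst z) (snd z)))"
proof (rule power2_le_imp_le)
  let ?h = "\<lambda>y x. (U x - U (resample A y x))\<^sup>2"
  have sq: "square_integrable PP (\<lambda>z. U (snd z) - U (resample A (fst z) (snd z)))"
    by (intro square_integrable_diff l2_snd l2_resample square_integrable_U)
  then have int: "integrable PP (\<lambda>(y, x). ?h y x)"
    by (simp add: square_integrable_def case_prod_beta')
  have "(l2norm P (\<lambda>x. U x - local_part A U x))\<^sup>2 \<le> (\<integral>x. (\<integral>y. ?h y x \<partial>P) \<partial>P)"
    unfolding l2norm_power2
  proof (rule integral_mono)
    show "integrable P (\<lambda>x. (U x - local_part A U x)\<^sup>2)"
      using square_integrable_diff[OF square_integrable_U square_integrable_local_part]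
      by (simp add: square_integrable_def)
    show "integrable P (\<lambda>x. \<integral>y. ?h y x \<partial>P)"
      by (rule pair.integrable_snd[OF int])
    fix x assume x: "x \<in> space P"
    have "U x - local_part A U x = (\<integral>y. U x - U (resample A y x) \<partial>P)"
      unfolding local_part_def using integrable_local_part[OF x] by (simp add: P.prob_space)
    moreover have "\<bar>U x - U w\<bar> \<le> 2 * T" for w using bdd[of x] bdd[of w] by linarith
    ultimately show "(U x - local_part A U x)\<^sup>2 \<le> (\<integral>y. ?h y x \<partial>P)"
      using jensen_square[of "\<lambda>y. U x - U (resample A y x)" "2 * T"] x by simp
  qed
  also have "\<dots> = (\<integral>z. ?h (fst z) (snd z) \<partial>PP)"
    using pair.integral_snd[OF int] by (simp add: case_prod_beta')
  finally show "(l2norm P (\<lambda>x. U x - local_part A U x))\<^sup>2 \<le>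
      (l2norm PP (\<lambda>z. U (snd z) - U (resample A (fst z) (snd z))))\<^sup>2"
    by (simp add: l2norm_power2)
qed simp

text \<open>If \<open>a\<close> is not in \<open>A\<close>, the average does not see
  \<open>a\<close> and its coefficient is \<open>0\<close>. If it is, changing the innovation at
  \<open>a\<close> commutes with refreshing the coordinates outside \<open>A\<close>, so the change
  of the average is the average of the changes, and Jensen applies.\<close>

lemma delta_local_part_le: "delta a (local_part A U) \<le> delta a U"
proof (cases "a \<in> A")
  case False
  then have "resample A y (resample {a} x u) = resample A y x" for x y u :: "'i \<Rightarrow> 'e"
    by (auto simp: resample_def)
  then have "delta a (local_part A U) = 0"
    by (simp add: delta_def local_part_def l2norm_def)
  then show ?thesis by simp
next
  case True
  let ?Z = "local_part A U"
  let ?k = "\<lambda>w u. (U w - U (resample {a} w u))\<^sup>2"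
  let ?K = "\<lambda>x u y. ?k (resample A y x) u"
  have k_bd: "\<bar>?k w u\<bar> \<le> (2 * T)\<^sup>2" for w u
  proof -
    have "\<bar>U w - U (resample {a} w u)\<bar> \<le> 2 * T" using bdd[of w] bdd[of "resample {a} w u"] by linarith
    from power_mono[OF this, of 2] show ?thesis by simp
  qed
  have K_int: "integrable P (\<lambda>y. ?K x u y)" if "x \<in> space P" "u \<in> space P" for x u
    by (rule P.integrable_const_bound[where B = "(2 * T)\<^sup>2"]) (use that k_bd in auto)
  have K2: "integrable PP (\<lambda>(u, y). ?K x u y)" if "x \<in> space P" for x
    by (rule pair.integrable_const_bound[where B = "(2 * T)\<^sup>2"]) (use that k_bd in auto)
  have k_int: "integrable PP (\<lambda>z. ?k (fst z) (snd z))"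
    using square_integrable_resample_diff[OF square_integrable_U, of "{a}"]
    by (simp add: square_integrable_def)
  have k1: "integrable P (\<lambda>w. \<integral>u. ?k w u \<partial>P)"
    using pair.integrable_fst'[OF k_int] by simp
  have H_int: "integrable PP (\<lambda>z. (?Z (fst z) - ?Z (resample {a} (fst z) (snd z)))\<^sup>2)"
    using square_integrable_resample_diff[OF square_integrable_local_part, of A "{a}"]
    by (simp add: square_integrable_def)
  have kr_int: "integrable PP (\<lambda>z. \<integral>u. ?k (resample A (fst z) (snd z)) u \<partial>P)"
    by (rule integrable_resample[OF k1])
  have le: "(?Z x - ?Z (resample {a} x u))\<^sup>2 \<le> (\<integral>y. ?K x u y \<partial>P)"
    if x: "x \<in> space P" and u: "u \<in> space P" for x u
  proof -
    have xu: "resample {a} x u \<in> space P"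
      using x u by (auto simp: space_PiM PiE_iff resample_def)
    have eq: "resample A y (resample {a} x u) = resample {a} (resample A y x) u" for y
      using True by (auto simp: resample_def)
    have "?Z x - ?Z (resample {a} x u) =
        (\<integral>y. U (resample A y x) - U (resample {a} (resample A y x) u) \<partial>P)"
      unfolding local_part_def
      using integrable_local_part[OF x, of A] integrable_local_part[OF xu, of A] by (simp add: eq)
    moreover have "\<bar>U v - U w\<bar> \<le> 2 * T" for v w using bdd[of v] bdd[of w] by linarith
    ultimately show ?thesis
      using jensen_square[of "\<lambda>y. U (resample A y x) - U (resample {a} (resample A y x) u)" "2 * T"] x u
      by simp
  qed
  have "(delta a ?Z)\<^sup>2 = (\<integral>x. (\<integral>u. (?Z x - ?Z (resample {a} x u))\<^sup>2 \<partial>P) \<partial>P)"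
    unfolding delta_def l2norm_power2 using pair.integral_fst'[OF H_int] by simp
  also have "\<dots> \<le> (\<integral>x. (\<integral>u. (\<integral>y. ?K x u y \<partial>P) \<partial>P) \<partial>P)"
  proof (rule integral_mono)
    show "integrable P (\<lambda>x. \<integral>u. (?Z x - ?Z (resample {a} x u))\<^sup>2 \<partial>P)"
      using pair.integrable_fst'[OF H_int] by simp
    have "(\<lambda>x. \<integral>u. (\<integral>y. ?K x u y \<partial>P) \<partial>P) \<in> borel_measurable P"
      by measurable
    moreover have "\<bar>\<integral>u. (\<integral>y. ?K x u y \<partial>P) \<partial>P\<bar> \<le> (2 * T)\<^sup>2" if x: "x \<in> space P" for x
    proof -
      have i: "integrable P (\<lambda>u. \<integral>y. ?K x u y \<partial>P)" using pair.integrable_fst[OF K2[OF x]] .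
      have "(\<integral>u. (\<integral>y. ?K x u y \<partial>P) \<partial>P) \<le> (2 * T)\<^sup>2"
        using k_bd K_int[OF x] by (intro P.integral_le_const i AE_I2 P.integral_le_const) auto
      moreover have "0 \<le> (\<integral>u. (\<integral>y. ?K x u y \<partial>P) \<partial>P)" by simp
      ultimately show ?thesis by simp
    qed
    ultimately show "integrable P (\<lambda>x. \<integral>u. (\<integral>y. ?K x u y \<partial>P) \<partial>P)"
      by (intro P.integrable_const_bound[where B = "(2 * T)\<^sup>2"]) (auto intro!: AE_I2)
    fix x assume x: "x \<in> space P"
    show "(\<integral>u. (?Z x - ?Z (resample {a} x u))\<^sup>2 \<partial>P) \<le> (\<integral>u. (\<integral>y. ?K x u y \<partial>P) \<partial>P)"
    proof (rule integral_mono)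
      have "\<bar>(?Z x - ?Z (resample {a} x u))\<^sup>2\<bar> \<le> (2 * T)\<^sup>2" if u: "u \<in> space P" for u
      proof -
        have "\<bar>?Z x - ?Z (resample {a} x u)\<bar> \<le> 2 * T"
        proof -
          have "resample {a} x u \<in> space P"
            using x u by (auto simp: space_PiM PiE_iff resample_def)
          then have "\<bar>?Z (resample {a} x u)\<bar> \<le> T" by (rule abs_local_part_le)
          then show ?thesis using abs_local_part_le[OF x, of A] by linarith
        qed
        from power_mono[OF this, of 2] show ?thesis by simp
      qed
      then show "integrable P (\<lambda>u. (?Z x - ?Z (resample {a} x u))\<^sup>2)"
        using x by (intro P.integrable_const_bound[where B = "(2 * T)\<^sup>2"]) (auto intro!: AE_I2)
      show "integrable P (\<lambda>u. \<integral>y. ?K x u y \<partial>P)" using pair.integrable_fst[OF K2[OF x]] .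
    qed (use le x in auto)
  qed
  \<comment> \<open>Once the replacement value \<open>u\<close> is integrated innermost,
    \<open>x\<close> and \<open>y\<close> occur only through \<open>resample A y x\<close>, which
    has law \<open>P\<close>; the triple integral collapses to the double one defining
    \<open>delta a U\<close>.\<close>
  also have "\<dots> = (\<integral>x. (\<integral>y. (\<integral>u. ?K x u y \<partial>P) \<partial>P) \<partial>P)"
    by (intro Bochner_Integration.integral_cong refl pair.Fubini_integral[symmetric] K2)
  also have "\<dots> = (\<integral>z. (\<integral>u. ?k (resample A (fst z) (snd z)) u \<partial>P) \<partial>PP)"
    using pair.integral_snd[of "\<lambda>y x. \<integral>u. ?k (resample A y x) u \<partial>P"] kr_int
    by (simp add: case_prod_beta')
  also have "\<dots> = (\<integral>w. (\<integral>u. ?k w u \<partial>P) \<partial>P)"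
    by (rule integral_resample) (use k1 in \<open>simp add: borel_measurable_integrable\<close>)
  also have "\<dots> = (delta a U)\<^sup>2"
    unfolding delta_def l2norm_power2 using pair.integral_fst'[OF k_int] by simp
  finally show ?thesis by (rule power2_le_imp_le) simp
qed

end

end

section \<open>Sums with bounded local dependence\<close>

lemma cmod_integral_le:
  fixes f :: "'a \<Rightarrow> complex"
  assumes "integrable M f" "integrable M g" "\<And>x. x \<in> space M \<Longrightarrow> cmod (f x) \<le> g x"
  shows "cmod (\<integral>x. f x \<partial>M) \<le> (\<integral>x. g x \<partial>M)"
proof -
  have "cmod (\<integral>x. f x \<partial>M) \<le> (\<integral>x. cmod (f x) \<partial>M)" by (rule integral_norm_bound)
  also have "\<dots> \<le> (\<integral>x. g x \<partial>M)" using assms by (intro integral_mono) auto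
  finally show ?thesis .
qed

lemma (in prob_space) cmod_integral_le_const:
  assumes "f \<in> borel_measurable M" "\<And>x. x \<in> space M \<Longrightarrow> cmod (f x) \<le> c"
  shows "cmod (\<integral>x. f x \<partial>M) \<le> c"
proof -
  have "integrable M f" using assms by (intro integrable_const_bound[where B = c]) (auto intro!: AE_I2)
  from cmod_integral_le[OF this, of "\<lambda>_. c"] assms(2) show ?thesis by (simp add: prob_space)
qed

lemma measurable_iexp [measurable]: "iexp \<in> borel_measurable borel"
  by (intro borel_measurable_continuous_onI continuous_intros)

lemma cmod_iexp [simp]: "cmod (iexp x) = 1"
  by (simp add: norm_exp_i_times)

lemma cmod_iexp_linear_le: "cmod (iexp x - 1 - \<i> * x) \<le> x\<^sup>2 / 2"
  using iexp_approx1[of x 1] by (simp add: numeral_2_eq_2[symmetric] diff_diff_eq)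

text \<open>The second-order Taylor bound for \<open>iexp\<close> integrates to the explicit
  remainder \<open>L * (y - s)\<^sup>2\<close> with \<open>L\<close> half the second moment, which
  gives the derivative directly.\<close>

lemma (in prob_space) has_vector_derivative_char:
  fixes V :: "'a \<Rightarrow> real"
  assumes V: "square_integrable M V"
  shows "((\<lambda>s. \<integral>x. iexp (s * V x) \<partial>M) has_vector_derivative (\<integral>x. \<i> * V x * iexp (s * V x) \<partial>M)) (at s)"
  unfolding has_vector_derivative_def has_derivative_at_alt
proof (intro conjI allI impI)
  have [measurable]: "V \<in> borel_measurable M" using V by (simp add: square_integrable_def)
  let ?\<psi> = "\<lambda>s. \<integral>x. iexp (s * V x) \<partial>M" and ?D = "\<integral>x. \<i> * V x * iexp (s * V x) \<partial>M"
  define L where "L = (\<integral>x. (V x)\<^sup>2 \<partial>M) / 2"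
  have L: "L \<ge> 0" by (simp add: L_def)
  show "bounded_linear (\<lambda>h. h *\<^sub>R ?D)" by (rule bounded_linear_scaleR_left)
  have i1: "integrable M (\<lambda>x. iexp (s * V x))" for s
    by (rule integrable_const_bound[where B = 1]) auto
  have i2: "integrable M (\<lambda>x. \<i> * V x * iexp (s * V x))" for s
    by (rule Bochner_Integration.integrable_bound[OF square_integrable_integrable[OF V]])
      (auto simp: norm_mult)
  have main: "cmod (?\<psi> y - ?\<psi> s - (y - s) *\<^sub>R ?D) \<le> L * (y - s)\<^sup>2" for y
  proof -
    have "?\<psi> y - ?\<psi> s - (y - s) *\<^sub>R ?D =
      (\<integral>x. iexp (y * V x) - iexp (s * V x) - (y - s) *\<^sub>R (\<i> * V x * iexp (s * V x)) \<partial>M)"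
      using i1 i2 by simp
    also have "cmod \<dots> \<le> (\<integral>x. (y - s)\<^sup>2 / 2 * (V x)\<^sup>2 \<partial>M)"
    proof (rule cmod_integral_le)
      fix x
      have "iexp (y * V x) = iexp (s * V x) * iexp ((y - s) * V x)"
        by (simp add: exp_add[symmetric] algebra_simps)
      then have "iexp (y * V x) - iexp (s * V x) - (y - s) *\<^sub>R (\<i> * V x * iexp (s * V x)) =
        iexp (s * V x) * (iexp ((y - s) * V x) - 1 - \<i> * complex_of_real ((y - s) * V x))"
        by (simp add: algebra_simps scaleR_conv_of_real)
      also have "cmod \<dots> \<le> ((y - s) * V x)\<^sup>2 / 2"
        using cmod_iexp_linear_le[of "(y - s) * V x"] by (simp only: norm_mult cmod_iexp mult_1)
      finally show "cmod (iexp (y * V x) - iexp (s * V x) - (y - s) *\<^sub>R (\<i> * V x * iexp (s * V x)))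
          \<le> (y - s)\<^sup>2 / 2 * (V x)\<^sup>2" by (simp add: power_mult_distrib)
    qed (use i1 i2 V in \<open>auto simp: square_integrable_def\<close>)
    also have "\<dots> = L * (y - s)\<^sup>2" by (simp add: L_def)
    finally show ?thesis .
  qed
  fix e :: real assume e: "e > 0"
  show "\<exists>d>0. \<forall>y. norm (y - s) < d \<longrightarrow>
    norm (?\<psi> y - ?\<psi> s - (y - s) *\<^sub>R ?D) \<le> e * norm (y - s)"
  proof (intro exI[of _ "e / (L + 1)"] conjI allI impI)
    show "e / (L + 1) > 0" using e L by simp
    fix y :: real assume "norm (y - s) < e / (L + 1)"
    then have "(L + 1) * \<bar>y - s\<bar> \<le> e" using L by (simp add: pos_less_divide_eq mult.commute)
    then have "L * \<bar>y - s\<bar> \<le> e" by (simp add: algebra_simps)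
    then have "L * \<bar>y - s\<bar> * \<bar>y - s\<bar> \<le> e * \<bar>y - s\<bar>" by (rule mult_right_mono) simp
    moreover have "L * (y - s)\<^sup>2 = L * \<bar>y - s\<bar> * \<bar>y - s\<bar>"
      by (simp add: mult.assoc flip: power2_eq_square)
    ultimately show "norm (?\<psi> y - ?\<psi> s - (y - s) *\<^sub>R ?D) \<le> e * norm (y - s)"
      using main[of y] unfolding real_norm_def by linarith
  qed
qed

text \<open>\<open>R\<close> bounds the residual of \<open>\<psi>' = - u v \<psi>\<close>.
  Multiplication by \<open>exp (v * u\<^sup>2 / 2)\<close> leaves only the residual in the
  derivative, so the mean value inequality applies. The largest value \<open>c\<close> of the factor
  on the interval is also the factor at \<open>s\<close>, hence it cancels from the final
  bound.\<close>

lemma gaussian_ode_bound: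
  fixes \<psi> :: "real \<Rightarrow> complex"
  assumes \<psi>: "\<And>s. (\<psi> has_vector_derivative D s) (at s)" and "\<psi> 0 = 1" and "v \<ge> 0"
    and R: "\<And>u. \<bar>u\<bar> \<le> \<bar>s\<bar> \<Longrightarrow> cmod (D u + (u * v) *\<^sub>R \<psi> u) \<le> R"
  shows "cmod (\<psi> s - exp (- (v * s\<^sup>2 / 2))) \<le> \<bar>s\<bar> * R"
proof -
  define G where "G u = exp (v * u\<^sup>2 / 2) *\<^sub>R \<psi> u" for u
  define c where "c = exp (v * s\<^sup>2 / 2)"
  have G: "(G has_vector_derivative exp (v * u\<^sup>2 / 2) *\<^sub>R (D u + (u * v) *\<^sub>R \<psi> u)) (at u within A)" for u A
  proof -
    have "((\<lambda>u. exp (v * u\<^sup>2 / 2)) has_real_derivative (exp (v * u\<^sup>2 / 2) * (u * v))) (at u within A)"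
      by (auto intro!: derivative_eq_intros simp: field_simps)
    from has_vector_derivative_scaleR[OF this has_vector_derivative_at_within[OF \<psi>[of u]]]
    show ?thesis unfolding G_def by (simp add: algebra_simps)
  qed
  have "norm (G s - G 0) \<le> (c * R) * norm (s - 0)"
  proof (rule differentiable_bound[of "{- \<bar>s\<bar>..\<bar>s\<bar>}"
        G "\<lambda>u h. h *\<^sub>R (exp (v * u\<^sup>2 / 2) *\<^sub>R (D u + (u * v) *\<^sub>R \<psi> u))" "c * R" s 0])
    fix u assume u: "u \<in> {- \<bar>s\<bar>..\<bar>s\<bar>}"
    then have us: "\<bar>u\<bar> \<le> \<bar>s\<bar>" by auto
    show "(G has_derivative (\<lambda>h. h *\<^sub>R (exp (v * u\<^sup>2 / 2) *\<^sub>R (D u + (u * v) *\<^sub>R \<psi> u))))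
        (at u within {- \<bar>s\<bar>..\<bar>s\<bar>})"
      using G by (simp add: has_vector_derivative_def)
    have "u\<^sup>2 \<le> s\<^sup>2" using us by (simp add: abs_le_square_iff)
    then have c: "exp (v * u\<^sup>2 / 2) \<le> c" using \<open>v \<ge> 0\<close> by (simp add: c_def mult_left_mono)
    let ?X = "exp (v * u\<^sup>2 / 2) *\<^sub>R (D u + (u * v) *\<^sub>R \<psi> u)"
    have X: "norm ?X \<le> c * R"
      using c R[OF us] exp_ge_zero[of "v * s\<^sup>2 / 2"]
      by (auto simp: c_def intro!: mult_mono)
    show "onorm (\<lambda>h. h *\<^sub>R ?X) \<le> c * R"
    proof (rule onorm_le)
      fix h :: real
      have "norm (h *\<^sub>R ?X) = \<bar>h\<bar> * norm ?X" by (rule norm_scaleR)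
      also have "\<dots> \<le> \<bar>h\<bar> * (c * R)" using X by (intro mult_left_mono) auto
      finally show "norm (h *\<^sub>R ?X) \<le> c * R * norm h" by (simp only: real_norm_def mult.commute)
    qed
  qed auto
  then have "cmod (c *\<^sub>R \<psi> s - 1) \<le> c * (\<bar>s\<bar> * R)"
    using \<open>\<psi> 0 = 1\<close> by (simp add: G_def c_def mult_ac)
  moreover have "c *\<^sub>R \<psi> s - 1 = c *\<^sub>R (\<psi> s - exp (- (v * s\<^sup>2 / 2)))"
    by (simp add: c_def scaleR_conv_of_real right_diff_distrib exp_minus flip: exp_of_real)
  ultimately have "c * cmod (\<psi> s - exp (- (v * s\<^sup>2 / 2))) \<le> c * (\<bar>s\<bar> * R)"
    by (simp add: c_def)
  then show ?thesis by (simp add: c_def)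
qed

text \<open>\<open>Nb i\<close> collects the sites on which \<open>Y i\<close> may depend,
  \<open>Mb i\<close> those \<open>k\<close> for which the products of \<open>Y\<close> with its
  neighbourhood sum at \<open>i\<close> and \<open>k\<close> may be correlated. Only three
  consequences of independence are assumed; the first holds at every frequency, because the residual
  of the differential equation must be bounded for all \<open>u\<close> up to \<open>s\<close> in
  absolute value. For \<open>s\<close> of order one over the root of \<open>card \<Gamma>\<close>,
  both error terms are of that order.\<close>

lemma (in prob_space) local_dependence_char_bound:
  fixes Y :: "'i \<Rightarrow> 'a \<Rightarrow> real" and \<Gamma> :: "'i set" and s K :: real and b c :: nat
  assumes fin: "finite \<Gamma>"
    and Y [measurable]: "\<And>i. Y i \<in> borel_measurable M"
    and K: "\<And>i x. x \<in> space M \<Longrightarrow> \<bar>Y i x\<bar> \<le> K"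
    and Nb: "\<And>i. i \<in> \<Gamma> \<Longrightarrow> Nb i \<subseteq> \<Gamma>" "\<And>i. i \<in> \<Gamma> \<Longrightarrow> card (Nb i) \<le> b"
    and Mb: "\<And>i. i \<in> \<Gamma> \<Longrightarrow> card (Mb i) \<le> c" "\<And>i. i \<in> \<Gamma> \<Longrightarrow> finite (Mb i)"
    and indep1: "\<And>i s. i \<in> \<Gamma> \<Longrightarrow> (\<integral>x. Y i x * iexp (s * (\<Sum>k\<in>\<Gamma> - Nb i. Y k x)) \<partial>M) = 0"
    and indep2: "\<And>i k. i \<in> \<Gamma> \<Longrightarrow> k \<in> \<Gamma> - Nb i \<Longrightarrow> (\<integral>x. Y i x * Y k x \<partial>M) = 0"
    and indep3: "\<And>i k. i \<in> \<Gamma> \<Longrightarrow> k \<in> \<Gamma> - Mb i \<Longrightarrow>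
      (\<integral>x. (Y i x * (\<Sum>j\<in>Nb i. Y j x)) * (Y k x * (\<Sum>j\<in>Nb k. Y j x)) \<partial>M) =
      (\<integral>x. Y i x * (\<Sum>j\<in>Nb i. Y j x) \<partial>M) * (\<integral>x. Y k x * (\<Sum>j\<in>Nb k. Y j x) \<partial>M)"
  defines "V \<equiv> \<lambda>x. \<Sum>i\<in>\<Gamma>. Y i x"
  defines "v \<equiv> \<integral>x. (V x)\<^sup>2 \<partial>M"
  shows "cmod ((\<integral>x. iexp (s * V x) \<partial>M) - exp (- (v * s\<^sup>2 / 2))) \<le>
    \<bar>s\<bar> * (card \<Gamma> * (K * (s * (b * K))\<^sup>2 / 2) + \<bar>s\<bar> * sqrt (card \<Gamma> * (c * (2 * (b * K\<^sup>2)\<^sup>2))))"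
proof -
  obtain x0 where x0: "x0 \<in> space M" using not_empty by blast
  have K0: "K \<ge> 0" using K[OF x0] abs_ge_zero order_trans by blast
  define \<eta> where "\<eta> i x = (\<Sum>j\<in>Nb i. Y j x)" for i x
  define T where "T i x = Y i x * \<eta> i x" for i x
  have [measurable]: "\<eta> i \<in> borel_measurable M" "T i \<in> borel_measurable M" "V \<in> borel_measurable M" for i
    unfolding \<eta>_def T_def V_def by measurable
  have \<eta>_bd: "\<bar>\<eta> i x\<bar> \<le> b * K" if "i \<in> \<Gamma>" "x \<in> space M" for i x
  proof -
    have "\<bar>\<eta> i x\<bar> \<le> (\<Sum>j\<in>Nb i. \<bar>Y j x\<bar>)" unfolding \<eta>_def by (rule sum_abs)
    also have "\<dots> \<le> card (Nb i) * K" using sum_bounded_above[of "Nb i" "\<lambda>j. \<bar>Y j x\<bar>" K] K[OF that(2)] by simp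
    also have "\<dots> \<le> b * K" using Nb(2)[OF that(1)] K0 by (intro mult_right_mono) auto
    finally show ?thesis .
  qed
  have T_bd: "\<bar>T i x\<bar> \<le> b * K\<^sup>2" if "i \<in> \<Gamma>" "x \<in> space M" for i x
    using mult_mono[OF K[OF that(2), of i] \<eta>_bd[OF that]] K0
    by (simp add: T_def abs_mult power2_eq_square mult_ac)
  have sqY: "square_integrable M (Y i)" for i
    by (rule square_integrable_bounded[OF Y K])
  have sqT: "square_integrable M (T i)" if "i \<in> \<Gamma>" for i
    by (rule square_integrable_bounded[OF _ T_bd[OF that]]) measurable
  have sqV: "square_integrable M V"
    unfolding V_def by (intro square_integrable_sum sqY)
  have sqTs: "square_integrable M (\<lambda>x. \<Sum>i\<in>\<Gamma>. T i x)"
    by (intro square_integrable_sum sqT)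
  \<comment> \<open>Pairs outside the neighbourhoods are uncorrelated, so the local products
    \<open>T i\<close> together have mean exactly \<open>v\<close>.\<close>
  have v_eq: "v = (\<Sum>i\<in>\<Gamma>. \<integral>x. T i x \<partial>M)"
  proof -
    have "v = (\<integral>x. (\<Sum>i\<in>\<Gamma>. \<Sum>k\<in>\<Gamma>. Y i x * Y k x) \<partial>M)"
      unfolding v_def V_def by (simp add: power2_eq_square sum_product)
    also have "\<dots> = (\<Sum>i\<in>\<Gamma>. \<Sum>k\<in>\<Gamma>. \<integral>x. Y i x * Y k x \<partial>M)"
      by (simp add: square_integrable_mult[OF sqY sqY])
    also have "\<dots> = (\<Sum>i\<in>\<Gamma>. \<Sum>k\<in>Nb i. \<integral>x. Y i x * Y k x \<partial>M)"
      using fin Nb(1) indep2 by (intro sum.cong refl sum.mono_neutral_right) auto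
    also have "\<dots> = (\<Sum>i\<in>\<Gamma>. \<integral>x. T i x \<partial>M)"
      by (simp add: T_def \<eta>_def sum_distrib_left square_integrable_mult[OF sqY sqY])
    finally show ?thesis .
  qed
  define W where "W x = (\<Sum>i\<in>\<Gamma>. T i x) - v" for x
  have sqW: "square_integrable M W"
    unfolding W_def by (intro square_integrable_diff sqTs square_integrable_const)
  \<comment> \<open>Of the covariances between \<open>T i\<close> and \<open>T k\<close>, only those
    with \<open>k\<close> in \<open>Mb i\<close> survive, at most \<open>c\<close> for each
    \<open>i\<close>; each is bounded by twice the square of the bound on \<open>T\<close>. Thus the
    variance grows like \<open>card \<Gamma>\<close> and not like its square.\<close>
  have varT: "l2norm M W \<le> sqrt (card \<Gamma> * (c * (2 * (b * K\<^sup>2)\<^sup>2)))"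
  proof -
    have "(\<integral>x. (W x)\<^sup>2 \<partial>M) = (\<integral>x. (\<Sum>i\<in>\<Gamma>. T i x)\<^sup>2 - 2 * v * (\<Sum>i\<in>\<Gamma>. T i x) + v\<^sup>2 \<partial>M)"
      unfolding W_def by (intro Bochner_Integration.integral_cong) (auto simp: power2_diff algebra_simps)
    also have "\<dots> = (\<integral>x. (\<Sum>i\<in>\<Gamma>. T i x)\<^sup>2 \<partial>M) - 2 * v * (\<integral>x. (\<Sum>i\<in>\<Gamma>. T i x) \<partial>M) + v\<^sup>2"
      using sqTs square_integrable_integrable[OF sqTs] by (simp add: square_integrable_def prob_space)
    also have "(\<integral>x. (\<Sum>i\<in>\<Gamma>. T i x) \<partial>M) = v"
      unfolding v_eq using sqT by (intro Bochner_Integration.integral_sum square_integrable_integrable)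
    also have "(\<integral>x. (\<Sum>i\<in>\<Gamma>. T i x)\<^sup>2 \<partial>M) = (\<integral>x. (\<Sum>i\<in>\<Gamma>. \<Sum>k\<in>\<Gamma>. T i x * T k x) \<partial>M)"
      by (simp add: power2_eq_square sum_product)
    also have "\<dots> = (\<Sum>i\<in>\<Gamma>. \<Sum>k\<in>\<Gamma>. \<integral>x. T i x * T k x \<partial>M)"
      using sqT by (simp add: square_integrable_mult)
    finally have "(\<integral>x. (W x)\<^sup>2 \<partial>M) =
        (\<Sum>i\<in>\<Gamma>. \<Sum>k\<in>\<Gamma>. (\<integral>x. T i x * T k x \<partial>M) - (\<integral>x. T i x \<partial>M) * (\<integral>x. T k x \<partial>M))"
      by (simp add: sum_subtractf power2_eq_square v_eq sum_product)
    also have "\<dots> = (\<Sum>i\<in>\<Gamma>. \<Sum>k\<in>\<Gamma> \<inter> Mb i. (\<integral>x. T i x * T k x \<partial>M) - (\<integral>x. T i x \<partial>M) * (\<integral>x. T k x \<partial>M))"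
      using fin indep3 by (intro sum.cong refl sum.mono_neutral_right) (auto simp: T_def \<eta>_def)
    also have "\<dots> \<le> (\<Sum>i\<in>\<Gamma>. c * (2 * (b * K\<^sup>2)\<^sup>2))"
    proof (rule sum_mono)
      fix i assume i: "i \<in> \<Gamma>"
      have "(\<integral>x. T i x * T k x \<partial>M) - (\<integral>x. T i x \<partial>M) * (\<integral>x. T k x \<partial>M) \<le> 2 * (b * K\<^sup>2)\<^sup>2"
        if k: "k \<in> \<Gamma> \<inter> Mb i" for k
      proof -
        have "k \<in> \<Gamma>" using k by simp
        have "\<bar>\<integral>x. T i x * T k x \<partial>M\<bar> \<le> (b * K\<^sup>2)\<^sup>2"
        proof -
          have "\<bar>T i x * T k x\<bar> \<le> (b * K\<^sup>2)\<^sup>2" if "x \<in> space M" for x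
            using mult_mono[OF T_bd[OF i that] T_bd[OF \<open>k \<in> \<Gamma>\<close> that]] by (simp add: abs_mult power2_eq_square)
          then have "(\<integral>x. \<bar>T i x * T k x\<bar> \<partial>M) \<le> (b * K\<^sup>2)\<^sup>2"
            using square_integrable_mult[OF sqT[OF i] sqT[OF \<open>k \<in> \<Gamma>\<close>]]
            by (intro integral_le_const) (auto intro!: AE_I2)
          then show ?thesis using integral_abs_bound[of M "\<lambda>x. T i x * T k x"] by linarith
        qed
        moreover have int_bd: "\<bar>\<integral>x. T i x \<partial>M\<bar> \<le> b * K\<^sup>2" if "i \<in> \<Gamma>" for i
        proof -
          have "(\<integral>x. \<bar>T i x\<bar> \<partial>M) \<le> b * K\<^sup>2"
            using square_integrable_integrable[OF sqT[OF that]] T_bd[OF that]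
            by (intro integral_le_const) (auto intro!: AE_I2)
          then show ?thesis using integral_abs_bound[of M "T i"] by linarith
        qed
        then have "\<bar>(\<integral>x. T i x \<partial>M) * (\<integral>x. T k x \<partial>M)\<bar> \<le> (b * K\<^sup>2)\<^sup>2"
          using mult_mono[OF int_bd[OF i] int_bd[OF \<open>k \<in> \<Gamma>\<close>]] by (simp add: abs_mult power2_eq_square)
        ultimately show ?thesis by linarith
      qed
      then have "(\<Sum>k\<in>\<Gamma> \<inter> Mb i. (\<integral>x. T i x * T k x \<partial>M) - (\<integral>x. T i x \<partial>M) * (\<integral>x. T k x \<partial>M)) \<le>
          card (\<Gamma> \<inter> Mb i) * (2 * (b * K\<^sup>2)\<^sup>2)"
        using sum_bounded_above[of "\<Gamma> \<inter> Mb i"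
          "\<lambda>k. (\<integral>x. T i x * T k x \<partial>M) - (\<integral>x. T i x \<partial>M) * (\<integral>x. T k x \<partial>M)"
          "2 * (b * K\<^sup>2)\<^sup>2"] by simp
      also have "card (\<Gamma> \<inter> Mb i) \<le> c"
        using Mb[OF i] card_mono[of "Mb i" "\<Gamma> \<inter> Mb i"] by auto
      then have "card (\<Gamma> \<inter> Mb i) * (2 * (b * K\<^sup>2)\<^sup>2) \<le> c * (2 * (b * K\<^sup>2)\<^sup>2)"
        by (intro mult_right_mono) auto
      finally show "(\<Sum>k\<in>\<Gamma> \<inter> Mb i. (\<integral>x. T i x * T k x \<partial>M) - (\<integral>x. T i x \<partial>M) * (\<integral>x. T k x \<partial>M)) \<le>
          c * (2 * (b * K\<^sup>2)\<^sup>2)" .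
    qed
    also have "\<dots> = card \<Gamma> * (c * (2 * (b * K\<^sup>2)\<^sup>2))" by simp
    finally show ?thesis unfolding l2norm_def by (rule real_sqrt_le_mono)
  qed
  define \<psi> where "\<psi> s = (\<integral>x. iexp (s * V x) \<partial>M)" for s
  define D where "D s = (\<integral>x. \<i> * V x * iexp (s * V x) \<partial>M)" for s
  have int_e: "integrable M (\<lambda>x. f x * iexp (u * V x))" if "integrable M f" for f :: "'a \<Rightarrow> real" and u
    by (rule Bochner_Integration.integrable_bound[OF that]) (use that in \<open>auto simp: norm_mult\<close>)
  have D_bd: "cmod (D u + (u * v) *\<^sub>R \<psi> u) \<le>
      card \<Gamma> * (K * (s * (b * K))\<^sup>2 / 2) + \<bar>s\<bar> * sqrt (card \<Gamma> * (c * (2 * (b * K\<^sup>2)\<^sup>2)))"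
    if us: "\<bar>u\<bar> \<le> \<bar>s\<bar>" for u
  proof -
    let ?e = "\<lambda>x. iexp (u * V x)"
    \<comment> \<open>Taylor remainder of site \<open>i\<close>: the derivative of the
      characteristic function is \<open>\<i>\<close> times the sum of the first integrals, and the
      second is the first-order effect of removing the neighbourhood from the exponent.\<close>
    define q where "q i = (\<integral>x. Y i x * ?e x \<partial>M) - \<i> * u * (\<integral>x. T i x * ?e x \<partial>M)" for i
    have summand: "cmod (q i) \<le> K * (s * (b * K))\<^sup>2 / 2"
      if i: "i \<in> \<Gamma>" for i
    proof -
      have i_rest: "integrable M (\<lambda>x. Y i x * iexp (u * (\<Sum>k\<in>\<Gamma> - Nb i. Y k x)))"
        by (rule Bochner_Integration.integrable_bound[OF square_integrable_integrable[OF sqY[of i]]])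
          (auto simp: norm_mult)
      have ints: "integrable M (\<lambda>x. Y i x * ?e x)" "integrable M (\<lambda>x. T i x * ?e x)"
        using int_e square_integrable_integrable sqY sqT[OF i] by auto
      \<comment> \<open>The inserted integral is zero by \<open>indep1\<close>; it makes the
        difference of the two exponentials visible.\<close>
      have "q i =
        (\<integral>x. Y i x * ?e x \<partial>M) - (\<integral>x. Y i x * iexp (u * (\<Sum>k\<in>\<Gamma> - Nb i. Y k x)) \<partial>M)
          - \<i> * u * (\<integral>x. T i x * ?e x \<partial>M)"
        using indep1[OF i] by (simp add: q_def)
      also have "\<dots> = (\<integral>x. Y i x * ?e x - Y i x * iexp (u * (\<Sum>k\<in>\<Gamma> - Nb i. Y k x))
          - \<i> * u * (T i x * ?e x) \<partial>M)"
        using ints i_rest by simp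
      also have "cmod \<dots> \<le> K * (s * (b * K))\<^sup>2 / 2"
      proof (rule cmod_integral_le_const)
        fix x assume x: "x \<in> space M"
        have "V x = (\<Sum>k\<in>\<Gamma> - Nb i. Y k x) + \<eta> i x"
          unfolding V_def \<eta>_def using fin Nb(1)[OF i] by (simp add: sum.subset_diff)
        then have rest: "iexp (u * (\<Sum>k\<in>\<Gamma> - Nb i. Y k x)) = ?e x * iexp (- (u * \<eta> i x))"
          by (simp add: exp_add[symmetric] algebra_simps)
        have "Y i x * ?e x - Y i x * iexp (u * (\<Sum>k\<in>\<Gamma> - Nb i. Y k x)) - \<i> * u * (T i x * ?e x) =
            - (Y i x * ?e x * (iexp (- (u * \<eta> i x)) - 1 - \<i> * complex_of_real (- (u * \<eta> i x))))"
          unfolding rest T_def by (simp add: algebra_simps)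
        also have "cmod \<dots> = \<bar>Y i x\<bar> * cmod (iexp (- (u * \<eta> i x)) - 1 - \<i> * complex_of_real (- (u * \<eta> i x)))"
          by (simp only: norm_minus_cancel norm_mult cmod_iexp norm_of_real mult_1_right)
        also have "\<dots> \<le> K * ((- (u * \<eta> i x))\<^sup>2 / 2)"
          by (intro mult_mono K x cmod_iexp_linear_le K0) auto
        also have "(- (u * \<eta> i x))\<^sup>2 \<le> (s * (b * K))\<^sup>2"
          using mult_mono[OF us \<eta>_bd[OF i x]] K0 by (simp add: abs_mult flip: abs_le_square_iff)
        finally show "cmod (Y i x * ?e x - Y i x * iexp (u * (\<Sum>k\<in>\<Gamma> - Nb i. Y k x))
            - \<i> * u * (T i x * ?e x)) \<le> K * (s * (b * K))\<^sup>2 / 2"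
          using K0 by (simp add: mult_left_mono)
      qed measurable
      finally show ?thesis .
    qed
    have DY: "D u = \<i> * (\<Sum>i\<in>\<Gamma>. \<integral>x. Y i x * ?e x \<partial>M)"
    proof -
      have "D u = (\<integral>x. \<i> * (\<Sum>i\<in>\<Gamma>. Y i x * ?e x) \<partial>M)"
        unfolding D_def by (simp add: V_def sum_distrib_right mult.assoc)
      also have "\<dots> = \<i> * (\<Sum>i\<in>\<Gamma>. \<integral>x. Y i x * ?e x \<partial>M)"
        using int_e square_integrable_integrable sqY by simp
      finally show ?thesis .
    qed
    have WT: "(\<integral>x. W x * ?e x \<partial>M) = (\<Sum>i\<in>\<Gamma>. \<integral>x. T i x * ?e x \<partial>M) - v * \<psi> u"
    proof -
      have "(\<integral>x. W x * ?e x \<partial>M) = (\<integral>x. (\<Sum>i\<in>\<Gamma>. T i x * ?e x) - v * ?e x \<partial>M)"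
        by (simp add: W_def sum_distrib_right left_diff_distrib)
      also have "\<dots> = (\<Sum>i\<in>\<Gamma>. \<integral>x. T i x * ?e x \<partial>M) - v * \<psi> u"
      proof -
        have "integrable M (\<lambda>x. T i x * ?e x)" if "i \<in> \<Gamma>" for i
          using int_e square_integrable_integrable sqT[OF that] by auto
        moreover have "integrable M ?e" using int_e[of "\<lambda>_. 1"] by simp
        ultimately show ?thesis unfolding \<psi>_def by simp
      qed
      finally show ?thesis .
    qed
    \<comment> \<open>The residual has two sources: the Taylor remainders \<open>q i\<close>, and
      the fluctuation \<open>W\<close> of the sum of the local products around its mean
      \<open>v\<close>.\<close>
    have "D u + (u * v) *\<^sub>R \<psi> u =
        \<i> * (\<Sum>i\<in>\<Gamma>. q i) - u * (\<integral>x. W x * ?e x \<partial>M)"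
      unfolding DY WT q_def
      by (simp add: sum_subtractf sum_distrib_left[symmetric] scaleR_conv_of_real algebra_simps)
    also have "cmod \<dots> \<le> cmod (\<Sum>i\<in>\<Gamma>. q i)
        + \<bar>u\<bar> * cmod (\<integral>x. W x * ?e x \<partial>M)"
      by (rule order_trans[OF norm_triangle_ineq4]) (simp add: norm_mult)
    finally have "cmod (D u + (u * v) *\<^sub>R \<psi> u) \<le>
        cmod (\<Sum>i\<in>\<Gamma>. q i)
        + \<bar>u\<bar> * cmod (\<integral>x. W x * ?e x \<partial>M)" .
    moreover have "cmod (\<Sum>i\<in>\<Gamma>. q i) \<le>
        card \<Gamma> * (K * (s * (b * K))\<^sup>2 / 2)"
      by (rule sum_norm_bound) (rule summand)
    moreover have "\<bar>u\<bar> * cmod (\<integral>x. W x * ?e x \<partial>M) \<le> \<bar>s\<bar> * sqrt (card \<Gamma> * (c * (2 * (b * K\<^sup>2)\<^sup>2)))"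
    proof (rule mult_mono[OF us])
      have "cmod (\<integral>x. W x * ?e x \<partial>M) \<le> (\<integral>x. \<bar>W x\<bar> \<partial>M)"
      proof (rule cmod_integral_le)
        show "integrable M (\<lambda>x. W x * ?e x)" "integrable M (\<lambda>x. \<bar>W x\<bar>)"
          using int_e square_integrable_integrable[OF sqW] by auto
      qed (simp add: norm_mult)
      also have "\<dots> \<le> l2norm M W" by (rule integral_abs_le_l2norm[OF sqW])
      also note varT
      finally show "cmod (\<integral>x. W x * ?e x \<partial>M) \<le> sqrt (card \<Gamma> * (c * (2 * (b * K\<^sup>2)\<^sup>2)))" .
    qed auto
    ultimately show ?thesis by linarith
  qed
  have "cmod (\<psi> s - exp (- (v * s\<^sup>2 / 2))) \<le> \<bar>s\<bar> * (card \<Gamma> * (K * (s * (b * K))\<^sup>2 / 2) +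
      \<bar>s\<bar> * sqrt (card \<Gamma> * (c * (2 * (b * K\<^sup>2)\<^sup>2))))"
  proof (rule gaussian_ode_bound[where D = D])
    show "(\<psi> has_vector_derivative D s) (at s)" for s
      using has_vector_derivative_char[OF sqV] unfolding \<psi>_def[abs_def] D_def .
    show "\<psi> 0 = 1" by (simp add: \<psi>_def prob_space)
    show "v \<ge> 0" by (simp add: v_def)
  qed (rule D_bd)
  then show ?thesis by (simp add: \<psi>_def)
qed

section \<open>Stationary fields on a product space\<close>

lemma cmod_iexp_diff_le: "cmod (iexp x - iexp y) \<le> \<bar>x - y\<bar>"
proof -
  have "iexp x = iexp y * iexp (x - y)" by (simp add: exp_add[symmetric] algebra_simps)
  then have "iexp x - iexp y = iexp y * (iexp (x - y) - 1)" by (simp add: algebra_simps)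
  then have "cmod (iexp x - iexp y) = cmod (iexp (x - y) - 1)" by (simp only: norm_mult cmod_iexp mult_1)
  also have "\<dots> \<le> \<bar>x - y\<bar>" using iexp_approx1[of "x - y" 0] by simp
  finally show ?thesis .
qed

lemma abs_exp_minus_diff_le:
  fixes a b :: real
  assumes "0 \<le> a" "0 \<le> b"
  shows "\<bar>exp (- a) - exp (- b)\<bar> \<le> \<bar>a - b\<bar>"
proof -
  have *: "exp (- a) - exp (- b) \<le> b - a" if "0 \<le> a" "a \<le> b" for a b :: real
  proof -
    have "exp (- a) - exp (- b) = exp (- a) * (1 - exp (a - b))"
      by (simp add: algebra_simps flip: exp_add)
    also have "\<dots> \<le> 1 * (b - a)"
    proof (rule mult_mono)
      show "1 - exp (a - b) \<le> b - a" using exp_ge_add_one_self[of "a - b"] by linarith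
    qed (use that in auto)
    finally show ?thesis by simp
  qed
  show ?thesis
  proof (cases "a \<le> b")
    case True
    then have "exp (- b) \<le> exp (- a)" by simp
    with *[of a b] True assms show ?thesis by linarith
  next
    case False
    then have "exp (- a) \<le> exp (- b)" by simp
    with *[of b a] False assms show ?thesis by linarith
  qed
qed

section \<open>Translations and sums of a stationary field\<close>

locale iid_field = iid_product N idx
  for N :: "'e measure" and idx :: "('i :: ab_group_add) itself"
begin

text \<open>The index is reflected, following the convention that \<open>X i\<close> evaluates
  \<open>g\<close> at the innovations \<open>i - s\<close>. In particular \<open>translate 0\<close>
  is the reflection of the configuration and not the identity.\<close>

definition translate :: "'i \<Rightarrow> ('i \<Rightarrow> 'e) \<Rightarrow> 'i \<Rightarrow> 'e" where
  "translate i x = (\<lambda>s. x (i - s))"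

lemma measurable_translate [measurable]: "translate i \<in> measurable P P"
  unfolding translate_def by (rule measurable_abs_UNIV) simp

lemma translate_in_space: "x \<in> space P \<Longrightarrow> translate i x \<in> space P"
  by (auto simp: space_PiM translate_def PiE_iff)

lemma distr_translate: "distr P P (translate i) = P"
  using distr_PiM_reindex[of UNIV "\<lambda>_. N" "\<lambda>s. i - s" UNIV] M.prob_space_axioms
  by (simp add: restrict_def translate_def[abs_def] inj_on_def)

lemma l2_translate:
  assumes "square_integrable P F"
  shows "square_integrable P (\<lambda>x. F (translate i x))" "l2norm P (\<lambda>x. F (translate i x)) = l2norm P F"
  using l2norm_distr[OF measurable_translate distr_translate assms] by auto

lemma integral_translate:
  fixes F :: "_ \<Rightarrow> 'b :: {banach, second_countable_topology}"
  assumes "F \<in> borel_measurable P"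
  shows "(\<integral>x. F (translate i x) \<partial>P) = (\<integral>x. F x \<partial>P)"
  using integral_distr[OF measurable_translate assms, of i] by (simp add: distr_translate)

lemma distr_translate_pair: "distr PP PP (\<lambda>z. (translate i (fst z), translate i (snd z))) = PP"
proof -
  have "distr P P (translate i) \<Otimes>\<^sub>M distr P P (translate i) =
      distr PP PP (\<lambda>(x, y). (translate i x, translate i y))"
    by (rule pair_measure_distr) (simp_all add: distr_translate P.sigma_finite_measure_axioms)
  then show ?thesis by (simp add: distr_translate case_prod_beta')
qed

lemma translate_resample:
  "translate i (resample {a} x y) = resample {i - a} (translate i x) (translate i y)"
proof
  fix s
  have "i - s = a \<longleftrightarrow> s = i - a" by (auto simp: algebra_simps)
  then show "translate i (resample {a} x y) s = resample {i - a} (translate i x) (translate i y) s"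
    by (simp add: translate_def resample_def)
qed

text \<open>Sites and field indices are interchangeable: the effect of innovation \<open>a\<close>
  on the field at \<open>i\<close> depends on \<open>i - a\<close> alone. So the physical dependence
  measure of \<open>X i\<close> at the origin is the coefficient of \<open>g\<close> at site
  \<open>i\<close>.\<close>

lemma delta_translate:
  assumes F: "square_integrable P F"
  shows "delta a (\<lambda>x. F (translate i x)) = delta (i - a) F"
proof -
  let ?t = "\<lambda>z. (translate i (fst z), translate i (snd z))"
  have t: "?t \<in> measurable PP PP" by measurable
  have "delta a (\<lambda>x. F (translate i x)) =
      l2norm PP (\<lambda>z. (\<lambda>z. F (fst z) - F (resample {i - a} (fst z) (snd z))) (?t z))"
    unfolding delta_def by (simp add: translate_resample)
  also have "\<dots> = delta (i - a) F"
    unfolding delta_def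
    by (rule l2norm_distr(2)[OF t distr_translate_pair square_integrable_resample_diff[OF F]])
  finally show ?thesis .
qed

definition field_sum :: "'i set \<Rightarrow> (('i \<Rightarrow> 'e) \<Rightarrow> real) \<Rightarrow> ('i \<Rightarrow> 'e) \<Rightarrow> real" where
  "field_sum \<Gamma> F x = (\<Sum>i\<in>\<Gamma>. F (translate i x))"

lemma field_sum_diff: "field_sum \<Gamma> (\<lambda>x. F x - G x) x = field_sum \<Gamma> F x - field_sum \<Gamma> G x"
  by (simp add: field_sum_def sum_subtractf)

lemma square_integrable_field_sum:
  assumes "square_integrable P F" shows "square_integrable P (field_sum \<Gamma> F)"
  unfolding field_sum_def by (intro square_integrable_sum l2_translate(1) assms)

lemma integral_field_sum:
  assumes "square_integrable P F" "(\<integral>x. F x \<partial>P) = 0"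
  shows "(\<integral>x. field_sum \<Gamma> F x \<partial>P) = 0"
proof -
  have "(\<integral>x. field_sum \<Gamma> F x \<partial>P) = (\<Sum>i\<in>\<Gamma>. \<integral>x. F (translate i x) \<partial>P)"
    unfolding field_sum_def
    by (intro Bochner_Integration.integral_sum P.square_integrable_integrable
        l2_translate(1) assms(1))
  also have "\<dots> = 0"
    using assms by (simp add: integral_translate square_integrable_def)
  finally show ?thesis .
qed

text \<open>The coefficient of the sum at \<open>l\<close> is at most the sum of
  \<open>delta (i - l) F\<close> over \<open>i\<close>. In this matrix every row and every column
  sums to at most \<open>D\<close>, so bounding one factor of the square by \<open>D\<close> and
  summing the other over \<open>l\<close> first yields \<open>card \<Gamma> * D\<^sup>2\<close>.
  Efron-Stein finishes the proof, its factor 1/2 being dropped.\<close>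

lemma l2norm_field_sum_le:
  assumes F: "square_integrable P F" "(\<integral>x. F x \<partial>P) = 0"
    and D: "\<And>B. finite B \<Longrightarrow> (\<Sum>a\<in>B. delta a F) \<le> D"
  shows "l2norm P (field_sum \<Gamma> F) \<le> sqrt (card \<Gamma>) * D"
proof (cases "finite \<Gamma>")
  \<comment> \<open>For infinite \<open>\<Gamma>\<close> both the sum and the cardinality take the
    default value \<open>0\<close>.\<close>
  case False
  then show ?thesis by (simp add: field_sum_def[abs_def] P.l2norm_const)
next
  case True
  have D0: "D \<ge> 0" using D[of "{}"] by simp
  note S = square_integrable_field_sum[OF F(1), of \<Gamma>]
  have delta_S: "delta l (field_sum \<Gamma> F) \<le> (\<Sum>i\<in>\<Gamma>. delta (i - l) F)" for l
    using delta_sum_le[of \<Gamma> "\<lambda>i x. F (translate i x)" l] l2_translate(1)[OF F(1)]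
    by (simp add: field_sum_def[abs_def] delta_translate[OF F(1)])
  have row: "(\<Sum>i\<in>\<Gamma>. delta (i - l) F) \<le> D" for l
    using D[of "(\<lambda>i. i - l) ` \<Gamma>"] True by (simp add: sum.reindex inj_on_def)
  have col: "(\<Sum>l\<in>B. delta (i - l) F) \<le> D" if "finite B" for i B
    using D[of "(\<lambda>l. i - l) ` B"] that by (simp add: sum.reindex inj_on_def)
  have "(\<Sum>l\<in>B. (delta l (field_sum \<Gamma> F))\<^sup>2) \<le> card \<Gamma> * D\<^sup>2" if B: "finite B" for B
  proof -
    have "(\<Sum>l\<in>B. (delta l (field_sum \<Gamma> F))\<^sup>2) \<le> (\<Sum>l\<in>B. D * (\<Sum>i\<in>\<Gamma>. delta (i - l) F))"
    proof (rule sum_mono)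
      fix l
      have "delta l (field_sum \<Gamma> F) * delta l (field_sum \<Gamma> F) \<le> D * (\<Sum>i\<in>\<Gamma>. delta (i - l) F)"
        using delta_S[of l] row[of l] by (intro mult_mono D0) auto
      then show "(delta l (field_sum \<Gamma> F))\<^sup>2 \<le> D * (\<Sum>i\<in>\<Gamma>. delta (i - l) F)"
        by (simp add: power2_eq_square)
    qed
    also have "\<dots> = D * (\<Sum>i\<in>\<Gamma>. \<Sum>l\<in>B. delta (i - l) F)"
      unfolding sum_distrib_left[symmetric] by (subst sum.swap) simp
    also have "\<dots> \<le> D * (\<Sum>i\<in>\<Gamma>. D)"
      using D0 col[OF B] by (intro mult_left_mono sum_mono) auto
    finally show ?thesis by (simp add: power2_eq_square mult_ac)
  qed
  from variance_le_delta[OF S this]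
  have "(l2norm P (field_sum \<Gamma> F))\<^sup>2 \<le> card \<Gamma> * D\<^sup>2 / 2"
    using integral_field_sum[OF F] by (simp add: l2norm_power2)
  also have "\<dots> \<le> (sqrt (card \<Gamma>) * D)\<^sup>2" by (simp add: power_mult_distrib)
  finally show ?thesis by (rule power2_le_imp_le) (use D0 in simp)
qed

lemma tail_of_summable_delta:
  assumes "(\<lambda>a. delta a F) summable_on UNIV" "e > 0"
  shows "\<exists>C. finite C \<and> (\<forall>B. finite B \<longrightarrow> B \<inter> C = {} \<longrightarrow> (\<Sum>a\<in>B. delta a F) \<le> e)"
proof -
  let ?S = "infsum (\<lambda>a. delta a F) UNIV"
  have "(sum (\<lambda>a. delta a F) \<longlongrightarrow> ?S) (finite_subsets_at_top UNIV)"
    using has_sum_infsum[OF assms(1)] by (simp add: has_sum_def)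
  from tendstoD[OF this assms(2)]
  obtain C where C: "finite C" "dist (\<Sum>a\<in>C. delta a F) ?S < e"
    unfolding eventually_finite_subsets_at_top by blast
  show ?thesis
  proof (intro exI[of _ C] conjI allI impI C(1))
    fix B assume B: "finite B" "B \<inter> C = {}"
    have "(\<Sum>a\<in>B. delta a F) + (\<Sum>a\<in>C. delta a F) = (\<Sum>a\<in>B \<union> C. delta a F)"
      using B C(1) by (simp add: sum.union_disjoint)
    also have "\<dots> \<le> ?S"
      using B C(1) assms(1) by (intro finite_sum_le_infsum) auto
    finally show "(\<Sum>a\<in>B. delta a F) \<le> e" using C(2) by (simp add: dist_real_def)
  qed
qed

lemma delta_clamp_le:
  assumes F: "square_integrable P F" and "0 \<le> T"
  shows "delta a (\<lambda>x. clamp T (F x)) \<le> delta a F"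
  unfolding delta_def
proof (rule l2norm_mono)
  show "square_integrable PP (\<lambda>z. F (fst z) - F (resample {a} (fst z) (snd z)))"
    by (rule square_integrable_resample_diff[OF F])
  show "(\<lambda>z. clamp T (F (fst z)) - clamp T (F (resample {a} (fst z) (snd z)))) \<in> borel_measurable PP"
    using square_integrable_resample_diff[OF square_integrable_clamp[OF assms], of "{a}"]
    by (simp add: square_integrable_def)
qed (rule clamp_lipschitz)

text \<open>Clamping and averaging out all but finitely many innovations do not increase any
  \<open>delta a\<close>. Hence \<open>delta a (F - Z)\<close> is at most twice \<open>delta a F\<close>, which handles the tail of
  the sum, and at most twice the distance of \<open>F\<close> and \<open>Z\<close>, which handles the remaining terms.\<close>

lemma local_bounded_approximation:
  assumes F: "square_integrable P F"
    and summable: "(\<lambda>a. delta a F) summable_on UNIV" and "e > 0"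
  obtains A Z K where "finite A" "Z \<in> borel_measurable P" "\<And>x. x \<in> space P \<Longrightarrow> \<bar>Z x\<bar> \<le> K"
    "depends_on A Z" "(\<integral>x. Z x \<partial>P) = 0"
    "\<And>B. finite B \<Longrightarrow> (\<Sum>a\<in>B. delta a (\<lambda>x. F x - Z x)) \<le> e"
proof -
  obtain C where C: "finite C" "\<And>B. finite B \<Longrightarrow> B \<inter> C = {} \<Longrightarrow> (\<Sum>a\<in>B. delta a F) \<le> e / 4"
    using tail_of_summable_delta[OF summable, of "e / 4"] \<open>e > 0\<close> by auto
  \<comment> \<open>At most \<open>card C\<close> sites lie in \<open>C\<close>, each contributing
    at most \<open>2 * r\<close>, together at most \<open>e / 2\<close>; the tail outside
    \<open>C\<close> uses the other half.\<close>
  define r where "r = e / (4 * (card C + 1))"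
  have r: "r > 0" using \<open>e > 0\<close> by (simp add: r_def)
  obtain T where T: "T \<ge> 0" "l2norm P (\<lambda>x. F x - clamp T (F x)) < r / 2"
    using l2_clamp_approx[OF F, of "r / 2"] r by auto
  define U where "U x = clamp T (F x)" for x
  have U: "square_integrable P U" "\<And>x. \<bar>U x\<bar> \<le> T"
    using square_integrable_clamp[OF F T(1)] abs_clamp_le[OF T(1)] unfolding U_def by auto
  have mU: "U \<in> borel_measurable P" using U(1) by (simp add: square_integrable_def)
  obtain A where A: "finite A" "l2norm PP (\<lambda>z. U (snd z) - U (resample A (fst z) (snd z))) < r / 2"
    using resample_l2_approx[OF U(1), of "r / 2"] r by auto
  define Z0 where "Z0 = local_part A U"
  have Z0: "square_integrable P Z0" unfolding Z0_def by (rule square_integrable_local_part[OF mU U(2)])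
  \<comment> \<open>Centring subtracts a constant and therefore changes no coefficient.\<close>
  define m where "m = (\<integral>x. Z0 x \<partial>P)"
  define Z where "Z x = Z0 x - m" for x
  have "l2norm P (\<lambda>x. U x - Z0 x) < r / 2"
    using l2norm_local_part_le[OF mU U(2), of A] A(2) by (simp add: Z0_def)
  moreover have "l2norm P (\<lambda>x. (F x - U x) + (U x - Z0 x)) \<le>
      l2norm P (\<lambda>x. F x - U x) + l2norm P (\<lambda>x. U x - Z0 x)"
    by (intro l2norm_add_le square_integrable_diff F U Z0)
  ultimately have FZ: "l2norm P (\<lambda>x. F x - Z0 x) \<le> r"
    using T(2) by (simp add: U_def)
  have eq: "delta a (\<lambda>x. F x - Z x) = delta a (\<lambda>x. F x - Z0 x)" for a
    by (simp add: delta_def Z_def algebra_simps)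
  have d1: "delta a (\<lambda>x. F x - Z x) \<le> 2 * r" for a
    unfolding eq using delta_le_l2norm[OF square_integrable_diff[OF F Z0], of a] FZ by linarith
  have d2: "delta a (\<lambda>x. F x - Z x) \<le> 2 * delta a F" for a
  proof -
    have "delta a Z0 \<le> delta a U" unfolding Z0_def by (rule delta_local_part_le[OF mU U(2)])
    also have "\<dots> \<le> delta a F" unfolding U_def by (rule delta_clamp_le[OF F T(1)])
    finally show ?thesis unfolding eq using delta_diff_le[OF F Z0, of a] by linarith
  qed
  show ?thesis
  proof
    show "finite A" by fact
    have mZ0: "Z0 \<in> borel_measurable P" unfolding Z0_def using mU by measurable
    then show "Z \<in> borel_measurable P" unfolding Z_def by measurable
    show "\<bar>Z x\<bar> \<le> T + \<bar>m\<bar>" if "x \<in> space P" for x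
      using abs_local_part_le[OF mU U(2) that, of A] unfolding Z_def Z0_def by linarith
    show "depends_on A Z"
      using depends_on_local_part[of A U] unfolding Z_def Z0_def depends_on_def by fastforce
    show "(\<integral>x. Z x \<partial>P) = 0"
      unfolding Z_def using P.square_integrable_integrable[OF Z0] by (simp add: m_def P.prob_space)
    fix B :: "'i set" assume B: "finite B"
    have "(\<Sum>a\<in>B. delta a (\<lambda>x. F x - Z x)) =
      (\<Sum>a\<in>B \<inter> C. delta a (\<lambda>x. F x - Z x)) + (\<Sum>a\<in>B - C. delta a (\<lambda>x. F x - Z x))"
      using B by (rule sum.Int_Diff)
    also have "(\<Sum>a\<in>B \<inter> C. delta a (\<lambda>x. F x - Z x)) \<le> card (B \<inter> C) * (2 * r)"
      by (rule sum_bounded_above) (rule d1)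
    also have "card (B \<inter> C) * (2 * r) \<le> (card C + 1) * (2 * r)"
      using r card_mono[OF C(1), of "B \<inter> C"] by (intro mult_right_mono) auto
    also have "\<dots> = e / 2" by (simp add: r_def field_simps)
    also have "(\<Sum>a\<in>B - C. delta a (\<lambda>x. F x - Z x)) \<le> (\<Sum>a\<in>B - C. 2 * delta a F)"
      by (rule sum_mono) (rule d2)
    also have "\<dots> = 2 * (\<Sum>a\<in>B - C. delta a F)" by (simp add: sum_distrib_left)
    also have "(\<Sum>a\<in>B - C. delta a F) \<le> e / 4" using B by (intro C(2)) auto
    finally show "(\<Sum>a\<in>B. delta a (\<lambda>x. F x - Z x)) \<le> e" by simp
  qed
qed

lemma depends_on_translate:
  assumes "depends_on A Z"
  shows "depends_on ((\<lambda>a. i - a) ` A) (\<lambda>x. Z (translate i x))"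
  using assms unfolding depends_on_def by (auto simp: translate_def)

lemma depends_on_sum:
  assumes "\<And>k. k \<in> J \<Longrightarrow> depends_on (C k) (f k)"
  shows "depends_on (\<Union>k\<in>J. C k) (\<lambda>x. \<Sum>k\<in>J. f k x)"
  using assms unfolding depends_on_def by (intro allI impI sum.cong refl) blast

lemma depends_on_compose: "depends_on C f \<Longrightarrow> depends_on C (\<lambda>x. h (f x))"
  unfolding depends_on_def by metis

lemma depends_on_mult:
  "depends_on C f \<Longrightarrow> depends_on D h \<Longrightarrow> depends_on (C \<union> D) (\<lambda>x. f x * h x :: real)"
  unfolding depends_on_def by (metis UnCI)

text \<open>The field at \<open>i\<close> depends only on the innovations in \<open>i - A\<close>,
  so two sites interact only if their difference lies in the finite set of differences of
  \<open>A\<close>. All neighbourhood sizes are thus bounded independently of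
  \<open>\<Gamma>\<close>, and so is \<open>c\<close>.\<close>

lemma local_field_char_bound:
  assumes "finite A" and Z [measurable]: "Z \<in> borel_measurable P"
    and K: "\<And>x. x \<in> space P \<Longrightarrow> \<bar>Z x\<bar> \<le> K"
    and dep: "depends_on A Z" and mean: "(\<integral>x. Z x \<partial>P) = 0"
  shows "\<exists>c. \<forall>\<Gamma>. finite \<Gamma> \<longrightarrow> \<Gamma> \<noteq> {} \<longrightarrow>
    cmod ((\<integral>x. iexp (t * (field_sum \<Gamma> Z x / sqrt (card \<Gamma>))) \<partial>P)
      - exp (- ((\<integral>x. (field_sum \<Gamma> Z x)\<^sup>2 \<partial>P) / card \<Gamma> * t\<^sup>2 / 2))) \<le> c / sqrt (card \<Gamma>)"
proof -
  define D where "D = (\<lambda>(a, a'). a' - a) ` (A \<times> A)"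
  \<comment> \<open>Possible values of \<open>k - i\<close> when the neighbourhoods of
    \<open>i\<close> and \<open>k\<close> interact: a step from \<open>i\<close> to
    \<open>j\<close>, a step from \<open>j\<close> to \<open>j'\<close>, and a step back from
    \<open>j'\<close> to \<open>k\<close>. The inserted \<open>0\<close> allows \<open>j = i\<close>
    and \<open>j' = k\<close>.\<close>
  define D3 where "D3 = (\<lambda>((d, d'), e). d - d' + e) ` ((insert 0 D \<times> insert 0 D) \<times> D)"
  have fin: "finite D" "finite D3" using \<open>finite A\<close> by (auto simp: D_def D3_def)
  define Y where "Y i x = Z (translate i x)" for i x
  define C where "C i = (\<lambda>a. i - a) ` A" for i
  define Mb where "Mb i = (\<lambda>d. i + d) ` D3" for i
  have Y [measurable]: "Y i \<in> borel_measurable P" for i unfolding Y_def by measurable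
  have Y_bd: "\<bar>Y i x\<bar> \<le> K" if "x \<in> space P" for i x
    unfolding Y_def by (rule K[OF translate_in_space[OF that]])
  have Y_mean: "(\<integral>x. Y i x \<partial>P) = 0" for i
    unfolding Y_def using integral_translate[OF Z] mean by simp
  have Y_dep: "depends_on (C i) (Y i)" for i
    unfolding Y_def[abs_def] C_def by (rule depends_on_translate[OF dep])
  have disj: "C i \<inter> C k = {}" if "k - i \<notin> D" for i k
  proof (rule ccontr)
    assume "C i \<inter> C k \<noteq> {}"
    then obtain a a' where a: "a \<in> A" "a' \<in> A" "i - a = k - a'" unfolding C_def by blast
    have "a' - a \<in> D" unfolding D_def using a(1,2) by force
    moreover have "k - i = a' - a" using a(3) by (simp add: algebra_simps)
    ultimately show False using that by simp
  qed
  define b where "b = card D"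
  define c where "c = card D3"
  \<comment> \<open>The bound of the previous lemma at \<open>s = t / sqrt n\<close>, with the
    common factor \<open>1 / sqrt n\<close> taken out.\<close>
  define c1 where "c1 = \<bar>t\<bar> * (K * (t * (b * K))\<^sup>2 / 2 + \<bar>t\<bar> * sqrt (c * (2 * (b * K\<^sup>2)\<^sup>2)))"
  show ?thesis
  proof (intro exI[of _ c1] allI impI)
    fix \<Gamma> :: "'i set" assume \<Gamma>: "finite \<Gamma>" "\<Gamma> \<noteq> {}"
    define n where "n = real (card \<Gamma>)"
    have n: "n > 0" using \<Gamma> by (simp add: n_def card_gt_0_iff)
    define Nb where "Nb i = {k \<in> \<Gamma>. k - i \<in> D}" for i
    define s where "s = t / sqrt n"
    have S: "field_sum \<Gamma> Z = (\<lambda>x. \<Sum>i\<in>\<Gamma>. Y i x)" by (simp add: field_sum_def[abs_def] Y_def)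
    have bound: "\<bar>\<Sum>j\<in>J. Y j x\<bar> \<le> card J * K" if "x \<in> space P" for J x
    proof -
      have "\<bar>\<Sum>j\<in>J. Y j x\<bar> \<le> (\<Sum>j\<in>J. \<bar>Y j x\<bar>)" by (rule sum_abs)
      also have "\<dots> \<le> card J * K" using Y_bd[OF that] by (rule sum_bounded_above)
      finally show ?thesis .
    qed
    have main: "cmod ((\<integral>x. iexp (s * (\<Sum>i\<in>\<Gamma>. Y i x)) \<partial>P)
        - exp (- ((\<integral>x. (\<Sum>i\<in>\<Gamma>. Y i x)\<^sup>2 \<partial>P) * s\<^sup>2 / 2))) \<le>
      \<bar>s\<bar> * (card \<Gamma> * (K * (s * (b * K))\<^sup>2 / 2) + \<bar>s\<bar> * sqrt (card \<Gamma> * (c * (2 * (b * K\<^sup>2)\<^sup>2))))"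
    proof (rule P.local_dependence_char_bound[where Nb = Nb and Mb = Mb])
      show "finite \<Gamma>" by fact
      fix i assume i: "i \<in> \<Gamma>"
      show "Nb i \<subseteq> \<Gamma>" by (auto simp: Nb_def)
      have "Nb i \<subseteq> (\<lambda>d. i + d) ` D"
      proof
        fix k assume "k \<in> Nb i"
        then have "k - i \<in> D" "k = i + (k - i)" by (auto simp: Nb_def)
        then show "k \<in> (\<lambda>d. i + d) ` D" by blast
      qed
      then show "card (Nb i) \<le> b"
        unfolding b_def using fin(1) by (meson card_image_le card_mono finite_imageI order_trans)
      show "card (Mb i) \<le> c" "finite (Mb i)"
        unfolding Mb_def c_def using fin(2) by (auto intro: card_image_le)
      show "(\<integral>x. Y i x * iexp (s * (\<Sum>k\<in>\<Gamma> - Nb i. Y k x)) \<partial>P) = 0" for s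
      proof -
        let ?h = "\<lambda>x. iexp (s * (\<Sum>k\<in>\<Gamma> - Nb i. Y k x))"
        have "(\<integral>x. complex_of_real (Y i x) * ?h x \<partial>P) = (\<integral>x. complex_of_real (Y i x) \<partial>P) * (\<integral>x. ?h x \<partial>P)"
        proof (rule integral_mult_disjoint)
          show "depends_on (C i) (\<lambda>x. complex_of_real (Y i x))" by (rule depends_on_compose[OF Y_dep])
          have "depends_on (\<Union>k\<in>\<Gamma> - Nb i. C k) (\<lambda>x. \<Sum>k\<in>\<Gamma> - Nb i. Y k x)"
            by (rule depends_on_sum) (rule Y_dep)
          then show "depends_on (\<Union>k\<in>\<Gamma> - Nb i. C k) ?h" by (rule depends_on_compose)
          show "C i \<inter> (\<Union>k\<in>\<Gamma> - Nb i. C k) = {}" using disj by (auto simp: Nb_def)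
          show "cmod (complex_of_real (Y i x)) \<le> K" if "x \<in> space P" for x using Y_bd[OF that] by simp
          show "cmod (?h x) \<le> 1" for x by simp
        qed measurable
        then show ?thesis by (simp add: Y_mean)
      qed
      fix k
      show "(\<integral>x. Y i x * Y k x \<partial>P) = 0" if "k \<in> \<Gamma> - Nb i"
      proof -
        have "C i \<inter> C k = {}" using that by (intro disj) (auto simp: Nb_def)
        then have "(\<integral>x. Y i x * Y k x \<partial>P) = (\<integral>x. Y i x \<partial>P) * (\<integral>x. Y k x \<partial>P)"
          using Y_bd by (intro integral_mult_disjoint[where C = "C i" and D = "C k" and K = K and L = K] Y Y_dep) auto
        then show ?thesis by (simp add: Y_mean)
      qed
      show "(\<integral>x. (Y i x * (\<Sum>j\<in>Nb i. Y j x)) * (Y k x * (\<Sum>j\<in>Nb k. Y j x)) \<partial>P) =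
        (\<integral>x. Y i x * (\<Sum>j\<in>Nb i. Y j x) \<partial>P) * (\<integral>x. Y k x * (\<Sum>j\<in>Nb k. Y j x) \<partial>P)"
        if k: "k \<in> \<Gamma> - Mb i"
      proof -
        have T_bd: "norm (Y i x * (\<Sum>j\<in>Nb i. Y j x)) \<le> K * (card (Nb i) * K)" if "x \<in> space P" for i x
          using mult_mono[OF Y_bd[OF that, of i] bound[OF that, of "Nb i"]] order_trans[OF abs_ge_zero Y_bd[OF that]]
          by (simp add: abs_mult)
        have T_dep: "depends_on (C i \<union> (\<Union>j\<in>Nb i. C j)) (\<lambda>x. Y i x * (\<Sum>j\<in>Nb i. Y j x))" for i
          by (intro depends_on_mult depends_on_sum Y_dep)
        have "C j \<inter> C j' = {}" if j: "j \<in> insert i (Nb i)" "j' \<in> insert k (Nb k)" for j j'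
        proof (rule disj)
          show "j' - j \<notin> D"
          proof
            assume d: "j' - j \<in> D"
            have "j - i \<in> insert 0 D" "j' - k \<in> insert 0 D" using j by (auto simp: Nb_def)
            with d have "((j - i, j' - k), j' - j) \<in> (insert 0 D \<times> insert 0 D) \<times> D"
              by (intro SigmaI)
            then have "(j - i) - (j' - k) + (j' - j) \<in> D3"
              unfolding D3_def by (rule image_eqI[rotated]) simp
            moreover have "k = i + ((j - i) - (j' - k) + (j' - j))" by simp
            ultimately have "k \<in> Mb i" unfolding Mb_def by blast
            then show False using k by simp
          qed
        qed
        then have "(C i \<union> (\<Union>j\<in>Nb i. C j)) \<inter> (C k \<union> (\<Union>j\<in>Nb k. C j)) = {}" by blast
        then show ?thesis
          by (intro integral_mult_disjoint[OF _ _ T_bd T_bd T_dep T_dep]) measurable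
      qed
    qed (use Y Y_bd in auto)
    have s2: "s\<^sup>2 = t\<^sup>2 / n" using n by (simp add: s_def power_divide)
    have "\<bar>s\<bar> * (card \<Gamma> * (K * (s * (b * K))\<^sup>2 / 2) + \<bar>s\<bar> * sqrt (card \<Gamma> * (c * (2 * (b * K\<^sup>2)\<^sup>2)))) =
      c1 / sqrt n"
    proof -
      have "n * (K * (s * (b * K))\<^sup>2 / 2) = K * (t * (b * K))\<^sup>2 / 2"
        using n by (simp add: power_mult_distrib s2)
      moreover have "\<bar>s\<bar> * sqrt (n * (c * (2 * (b * K\<^sup>2)\<^sup>2))) = \<bar>t\<bar> * sqrt (c * (2 * (b * K\<^sup>2)\<^sup>2))"
        using n by (simp add: s_def real_sqrt_mult)
      moreover have "\<bar>s\<bar> = \<bar>t\<bar> / sqrt n" using n by (simp add: s_def)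
      ultimately show ?thesis by (simp add: c1_def n_def)
    qed
    with main show "cmod ((\<integral>x. iexp (t * (field_sum \<Gamma> Z x / sqrt (card \<Gamma>))) \<partial>P)
      - exp (- ((\<integral>x. (field_sum \<Gamma> Z x)\<^sup>2 \<partial>P) / card \<Gamma> * t\<^sup>2 / 2))) \<le> c1 / sqrt (card \<Gamma>)"
      unfolding S n_def[symmetric] s2 by (simp add: s_def)
  qed
qed

text \<open>Three errors: replacing the field by its local approximation in the characteristic
  function, the local estimate, and exchanging the two variances in the Gaussian. The first and
  third are proportional to \<open>\<eta>\<close> uniformly in the set. The constant
  \<open>c\<close> of the second depends on the approximation, so \<open>\<eta>\<close> is fixed
  before \<open>n\<close> grows.\<close>

theorem char_field_sum_tendsto:
  assumes F: "square_integrable P F" "(\<integral>x. F x \<partial>P) = 0"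
    and summable: "(\<lambda>a. delta a F) summable_on UNIV"
    and fin: "eventually (\<lambda>n. finite (\<Gamma> n)) sequentially"
    and card: "filterlim (\<lambda>n. card (\<Gamma> n)) at_top sequentially"
  shows "(\<lambda>n. (\<integral>x. iexp (t * (field_sum (\<Gamma> n) F x / sqrt (card (\<Gamma> n)))) \<partial>P)
      - exp (- ((\<integral>x. (field_sum (\<Gamma> n) F x)\<^sup>2 \<partial>P) / card (\<Gamma> n) * t\<^sup>2 / 2))) \<longlonglongrightarrow> 0"
proof (rule LIMSEQ_I)
  fix e :: real assume "e > 0"
  define \<Delta> where "\<Delta> = infsum (\<lambda>a. delta a F) UNIV"
  have \<Delta>: "(\<Sum>a\<in>B. delta a F) \<le> \<Delta>" if "finite B" for B
    unfolding \<Delta>_def using that summable by (intro finite_sum_le_infsum) auto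
  have \<Delta>0: "\<Delta> \<ge> 0" using \<Delta>[of "{}"] by simp
  \<comment> \<open>Total coefficient of \<open>\<eta>\<close>: \<open>\<bar>t\<bar>\<close> from
    the field and the rest from the variance.\<close>
  define L where "L = \<bar>t\<bar> + (2 * \<Delta> + 1) * t\<^sup>2 / 2"
  have L: "L \<ge> 0" using \<Delta>0 by (simp add: L_def)
  \<comment> \<open>The bound \<open>1\<close> keeps \<open>p + q\<close> below
    \<open>2 * \<Delta> + 1\<close>; adding \<open>1\<close> to \<open>L\<close> covers
    \<open>t = 0\<close>.\<close>
  define \<eta> where "\<eta> = min 1 (e / (2 * (L + 1)))"
  have \<eta>: "\<eta> > 0" "\<eta> \<le> 1" using \<open>e > 0\<close> L by (auto simp: \<eta>_def)
  have "\<eta> * L \<le> e / (2 * (L + 1)) * (L + 1)"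
    using L \<eta> \<open>e > 0\<close> by (intro mult_mono) (auto simp: \<eta>_def)
  also have "\<dots> = e / 2"
  proof -
    have "L + 1 \<noteq> 0" using L by linarith
    then show ?thesis by (simp add: divide_simps)
  qed
  finally have \<eta>L: "\<eta> * L \<le> e / 2" .
  obtain A Z K where Z: "finite A" "Z \<in> borel_measurable P" "\<And>x. x \<in> space P \<Longrightarrow> \<bar>Z x\<bar> \<le> K"
    "depends_on A Z" "(\<integral>x. Z x \<partial>P) = 0"
    "\<And>B. finite B \<Longrightarrow> (\<Sum>a\<in>B. delta a (\<lambda>x. F x - Z x)) \<le> \<eta>"
    by (rule local_bounded_approximation[OF F(1) summable \<eta>(1)]) (rule that)
  have sqZ: "square_integrable P Z" by (rule P.square_integrable_bounded[OF Z(2,3)])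
  have FZ: "square_integrable P (\<lambda>x. F x - Z x)" by (rule square_integrable_diff[OF F(1) sqZ])
  have FZ0: "(\<integral>x. F x - Z x \<partial>P) = 0"
    using P.square_integrable_integrable[OF F(1)] P.square_integrable_integrable[OF sqZ] F(2) Z(5) by simp
  obtain c where c: "\<And>\<Gamma>. finite \<Gamma> \<Longrightarrow> \<Gamma> \<noteq> {} \<Longrightarrow>
    cmod ((\<integral>x. iexp (t * (field_sum \<Gamma> Z x / sqrt (card \<Gamma>))) \<partial>P)
      - exp (- ((\<integral>x. (field_sum \<Gamma> Z x)\<^sup>2 \<partial>P) / card \<Gamma> * t\<^sup>2 / 2))) \<le> c / sqrt (card \<Gamma>)"
    using local_field_char_bound[OF Z(1-5), of t] by blast
  have bound: "cmod ((\<integral>x. iexp (t * (field_sum \<Gamma> F x / sqrt (card \<Gamma>))) \<partial>P)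
      - exp (- ((\<integral>x. (field_sum \<Gamma> F x)\<^sup>2 \<partial>P) / card \<Gamma> * t\<^sup>2 / 2))) \<le> e / 2 + c / sqrt (card \<Gamma>)"
    if \<Gamma>: "finite \<Gamma>" "\<Gamma> \<noteq> {}" for \<Gamma>
  proof -
    define n where "n = real (card \<Gamma>)"
    have n: "n > 0" using \<Gamma> by (simp add: n_def card_gt_0_iff)
    let ?S = "field_sum \<Gamma> F" and ?V = "field_sum \<Gamma> Z" and ?R = "field_sum \<Gamma> (\<lambda>x. F x - Z x)"
    note sS = square_integrable_field_sum[OF F(1), of \<Gamma>] and sV = square_integrable_field_sum[OF sqZ, of \<Gamma>]
      and sR = square_integrable_field_sum[OF FZ, of \<Gamma>]
    have [measurable]: "?S \<in> borel_measurable P" "?V \<in> borel_measurable P"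
      using sS sV by (simp_all add: square_integrable_def)
    define p where "p = l2norm P ?S / sqrt n"
    define q where "q = l2norm P ?V / sqrt n"
    have R: "l2norm P ?R \<le> sqrt n * \<eta>"
      unfolding n_def by (rule l2norm_field_sum_le[OF FZ FZ0 Z(6)])
    have p: "0 \<le> p" "p \<le> \<Delta>"
      using l2norm_field_sum_le[OF F \<Delta>, of \<Gamma>] n by (auto simp: p_def n_def field_simps)
    have q: "0 \<le> q" using n by (simp add: q_def)
    have pq: "\<bar>p - q\<bar> \<le> \<eta>"
    proof -
      have "l2norm P ?S \<le> l2norm P ?V + l2norm P ?R"
        using l2norm_le_add_diff[OF sS sV] by (simp add: field_sum_diff[abs_def])
      moreover have "l2norm P ?V \<le> l2norm P ?S + l2norm P ?R"
        using l2norm_diff_le[OF sS sR] by (simp add: field_sum_diff[abs_def])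
      ultimately have "\<bar>l2norm P ?S - l2norm P ?V\<bar> \<le> sqrt n * \<eta>" using R by linarith
      then show ?thesis using n by (simp add: p_def q_def pos_divide_le_eq mult.commute flip: diff_divide_distrib)
    qed
    have var: "\<bar>p\<^sup>2 - q\<^sup>2\<bar> \<le> \<eta> * (2 * \<Delta> + 1)"
    proof -
      have "\<bar>p\<^sup>2 - q\<^sup>2\<bar> = \<bar>p - q\<bar> * (p + q)"
        using p(1) q by (simp add: power2_eq_square square_diff_square_factored abs_mult)
      also have "\<dots> \<le> \<eta> * (2 * \<Delta> + 1)" using pq p q \<eta> by (intro mult_mono) auto
      finally show ?thesis .
    qed
    have p2: "(\<integral>x. (?S x)\<^sup>2 \<partial>P) / n = p\<^sup>2" and q2: "(\<integral>x. (?V x)\<^sup>2 \<partial>P) / n = q\<^sup>2"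
      using n by (simp_all add: p_def q_def power_divide l2norm_power2)
    have int: "integrable P (\<lambda>x. iexp (t * (?S x / sqrt n)))" "integrable P (\<lambda>x. iexp (t * (?V x / sqrt n)))"
      by (auto intro!: P.integrable_const_bound[where B = 1])
    have "cmod ((\<integral>x. iexp (t * (?S x / sqrt n)) \<partial>P) - (\<integral>x. iexp (t * (?V x / sqrt n)) \<partial>P)) =
        cmod (\<integral>x. iexp (t * (?S x / sqrt n)) - iexp (t * (?V x / sqrt n)) \<partial>P)"
      using int by simp
    also have "\<dots> \<le> (\<integral>x. \<bar>t\<bar> / sqrt n * \<bar>?R x\<bar> \<partial>P)"
    proof (rule cmod_integral_le)
      fix x
      have "cmod (iexp (t * (?S x / sqrt n)) - iexp (t * (?V x / sqrt n))) \<le>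
          \<bar>t * (?S x / sqrt n) - t * (?V x / sqrt n)\<bar>"
        by (rule cmod_iexp_diff_le)
      also have "t * (?S x / sqrt n) - t * (?V x / sqrt n) = t / sqrt n * ?R x"
        by (simp add: field_sum_diff diff_divide_distrib right_diff_distrib)
      also have "\<bar>t / sqrt n * ?R x\<bar> = \<bar>t\<bar> / sqrt n * \<bar>?R x\<bar>" using n by (simp add: abs_mult)
      finally show "cmod (iexp (t * (?S x / sqrt n)) - iexp (t * (?V x / sqrt n))) \<le> \<bar>t\<bar> / sqrt n * \<bar>?R x\<bar>" .
    qed (use int P.square_integrable_integrable[OF sR] in auto)
    also have "\<dots> = \<bar>t\<bar> / sqrt n * (\<integral>x. \<bar>?R x\<bar> \<partial>P)" by simp
    also have "\<dots> \<le> \<bar>t\<bar> / sqrt n * (sqrt n * \<eta>)"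
      using P.integral_abs_le_l2norm[OF sR] R n by (intro mult_left_mono) auto
    also have "\<dots> = \<bar>t\<bar> * \<eta>" using n by simp
    finally have 1: "cmod ((\<integral>x. iexp (t * (?S x / sqrt n)) \<partial>P) - (\<integral>x. iexp (t * (?V x / sqrt n)) \<partial>P)) \<le> \<bar>t\<bar> * \<eta>" .
    have 2: "cmod ((\<integral>x. iexp (t * (?V x / sqrt n)) \<partial>P) - exp (- (q\<^sup>2 * t\<^sup>2 / 2))) \<le> c / sqrt n"
      using c[OF \<Gamma>] unfolding n_def[symmetric] q2 .
    have 3: "cmod (exp (- (q\<^sup>2 * t\<^sup>2 / 2)) - complex_of_real (exp (- (p\<^sup>2 * t\<^sup>2 / 2)))) \<le> \<eta> * (2 * \<Delta> + 1) * t\<^sup>2 / 2"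
    proof -
      have "cmod (complex_of_real (exp (- (q\<^sup>2 * t\<^sup>2 / 2))) - complex_of_real (exp (- (p\<^sup>2 * t\<^sup>2 / 2)))) =
          \<bar>exp (- (q\<^sup>2 * t\<^sup>2 / 2)) - exp (- (p\<^sup>2 * t\<^sup>2 / 2))\<bar>"
        by (metis norm_of_real of_real_diff)
      also have "\<dots> \<le> \<bar>q\<^sup>2 * t\<^sup>2 / 2 - p\<^sup>2 * t\<^sup>2 / 2\<bar>" by (rule abs_exp_minus_diff_le) auto
      also have "q\<^sup>2 * t\<^sup>2 / 2 - p\<^sup>2 * t\<^sup>2 / 2 = - ((p\<^sup>2 - q\<^sup>2) * (t\<^sup>2 / 2))" by (simp add: field_simps)
      also have "\<bar>- ((p\<^sup>2 - q\<^sup>2) * (t\<^sup>2 / 2))\<bar> = \<bar>p\<^sup>2 - q\<^sup>2\<bar> * (t\<^sup>2 / 2)" by (simp add: abs_mult)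
      also have "\<dots> \<le> \<eta> * (2 * \<Delta> + 1) * (t\<^sup>2 / 2)" using var by (intro mult_right_mono) auto
      finally show ?thesis by simp
    qed
    have "\<bar>t\<bar> * \<eta> + \<eta> * (2 * \<Delta> + 1) * t\<^sup>2 / 2 = \<eta> * L" by (simp add: L_def field_simps)
    then have "cmod ((\<integral>x. iexp (t * (?S x / sqrt n)) \<partial>P) - exp (- (p\<^sup>2 * t\<^sup>2 / 2))) \<le> e / 2 + c / sqrt n"
      using 1 2 3 \<eta>L
        norm_triangle_ineq[of "(\<integral>x. iexp (t * (?S x / sqrt n)) \<partial>P) - (\<integral>x. iexp (t * (?V x / sqrt n)) \<partial>P)"
          "(\<integral>x. iexp (t * (?V x / sqrt n)) \<partial>P) - exp (- (q\<^sup>2 * t\<^sup>2 / 2))"]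
        norm_triangle_ineq[of "(\<integral>x. iexp (t * (?S x / sqrt n)) \<partial>P) - exp (- (q\<^sup>2 * t\<^sup>2 / 2))"
          "exp (- (q\<^sup>2 * t\<^sup>2 / 2)) - complex_of_real (exp (- (p\<^sup>2 * t\<^sup>2 / 2)))"]
      by simp
    then show ?thesis unfolding n_def[symmetric] p2 .
  qed
  have "filterlim (\<lambda>n. sqrt (real (card (\<Gamma> n)))) at_top sequentially"
    by (intro filterlim_compose[OF sqrt_at_top] filterlim_compose[OF filterlim_real_sequentially card])
  then have "(\<lambda>n. c / sqrt (card (\<Gamma> n))) \<longlonglongrightarrow> 0"
    by (rule real_tendsto_divide_at_top[OF tendsto_const])
  then have "eventually (\<lambda>n. c / sqrt (card (\<Gamma> n)) < e / 2) sequentially"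
    by (rule order_tendstoD) (use \<open>e > 0\<close> in simp)
  moreover have "eventually (\<lambda>n. card (\<Gamma> n) \<ge> 1) sequentially"
    using card by (simp add: filterlim_at_top)
  ultimately have "eventually (\<lambda>n. cmod ((\<integral>x. iexp (t * (field_sum (\<Gamma> n) F x / sqrt (card (\<Gamma> n)))) \<partial>P)
      - exp (- ((\<integral>x. (field_sum (\<Gamma> n) F x)\<^sup>2 \<partial>P) / card (\<Gamma> n) * t\<^sup>2 / 2)) - 0) < e) sequentially"
    using fin
  proof eventually_elim
    case (elim n)
    then have "\<Gamma> n \<noteq> {}" by auto
    from bound[OF elim(3) this] elim(1) show ?case unfolding diff_zero by linarith
  qed
  then show "\<exists>no. \<forall>n\<ge>no. norm ((\<integral>x. iexp (t * (field_sum (\<Gamma> n) F x / sqrt (card (\<Gamma> n)))) \<partial>P)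
      - exp (- ((\<integral>x. (field_sum (\<Gamma> n) F x)\<^sup>2 \<partial>P) / card (\<Gamma> n) * t\<^sup>2 / 2)) - 0) < e"
    by (simp only: eventually_sequentially)
qed

end

section \<open>The Levy distance\<close>

lemma Levy_distance_le:
  assumes "e > 0" "\<And>x. cdf \<mu> (x - e) - e \<le> cdf \<nu> x" "\<And>x. cdf \<nu> x \<le> cdf \<mu> (x + e) + e"
  shows "Levy_distance \<mu> \<nu> \<le> e"
  unfolding Levy_distance_def
  by (rule cInf_lower) (use assms in \<open>auto intro!: bdd_belowI[of _ 0]\<close>)

text \<open>The point is that the infimum is over a nonempty set: \<open>e = 1\<close> is always
  admissible, as distribution functions take values between 0 and 1.\<close>

lemma Levy_distance_nonneg:
  assumes "real_distribution \<mu>" "real_distribution \<nu>"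
  shows "0 \<le> Levy_distance \<mu> \<nu>"
proof -
  interpret \<mu>: real_distribution \<mu> by fact
  interpret \<nu>: real_distribution \<nu> by fact
  have "cdf \<mu> (x - 1) - 1 \<le> cdf \<nu> x \<and> cdf \<nu> x \<le> cdf \<mu> (x + 1) + 1" for x
    using \<mu>.cdf_bounded_prob[of "x - 1"] \<nu>.cdf_bounded_prob[of x] \<mu>.cdf_nonneg[of "x + 1"] \<nu>.cdf_nonneg[of x]
    by linarith
  then have "1 \<in> {e. e > 0 \<and> (\<forall>x. cdf \<mu> (x - e) - e \<le> cdf \<nu> x \<and> cdf \<nu> x \<le> cdf \<mu> (x + e) + e)}"
    by simp
  then show ?thesis
    unfolding Levy_distance_def by (intro cInf_greatest) (blast, simp)
qed

text \<open>Between grid points \<open>x\<close> is rounded down to some \<open>c j\<close>; the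
  next point is at most \<open>e\<close> further, so \<open>x - e\<close> lies below
  \<open>c j\<close> and monotonicity transfers the comparison. Beyond the grid, \<open>F\<close> is
  nearly \<open>0\<close> or \<open>G\<close> nearly \<open>1\<close>.\<close>

lemma shifted_le_on_grid:
  fixes F G :: "real \<Rightarrow> real" and c :: "int \<Rightarrow> real"
  assumes F: "mono F" "\<And>x. F x \<le> 1" and G: "mono G" "\<And>x. 0 \<le> G x"
    and c: "\<And>j. c (j + 1) \<le> c j + e"
    and grid: "\<And>j. j \<in> {- m..m} \<Longrightarrow> F (c j) \<le> G (c j) + e" and "0 \<le> m" "0 < e"
    and lo: "F (c (- m)) \<le> e" and hi: "1 - e \<le> G (c m)"
  shows "F (x - e) - e \<le> G x"
proof -
  consider "x < c (- m)" | "c m \<le> x" | "c (- m) \<le> x" "x < c m" by linarith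
  then show ?thesis
  proof cases
    case 1
    then have "F (x - e) \<le> F (c (- m))" using \<open>0 < e\<close> by (intro monoD[OF F(1)]) simp
    then show ?thesis using lo G(2)[of x] by linarith
  next
    case 2
    then have "G (c m) \<le> G x" by (rule monoD[OF G(1)])
    then show ?thesis using hi F(2)[of "x - e"] by linarith
  next
    case 3
    \<comment> \<open>Since \<open>c\<close> is not assumed increasing, \<open>j\<close> is taken as
      the largest admissible index with \<open>c j \<le> x\<close>; its successor then lies beyond
      \<open>x\<close>.\<close>
    define A where "A = {k \<in> {- m..m}. c k \<le> x}"
    have "A \<subseteq> {- m..m}" by (auto simp: A_def)
    then have "finite A" by (rule finite_subset) simp
    moreover have "- m \<in> A" using 3 \<open>0 \<le> m\<close> by (simp add: A_def)
    ultimately have A: "finite A" "- m \<in> A" by auto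
    define j where "j = Max A"
    have j: "j \<in> A" unfolding j_def using A by (intro Max_in) auto
    then have "j \<noteq> m" using 3 by (auto simp: A_def)
    then have "j + 1 \<in> {- m..m}" using j by (auto simp: A_def)
    moreover have "j + 1 \<notin> A" using Max_ge[OF A(1), of "j + 1"] unfolding j_def by auto
    ultimately have "x < c (j + 1)" by (auto simp: A_def)
    then have "F (x - e) \<le> F (c j)" using c[of j] by (intro monoD[OF F(1)]) simp
    also have "\<dots> \<le> G (c j) + e" using grid j by (auto simp: A_def)
    also have "G (c j) \<le> G x" using j by (intro monoD[OF G(1)]) (auto simp: A_def)
    finally show ?thesis by simp
  qed
qed

lemma (in real_distribution) exists_isCont_cdf:
  assumes "a < b" shows "\<exists>x. a < x \<and> x < b \<and> isCont (cdf M) x"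
proof -
  have "uncountable ({a<..<b} - {x. measure M {x} > 0})"
    using assms by (intro uncountable_minus_countable countable_atoms) (simp add: uncountable_open_interval)
  then obtain x where "x \<in> {a<..<b} - {x. measure M {x} > 0}"
    by (metis countable_empty ex_in_conv)
  then have "a < x" "x < b" "measure M {x} = 0"
    using measure_nonneg[of M "{x}"] by (auto simp del: measure_nonneg)
  then show ?thesis using isCont_cdf by blast
qed

text \<open>Weak convergence controls distribution functions only at continuity points of the limit,
  so the grid is made of such points. Finitely many carry all but a small part of the limit mass,
  and at each both laws are eventually within \<open>e / 2\<close> of the limit.\<close>

lemma weak_conv_imp_Levy_distance_le:
  assumes \<mu>: "\<And>n. real_distribution (\<mu> n)" and \<nu>: "\<And>n. real_distribution (\<nu> n)"
    and \<rho>: "real_distribution \<rho>"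
    and conv: "weak_conv_m \<mu> \<rho>" "weak_conv_m \<nu> \<rho>" and "e > 0"
  shows "eventually (\<lambda>n. Levy_distance (\<mu> n) (\<nu> n) \<le> e) sequentially"
proof -
  interpret \<rho>: real_distribution \<rho> by fact
  \<comment> \<open>One continuity point in each cell of length \<open>e / 2\<close>, so that
    consecutive points are less than \<open>e\<close> apart.\<close>
  have "\<forall>j :: int. \<exists>x. j * (e / 2) < x \<and> x < (j + 1) * (e / 2) \<and> isCont (cdf \<rho>) x"
    using \<open>e > 0\<close> by (intro allI \<rho>.exists_isCont_cdf) simp
  then obtain c :: "int \<Rightarrow> real" where c: "\<And>j. j * (e / 2) < c j" "\<And>j. c j < (j + 1) * (e / 2)"
    "\<And>j. isCont (cdf \<rho>) (c j)"
    by metis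
  have step: "c (j + 1) \<le> c j + e" for j
    using c(1)[of j] c(2)[of "j + 1"] by (simp add: algebra_simps)
  have "eventually (\<lambda>x. cdf \<rho> x > 1 - e / 2) at_top"
    using \<open>e > 0\<close> by (intro order_tendstoD(1)[OF \<rho>.cdf_lim_at_top_prob]) simp
  then obtain X where X: "\<And>x. x \<ge> X \<Longrightarrow> cdf \<rho> x > 1 - e / 2"
    unfolding eventually_at_top_linorder by blast
  have "eventually (\<lambda>x. cdf \<rho> x < e / 2) at_bot"
    using \<open>e > 0\<close> by (intro order_tendstoD(2)[OF \<rho>.cdf_lim_at_bot]) simp
  then obtain X' where X': "\<And>x. x \<le> X' \<Longrightarrow> cdf \<rho> x < e / 2"
    unfolding eventually_at_bot_linorder by blast
  \<comment> \<open>\<open>c (- m)\<close> is only known to lie below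
    \<open>(1 - m) * (e / 2)\<close>, so the grid is one cell longer than the tails require.\<close>
  define m where "m = max 0 (\<lceil>(\<bar>X\<bar> + \<bar>X'\<bar>) / (e / 2)\<rceil> + 1)"
  have m: "m \<ge> 0" by (simp add: m_def)
  have "(\<bar>X\<bar> + \<bar>X'\<bar>) / (e / 2) + 1 \<le> real_of_int m" unfolding m_def by linarith
  then have "\<bar>X\<bar> + \<bar>X'\<bar> \<le> (m - 1) * (e / 2)"
    using \<open>e > 0\<close> by (simp add: field_simps)
  then have cm: "c m \<ge> X" "c (- m) \<le> X'"
    using c(1)[of m] c(2)[of "- m"] \<open>e > 0\<close> by (simp_all add: algebra_simps)
  have near: "eventually (\<lambda>n. \<forall>j\<in>{- m..m}. \<bar>cdf (\<kappa> n) (c j) - cdf \<rho> (c j)\<bar> < e / 2) sequentially"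
    if "weak_conv_m \<kappa> \<rho>" for \<kappa>
  proof (intro eventually_ball_finite ballI)
    fix j
    have "(\<lambda>n. cdf (\<kappa> n) (c j)) \<longlonglongrightarrow> cdf \<rho> (c j)"
      using that c(3) unfolding weak_conv_m_def weak_conv_def by blast
    from tendstoD[OF this, of "e / 2"] \<open>e > 0\<close>
    show "eventually (\<lambda>n. \<bar>cdf (\<kappa> n) (c j) - cdf \<rho> (c j)\<bar> < e / 2) sequentially"
      by (simp add: dist_real_def)
  qed simp
  show ?thesis
    using near[OF conv(1)] near[OF conv(2)]
  proof eventually_elim
    case (elim n)
    interpret a: real_distribution "\<mu> n" by fact
    interpret b: real_distribution "\<nu> n" by fact
    have mono: "mono (cdf (\<mu> n))" "mono (cdf (\<nu> n))"
      by (auto intro!: monoI a.cdf_nondecreasing b.cdf_nondecreasing)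
    have ends: "m \<in> {- m..m}" "- m \<in> {- m..m}" using m by auto
    have le: "cdf (\<mu> n) (c j) \<le> cdf (\<nu> n) (c j) + e" "cdf (\<nu> n) (c j) \<le> cdf (\<mu> n) (c j) + e"
      if "j \<in> {- m..m}" for j
      using bspec[OF elim(1) that] bspec[OF elim(2) that] by linarith+
    have lo: "cdf (\<mu> n) (c (- m)) \<le> e" "cdf (\<nu> n) (c (- m)) \<le> e"
      using bspec[OF elim(1) ends(2)] bspec[OF elim(2) ends(2)] X'[OF cm(2)] by linarith+
    have hi: "1 - e \<le> cdf (\<mu> n) (c m)" "1 - e \<le> cdf (\<nu> n) (c m)"
      using bspec[OF elim(1) ends(1)] bspec[OF elim(2) ends(1)] X[OF cm(1)] by linarith+
    show ?case
    proof (rule Levy_distance_le[OF \<open>e > 0\<close>])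
      fix x
      show "cdf (\<mu> n) (x - e) - e \<le> cdf (\<nu> n) x"
        by (rule shifted_le_on_grid[OF mono(1) a.cdf_bounded_prob mono(2) b.cdf_nonneg step le(1) m
              \<open>e > 0\<close> lo(1) hi(2)])
      \<comment> \<open>The upper inequality is the lower one at \<open>x + e\<close> with the two
        laws interchanged.\<close>
      have "cdf (\<nu> n) (x + e - e) - e \<le> cdf (\<mu> n) (x + e)"
        by (rule shifted_le_on_grid[OF mono(2) b.cdf_bounded_prob mono(1) a.cdf_nonneg step le(2) m
              \<open>e > 0\<close> lo(2) hi(1)])
      then show "cdf (\<nu> n) x \<le> cdf (\<mu> n) (x + e) + e" by simp
    qed
  qed
qed

text \<open>A description valid also for variance \<open>0\<close>, where the scaled standard normal
  variable is constant; the later facts on \<open>centered_normal\<close> need no case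
  distinction.\<close>

lemma centered_normal_eq_distr:
  assumes "v \<ge> 0"
  shows "centered_normal v = distr std_normal_distribution borel (\<lambda>x. sqrt v * x)"
proof -
  interpret std: real_distribution std_normal_distribution by (rule real_dist_normal_dist)
  show ?thesis
  proof (cases "v = 0")
    case True
    have "distr std_normal_distribution borel (\<lambda>x. 0) = return borel (0 :: real)"
    proof (rule measure_eqI)
      fix A :: "real set" assume "A \<in> sets (distr std_normal_distribution borel (\<lambda>x. 0))"
      then have A: "A \<in> sets borel" by simp
      show "emeasure (distr std_normal_distribution borel (\<lambda>x. 0)) A = emeasure (return borel 0) A"
        using A std.emeasure_space_1 by (subst emeasure_distr) (auto simp: indicator_def)
    qed simp
    then show ?thesis using True by (simp add: centered_normal_def)
  next
    case False
    then have pos: "sqrt v > 0" using assms by simp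
    have "distributed std_normal_distribution lborel (\<lambda>x. x) std_normal_density"
      by (auto simp: distributed_def intro!: distr_id2)
    from std.normal_density_affine[OF this, of "sqrt v" 0] pos
    have "distributed std_normal_distribution lborel (\<lambda>x. sqrt v * x) (normal_density 0 (sqrt v))"
      by simp
    then have "distr std_normal_distribution lborel (\<lambda>x. sqrt v * x) = density lborel (normal_density 0 (sqrt v))"
      by (simp add: distributed_def)
    moreover have "distr std_normal_distribution lborel (\<lambda>x. sqrt v * x) =
        distr std_normal_distribution borel (\<lambda>x. sqrt v * x)"
      by (rule distr_cong) auto
    ultimately show ?thesis using False by (simp add: centered_normal_def)
  qed
qed

lemma real_distribution_centered_normal:
  assumes "v \<ge> 0" shows "real_distribution (centered_normal v)"
proof -
  interpret std: real_distribution std_normal_distribution by (rule real_dist_normal_dist)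
  show ?thesis unfolding centered_normal_eq_distr[OF assms] by (intro std.real_distribution_distr) simp
qed

lemma char_centered_normal:
  assumes "v \<ge> 0" shows "char (centered_normal v) t = exp (- (v * t\<^sup>2 / 2))"
proof -
  have "char (centered_normal v) t = char std_normal_distribution (t * sqrt v)"
    unfolding centered_normal_eq_distr[OF assms] char_def
    by (subst integral_distr) (auto simp: mult.assoc intro!: borel_measurable_continuous_onI continuous_intros)
  moreover have "- (t * sqrt v)\<^sup>2 / 2 = - (v * t\<^sup>2 / 2)"
    using assms by (simp add: power_mult_distrib mult.commute)
  ultimately show ?thesis by (simp only: char_std_normal_distribution)
qed

text \<open>The variances need not converge; boundedness gives a convergent subsequence of any bad
  subsequence, along which both laws converge weakly to the same Gaussian.\<close>

lemma Levy_distance_tendsto_0: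
  assumes \<mu>: "\<And>n. real_distribution (\<mu> n)"
    and v: "\<And>n. 0 \<le> v n" "\<And>n. v n \<le> C"
    and char: "\<And>t. (\<lambda>n. char (\<mu> n) t - exp (- (v n * t\<^sup>2 / 2))) \<longlonglongrightarrow> 0"
  shows "(\<lambda>n. Levy_distance (\<mu> n) (centered_normal (v n))) \<longlonglongrightarrow> 0"
proof (rule ccontr)
  let ?L = "\<lambda>n. Levy_distance (\<mu> n) (centered_normal (v n))"
  assume "\<not> ?L \<longlonglongrightarrow> 0"
  then obtain e where e: "e > 0" "\<not> eventually (\<lambda>n. dist (?L n) 0 < e) sequentially"
    unfolding tendsto_iff by blast
  then have "infinite {n. \<not> dist (?L n) 0 < e}"
    unfolding cofinite_eq_sequentially[symmetric] eventually_cofinite by simp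
  then obtain r :: "nat \<Rightarrow> nat" where r: "strict_mono r" "\<And>n. \<not> dist (?L (r n)) 0 < e"
    using infinite_enumerate by blast
  have "compact {0..C}" by simp
  then obtain l r' where l: "l \<in> {0..C}" "strict_mono r'" "((v \<circ> r) \<circ> r') \<longlonglongrightarrow> l"
    unfolding compact_def using v by (metis atLeastAtMost_iff comp_apply)
  define q where "q = r \<circ> r'"
  have q: "strict_mono q" using strict_mono_o[OF r(1) l(2)] by (simp add: q_def)
  have vq: "(\<lambda>n. v (q n)) \<longlonglongrightarrow> l" using l(3) by (simp add: q_def comp_def)
  have l0: "l \<ge> 0" using l(1) by simp
  have lim: "(\<lambda>n. complex_of_real (exp (- (v (q n) * t\<^sup>2 / 2)))) \<longlonglongrightarrow> complex_of_real (exp (- (l * t\<^sup>2 / 2)))" for t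
    by (intro tendsto_intros vq) simp
  have "weak_conv_m (\<lambda>n. centered_normal (v (q n))) (centered_normal l)"
  proof (rule levy_continuity)
    show "real_distribution (centered_normal (v (q n)))" "real_distribution (centered_normal l)" for n
      using v l0 by (auto intro: real_distribution_centered_normal)
    show "(\<lambda>n. char (centered_normal (v (q n))) t) \<longlonglongrightarrow> char (centered_normal l) t" for t
      using lim[of t] v(1) l0 by (simp add: char_centered_normal)
  qed
  moreover have "weak_conv_m (\<lambda>n. \<mu> (q n)) (centered_normal l)"
  proof (rule levy_continuity)
    show "real_distribution (\<mu> (q n))" "real_distribution (centered_normal l)" for n
      using \<mu> l0 by (auto intro: real_distribution_centered_normal)
    fix t
    have "(\<lambda>n. char (\<mu> (q n)) t - exp (- (v (q n) * t\<^sup>2 / 2))) \<longlonglongrightarrow> 0"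
      using LIMSEQ_subseq_LIMSEQ[OF char q] by (simp add: comp_def)
    from tendsto_add[OF this lim[of t]]
    show "(\<lambda>n. char (\<mu> (q n)) t) \<longlonglongrightarrow> char (centered_normal l) t"
      using l0 by (simp add: char_centered_normal)
  qed
  ultimately have "eventually (\<lambda>n. ?L (q n) \<le> e / 2) sequentially"
    using \<mu> v(1) l0 e(1)
    by (intro weak_conv_imp_Levy_distance_le[where \<rho> = "centered_normal l"]
        real_distribution_centered_normal) auto
  then obtain n where "?L (q n) \<le> e / 2"
    by (meson eventually_sequentially order_refl)
  moreover have "0 \<le> ?L (q n)"
    using \<mu> v(1) by (intro Levy_distance_nonneg real_distribution_centered_normal)
  ultimately show False using r(2)[of "r' n"] e(1) by (simp add: q_def)
qed

section \<open>Transfer from the given innovations to the product space\<close>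

lemma (in prob_space) iid_family_distr:
  fixes \<epsilon> :: "'i \<Rightarrow> 'a \<Rightarrow> 'e"
  assumes "iid_family M E \<epsilon>" and N: "\<And>j. distr M E (\<epsilon> j) = N"
  shows "(\<lambda>\<omega> j. \<epsilon> j \<omega>) \<in> measurable M (PiM UNIV (\<lambda>_. E))"
    "distr M (PiM UNIV (\<lambda>_. E)) (\<lambda>\<omega> j. \<epsilon> j \<omega>) = PiM UNIV (\<lambda>_. N)"
proof -
  have ind: "indep_vars (\<lambda>_. E) \<epsilon> UNIV" using assms(1) by (simp add: iid_family_def)
  then have rv: "\<epsilon> j \<in> measurable M E" for j by (simp add: indep_vars_def)
  then show "(\<lambda>\<omega> j. \<epsilon> j \<omega>) \<in> measurable M (PiM UNIV (\<lambda>_. E))" by (intro measurable_abs_UNIV)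
  show "distr M (PiM UNIV (\<lambda>_. E)) (\<lambda>\<omega> j. \<epsilon> j \<omega>) = PiM UNIV (\<lambda>_. N)"
    using indep_vars_iff_distr_eq_PiM[of UNIV \<epsilon> "\<lambda>_. E"] rv ind N by (simp add: restrict_def)
qed

lemma coupled_innovations_eq_resample:
  "coupled_innovations \<epsilon> \<epsilon>' j \<omega> = resample {0} (\<lambda>j. \<epsilon> j \<omega>) (\<lambda>j. \<epsilon>' j \<omega>) j"
  by (simp add: coupled_innovations_def resample_def)

lemma Lp_norm_2: "Lp_norm M 2 Z = l2norm M Z"
  by (simp add: Lp_norm_def l2norm_def powr_half_sqrt)

theorem theorem1:
  fixes M :: "'w measure" and E :: "'e measure"
    and \<epsilon> \<epsilon>' :: "int ^ 'd \<Rightarrow> 'w \<Rightarrow> 'e"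
    and g :: "(int ^ 'd \<Rightarrow> 'e) \<Rightarrow> real"
    and X :: "int ^ 'd \<Rightarrow> 'w \<Rightarrow> real"
    and \<Gamma> :: "nat \<Rightarrow> (int ^ 'd) set"
    and S :: "nat \<Rightarrow> 'w \<Rightarrow> real"
    and \<sigma>2 :: "nat \<Rightarrow> real"
  assumes "prob_space M"
    and "iid_family M E \<epsilon>"
    and "indep_iid_copy M E \<epsilon> \<epsilon>'"
    and "g \<in> borel_measurable (PiM UNIV (\<lambda>_. E))"
    and "\<And>i. X i = random_field g \<epsilon> i"
    and "integrable M (\<lambda>\<omega>. (X 0 \<omega>)\<^sup>2)"
    and "(\<integral>\<omega>. X 0 \<omega> \<partial>M) = 0"
    and "(\<lambda>i. phys_dep M g \<epsilon> \<epsilon>' i 2) summable_on UNIV"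
    and "\<And>n. n \<ge> 1 \<Longrightarrow> finite (\<Gamma> n)"
    and "filterlim (\<lambda>n. card (\<Gamma> n)) at_top sequentially"
    and "\<And>n \<omega>. S n \<omega> = (\<Sum>i\<in>\<Gamma> n. X i \<omega>)"
    and "\<And>n. \<sigma>2 n = (\<integral>\<omega>. (S n \<omega>)\<^sup>2 \<partial>M)"
    and "filterlim \<sigma>2 at_top sequentially"
  shows "(\<lambda>n. Levy_distance
            (distr M borel (\<lambda>\<omega>. S n \<omega> / sqrt (real (card (\<Gamma> n)))))
            (centered_normal (\<sigma>2 n / real (card (\<Gamma> n))))) \<longlonglongrightarrow> 0"
proof -
  interpret M: prob_space M by fact
  define N where "N = distr M E (\<epsilon> 0)"
  let ?PE = "PiM (UNIV :: (int ^ 'd) set) (\<lambda>_. E)"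
  let ?x = "\<lambda>\<omega> j. \<epsilon> j \<omega>" and ?y = "\<lambda>\<omega> j. \<epsilon>' j \<omega>"
  have \<epsilon>N: "distr M E (\<epsilon> j) = N" for j
    using assms(2) unfolding iid_family_def N_def by blast
  have "iid_family M E \<epsilon>'" and \<epsilon>'N: "distr M E (\<epsilon>' j) = N" for j
    using assms(3) \<epsilon>N unfolding indep_iid_copy_def by auto
  note x = M.iid_family_distr[OF assms(2) \<epsilon>N] and y = M.iid_family_distr[OF this(1) \<epsilon>'N]
  have "\<epsilon> 0 \<in> measurable M E"
    using assms(2) unfolding iid_family_def M.indep_vars_def by auto
  then interpret N: prob_space N unfolding N_def by (rule M.prob_space_distr)
  interpret iid_field N "TYPE(int ^ 'd)" by unfold_locales
  have sets_N: "sets N = sets E" by (simp add: N_def)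
  \<comment> \<open>\<open>P\<close> is the product of the common law \<open>N\<close>, while the
    hypotheses speak of the product of the space \<open>E\<close>; the sigma-algebras agree, so
    measurability carries over.\<close>
  have sets_P: "sets P = sets ?PE" by (rule sets_PiM_cong) (simp_all add: sets_N)
  have sets_PP: "sets PP = sets (?PE \<Otimes>\<^sub>M ?PE)" by (intro sets_pair_measure_cong sets_P)
  have xm: "?x \<in> measurable M P" and ym: "?y \<in> measurable M P"
    using x(1) y(1) measurable_cong_sets[OF refl sets_P] by auto
  have xd: "distr M P ?x = P"
    using x(2) distr_cong[OF refl sets_P, of M ?x ?x] by simp
  have zm: "(\<lambda>\<omega>. (?x \<omega>, ?y \<omega>)) \<in> measurable M PP" using xm ym by measurable
  have zd: "distr M PP (\<lambda>\<omega>. (?x \<omega>, ?y \<omega>)) = PP"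
  proof -
    have "M.indep_var ?PE ?x ?PE ?y" using assms(3) unfolding indep_iid_copy_def by simp
    then have "distr M ?PE ?x \<Otimes>\<^sub>M distr M ?PE ?y = distr M (?PE \<Otimes>\<^sub>M ?PE) (\<lambda>\<omega>. (?x \<omega>, ?y \<omega>))"
      unfolding M.indep_var_distribution_eq by blast
    then show ?thesis
      using x(2) y(2) distr_cong[OF refl sets_PP, of M "\<lambda>\<omega>. (?x \<omega>, ?y \<omega>)" "\<lambda>\<omega>. (?x \<omega>, ?y \<omega>)"] by simp
  qed
  have g [measurable]: "g \<in> borel_measurable P"
    using assms(4) measurable_cong_sets[OF sets_P refl] by auto
  have X: "X i \<omega> = g (translate i (?x \<omega>))" for i \<omega>
    by (simp add: assms(5) random_field_def translate_def)
  have S: "S n \<omega> = field_sum (\<Gamma> n) g (?x \<omega>)" for n \<omega>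
    by (simp add: assms(11) X field_sum_def)
  have integral_x: "(\<integral>\<omega>. f (?x \<omega>) \<partial>M) = (\<integral>x. f x \<partial>P)"
    if "f \<in> borel_measurable P" for f :: "_ \<Rightarrow> 'b :: {banach, second_countable_topology}"
    using integral_distr[OF xm that] by (simp add: xd)
  \<comment> \<open>The hypothesis concerns \<open>X 0\<close>, which is \<open>g\<close> after the
    reflection \<open>translate 0\<close>; invariance of \<open>P\<close> removes the
    reflection.\<close>
  have sq: "square_integrable P g"
  proof -
    have "integrable (distr M P ?x) (\<lambda>x. (g (translate 0 x))\<^sup>2)"
      using assms(6) xm by (subst integrable_distr_eq) (auto simp: X)
    then have "integrable P (\<lambda>x. (g (translate 0 x))\<^sup>2)" by (simp add: xd)
    then have "integrable (distr P P (translate 0)) (\<lambda>x. (g x)\<^sup>2)"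
      by (subst integrable_distr_eq) auto
    then show ?thesis using g by (simp add: distr_translate square_integrable_def)
  qed
  have mean: "(\<integral>x. g x \<partial>P) = 0"
    using assms(7) integral_x[of "\<lambda>x. g (translate 0 x)"] integral_translate[OF g, of 0] by (simp add: X)
  have "phys_dep M g \<epsilon> \<epsilon>' i 2 = delta i g" for i
  proof -
    have "phys_dep M g \<epsilon> \<epsilon>' i 2 =
        l2norm M (\<lambda>\<omega>. (\<lambda>z. g (translate i (fst z)) - g (translate i (resample {0} (fst z) (snd z)))) (?x \<omega>, ?y \<omega>))"
      by (simp add: phys_dep_def Lp_norm_2 random_field_def coupled_innovations_eq_resample translate_def)
    also have "\<dots> = delta 0 (\<lambda>x. g (translate i x))"
      unfolding delta_def
      by (rule l2norm_distr(2)[OF zm zd square_integrable_resample_diff[OF l2_translate(1)[OF sq]]])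
    also have "\<dots> = delta i g" by (simp add: delta_translate[OF sq])
    finally show ?thesis .
  qed
  then have summable: "(\<lambda>a. delta a g) summable_on UNIV" using assms(8) by simp
  define \<Delta> where "\<Delta> = infsum (\<lambda>a. delta a g) UNIV"
  have \<Delta>: "(\<Sum>a\<in>B. delta a g) \<le> \<Delta>" if "finite B" for B
    unfolding \<Delta>_def using that summable by (intro finite_sum_le_infsum) auto
  have [measurable]: "field_sum (\<Gamma> n) g \<in> borel_measurable P" for n
    using square_integrable_field_sum[OF sq] by (simp add: square_integrable_def)
  have var: "\<sigma>2 n = (\<integral>x. (field_sum (\<Gamma> n) g x)\<^sup>2 \<partial>P)" for n
    unfolding assms(12) S by (rule integral_x) measurable
  have "S n \<in> borel_measurable M" for n
    unfolding S[abs_def] by (rule measurable_compose[OF xm]) measurable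
  then have Sm: "(\<lambda>\<omega>. S n \<omega> / sqrt (real (card (\<Gamma> n)))) \<in> borel_measurable M" for n
    by (intro borel_measurable_divide borel_measurable_const)
  show ?thesis
  proof (rule Levy_distance_tendsto_0)
    show "real_distribution (distr M borel (\<lambda>\<omega>. S n \<omega> / sqrt (real (card (\<Gamma> n)))))" for n
      by (rule M.real_distribution_distr[OF Sm])
    show "0 \<le> \<sigma>2 n / real (card (\<Gamma> n))" for n by (simp add: var)
    \<comment> \<open>If the cardinality is \<open>0\<close>, as for an empty set or an infinite
      \<open>\<Gamma> 0\<close>, the quotient is \<open>0\<close> by convention.\<close>
    show "\<sigma>2 n / real (card (\<Gamma> n)) \<le> \<Delta>\<^sup>2" for n
    proof (cases "card (\<Gamma> n) = 0")
      case False
      have "\<sigma>2 n \<le> (sqrt (card (\<Gamma> n)) * \<Delta>)\<^sup>2"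
        unfolding var l2norm_power2[symmetric]
        by (intro power_mono l2norm_field_sum_le sq mean \<Delta>) auto
      then show ?thesis using False by (simp add: power_mult_distrib divide_le_eq mult.commute)
    qed simp
    fix t
    have char_eq: "char (distr M borel (\<lambda>\<omega>. S n \<omega> / sqrt (real (card (\<Gamma> n))))) t =
        (\<integral>x. iexp (t * (field_sum (\<Gamma> n) g x / sqrt (card (\<Gamma> n)))) \<partial>P)" for n
    proof -
      have "char (distr M borel (\<lambda>\<omega>. S n \<omega> / sqrt (real (card (\<Gamma> n))))) t =
          (\<integral>\<omega>. iexp (t * (S n \<omega> / sqrt (card (\<Gamma> n)))) \<partial>M)"
        unfolding char_def by (rule integral_distr[OF Sm]) measurable
      also have "\<dots> = (\<integral>x. iexp (t * (field_sum (\<Gamma> n) g x / sqrt (card (\<Gamma> n)))) \<partial>P)"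
        unfolding S by (rule integral_x) measurable
      finally show ?thesis .
    qed
    \<comment> \<open>Finiteness is given from index 1 on, hence eventually.\<close>
    have fin: "eventually (\<lambda>n. finite (\<Gamma> n)) sequentially"
      using eventually_ge_at_top[of 1] by eventually_elim (rule assms(9))
    show "(\<lambda>n. char (distr M borel (\<lambda>\<omega>. S n \<omega> / sqrt (real (card (\<Gamma> n))))) t
        - exp (- (\<sigma>2 n / real (card (\<Gamma> n)) * t\<^sup>2 / 2))) \<longlonglongrightarrow> 0"
      unfolding char_eq var by (rule char_field_sum_tendsto[OF sq mean summable fin assms(10)])
  qed
qed

end
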